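(* There is an absolute constant $C>0$ such that the following holds. For every $p>0$ there is $s_0\in(0,2)$ such that for every $s\in(s_0,2)$, every $\epsilon>0$, and every homeomorphism $f:\mathbb{C}\to\mathbb{C}$ with $p$-exponentially integrable distortion: with the gauge function $$h(t)=e^{-\frac{C\sqrt{p\tilde{C}}\,s}{\sqrt{2-s+\epsilon}}\log^{\frac12}\left(\frac1t\right)},$$ every set $A\subset\mathbb{C}$ for which $H^h(f(A))=0$ satisfies $H^s(A)=0$.
   Context: A sense-preserving homeomorphism $f:\mathbb{C}\to\mathbb{C}$ has finite distortion if $f\in W^{1,1}_{\mathrm{loc}}(\mathbb{C})$, its Jacobian satisfies $J_f\in L^1_{\mathrm{loc}}(\mathbb{C})$, and $|Df(z)|^2\le K(z)J_f(z)$ almost everywhere for some measurable $K\ge 1$ that is finite almost everywhere; here $|Df(z)|$ is the operator norm. The smallest such function is denoted $K_f$ (the distortion of $f$). For $p>0$, $f$ has $p$-exponentially integrable distortion if it has finite distortion and $e^{pK_f}\in L^1_{\mathrm{loc}}(\mathbb{C})$. For a gauge function $h$ (defined for small $t>0$, increasing, with $h(t)\to0$ as $t\to 0$), $H^h(E)=\lim_{\delta\to0}\inf\{\sum_i h(\mathrm{diam}\,U_i): E\subset\bigcup_i U_i,\ \mathrm{diam}\,U_i\le\delta\}$ is the generalized Hausdorff measure, and $H^s$ is the case $h(t)=t^s$. The constant $\tilde{C}>0$ is a fixed constant such that for all disjoint continua $E,F\subset\mathbb{C}$, the family $\Gamma$ of all paths connecting $E$ and $F$ satisfies $$M(\Gamma)\ge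 \tilde{C}\log\left(1+\frac{\min\{\mathrm{diam}(E),\mathrm{diam}(F)\}}{\mathrm{dist}(E,F)}\right),$$ where $M(\Gamma)=\inf_\rho\int_{\mathbb{C}}\rho^2\,dA$ is the (conformal) modulus, the infimum being over Borel functions $\rho:\mathbb{C}\to[0,\infty]$ with $\int_\gamma\rho\,|dz|\ge 1$ for every locally rectifiable $\gamma\in\Gamma$. *)

theory Defs
  imports "HOL-Complex_Analysis.Complex_Analysis"
begin

section \<open>Generalized Hausdorff measures\<close>

text \<open>
  Gauge functions are only defined for small \<open>t > 0\<close> and tend to \<open>0\<close> at \<open>0\<close>, so sets of
  diameter \<open>0\<close> (including the empty set) get the value \<open>0\<close>, whatever the formula for \<open>h\<close>
  yields at \<open>t = 0\<close>. The explicit boundedness is needed because \<^const>\<open>diameter\<close> is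
  unspecified on unbounded sets.
\<close>

definition gauge_at :: "(real \<Rightarrow> real) \<Rightarrow> real \<Rightarrow> ennreal" where
  "gauge_at h t = (if t = 0 then 0 else ennreal (h t))"

definition hausdorff_premeasure ::
    "(real \<Rightarrow> real) \<Rightarrow> real \<Rightarrow> 'a::metric_space set \<Rightarrow> ennreal" where
  "hausdorff_premeasure h \<delta> E =
     (INF U \<in> {U :: nat \<Rightarrow> 'a set. E \<subseteq> (\<Union>i. U i) \<and> (\<forall>i. bounded (U i) \<and> diameter (U i) \<le> \<delta>)}.
        \<Sum>i. gauge_at h (diameter (U i)))"

definition hausdorff_gauge_measure ::
    "(real \<Rightarrow> real) \<Rightarrow> 'a::metric_space set \<Rightarrow> ennreal" where
  "hausdorff_gauge_measure h E = Lim (at_right 0) (\<lambda>\<delta>. hausdorff_premeasure h \<delta> E)"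

definition hausdorff_measure :: "real \<Rightarrow> 'a::metric_space set \<Rightarrow> ennreal" where
  "hausdorff_measure s = hausdorff_gauge_measure (\<lambda>t. t powr s)"

section \<open>Weak derivatives in the plane\<close>

definition locally_integrable ::
    "(complex \<Rightarrow> 'b::{banach, second_countable_topology}) \<Rightarrow> bool" where
  "locally_integrable u \<longleftrightarrow> (\<forall>S. compact S \<longrightarrow> set_integrable lebesgue S u)"

primrec C_k :: "nat \<Rightarrow> (complex \<Rightarrow> real) \<Rightarrow> bool" where
  "C_k 0 \<phi> \<longleftrightarrow> continuous_on UNIV \<phi>"
| "C_k (Suc k) \<phi> \<longleftrightarrow> (\<forall>z. \<phi> differentiable (at z)) \<and>
     (\<forall>v \<in> {1, \<i>}. C_k k (\<lambda>z. frechet_derivative \<phi> (at z) v))"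

definition test_function :: "(complex \<Rightarrow> real) \<Rightarrow> bool" where
  "test_function \<phi> \<longleftrightarrow> (\<forall>k. C_k k \<phi>) \<and> compact (closure {z. \<phi> z \<noteq> 0})"

text \<open>The partial derivatives in \<open>x\<close> and \<open>y\<close> are those in the directions \<open>v = 1\<close> and \<open>v = \<i>\<close>.\<close>

definition has_weak_partial ::
    "complex \<Rightarrow> (complex \<Rightarrow> complex) \<Rightarrow> (complex \<Rightarrow> complex) \<Rightarrow> bool" where
  "has_weak_partial v f g \<longleftrightarrow> locally_integrable f \<and> locally_integrable g \<and>
     (\<forall>\<phi>. test_function \<phi> \<longrightarrow>
        (\<integral>z. frechet_derivative \<phi> (at z) v *\<^sub>R f z \<partial>lebesgue) = - (\<integral>z. \<phi> z *\<^sub>R g z \<partial>lebesgue))"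

definition W11_loc :: "(complex \<Rightarrow> complex) \<Rightarrow> bool" where
  "W11_loc f \<longleftrightarrow> locally_integrable f \<and> (\<forall>v \<in> {1, \<i>}. \<exists>g. has_weak_partial v f g)"

text \<open>Unique up to null sets; every notion below is insensitive to the representative chosen.\<close>

definition weak_partial :: "complex \<Rightarrow> (complex \<Rightarrow> complex) \<Rightarrow> complex \<Rightarrow> complex" where
  "weak_partial v f = (SOME g. has_weak_partial v f g)"

definition weak_differential :: "(complex \<Rightarrow> complex) \<Rightarrow> complex \<Rightarrow> complex \<Rightarrow> complex" where
  "weak_differential f z = (\<lambda>h. Re h *\<^sub>R weak_partial 1 f z + Im h *\<^sub>R weak_partial \<i> f z)"

definition jacobian :: "(complex \<Rightarrow> complex) \<Rightarrow> complex \<Rightarrow> real" where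
  "jacobian f z = Re (weak_partial 1 f z) * Im (weak_partial \<i> f z)
                - Im (weak_partial 1 f z) * Re (weak_partial \<i> f z)"

section \<open>Homeomorphisms of finite distortion\<close>

definition plane_homeomorphism :: "(complex \<Rightarrow> complex) \<Rightarrow> bool" where
  "plane_homeomorphism f \<longleftrightarrow> (\<exists>g. homeomorphism UNIV UNIV f g)"

text \<open>
  Images of positively oriented circles wind once, in the positive sense, around the image of
  the centre.
\<close>

definition sense_preserving :: "(complex \<Rightarrow> complex) \<Rightarrow> bool" where
  "sense_preserving f \<longleftrightarrow> (\<forall>z. \<forall>r>0. winding_number (f \<circ> circlepath z r) (f z) = 1)"

text \<open>
  A function \<open>K\<close> that is finite almost everywhere is given by a real-valued representative.
\<close>

definition distortion_bound :: "(complex \<Rightarrow> complex) \<Rightarrow> (complex \<Rightarrow> real) \<Rightarrow> bool" where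
  "distortion_bound f K \<longleftrightarrow> K \<in> borel_measurable lebesgue \<and> (\<forall>z. 1 \<le> K z) \<and>
     (AE z in lebesgue. (onorm (weak_differential f z))\<^sup>2 \<le> K z * jacobian f z)"

definition finite_distortion :: "(complex \<Rightarrow> complex) \<Rightarrow> bool" where
  "finite_distortion f \<longleftrightarrow> plane_homeomorphism f \<and> sense_preserving f \<and> W11_loc f \<and>
     locally_integrable (jacobian f) \<and> (\<exists>K. distortion_bound f K)"

text \<open>The smallest distortion bound \<open>K\<^sub>f\<close>, which is determined up to null sets.\<close>

definition is_distortion :: "(complex \<Rightarrow> complex) \<Rightarrow> (complex \<Rightarrow> real) \<Rightarrow> bool" where
  "is_distortion f K \<longleftrightarrow> distortion_bound f K \<and>
     (\<forall>K'. distortion_bound f K' \<longrightarrow> (AE z in lebesgue. K z \<le> K' z))"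

definition exp_integrable_distortion :: "real \<Rightarrow> (complex \<Rightarrow> complex) \<Rightarrow> bool" where
  "exp_integrable_distortion p f \<longleftrightarrow> finite_distortion f \<and>
     (\<exists>K. is_distortion f K \<and> locally_integrable (\<lambda>z. exp (p * K z)))"

section \<open>Modulus of path families\<close>

definition path_length :: "(real \<Rightarrow> complex) \<Rightarrow> real \<Rightarrow> real \<Rightarrow> ennreal" where
  "path_length \<gamma> a b =
     (SUP (n, \<tau>) \<in> UNIV \<times> {\<tau> :: nat \<Rightarrow> real. mono \<tau> \<and> range \<tau> \<subseteq> {a..b}}.
        ennreal (\<Sum>i<n. dist (\<gamma> (\<tau> i)) (\<gamma> (\<tau> (Suc i)))))"

text \<open>Paths live on the compact interval \<open>[0,1]\<close>, where local rectifiability is rectifiability.\<close>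

definition rectifiable :: "(real \<Rightarrow> complex) \<Rightarrow> bool" where
  "rectifiable \<gamma> \<longleftrightarrow> path \<gamma> \<and> path_length \<gamma> 0 1 < \<infinity>"

text \<open>
  The arc-length parametrization on \<open>[0, L]\<close>, where \<open>L\<close> is the length of \<open>\<gamma>\<close>. The choice of
  \<open>t\<close> is immaterial, as \<open>\<gamma>\<close> is constant wherever its length function is.
\<close>

definition arclength_param :: "(real \<Rightarrow> complex) \<Rightarrow> real \<Rightarrow> complex" where
  "arclength_param \<gamma> s = \<gamma> (SOME t. t \<in> {0..1} \<and> path_length \<gamma> 0 t = ennreal s)"

definition line_integral :: "(complex \<Rightarrow> ennreal) \<Rightarrow> (real \<Rightarrow> complex) \<Rightarrow> ennreal" where
  "line_integral \<rho> \<gamma> =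
     (\<integral>\<^sup>+ s. \<rho> (arclength_param \<gamma> s) * indicator {0..enn2real (path_length \<gamma> 0 1)} s \<partial>lborel)"

definition admissible :: "(real \<Rightarrow> complex) set \<Rightarrow> (complex \<Rightarrow> ennreal) \<Rightarrow> bool" where
  "admissible \<Gamma> \<rho> \<longleftrightarrow> \<rho> \<in> borel_measurable borel \<and>
     (\<forall>\<gamma>\<in>\<Gamma>. rectifiable \<gamma> \<longrightarrow> 1 \<le> line_integral \<rho> \<gamma>)"

definition modulus :: "(real \<Rightarrow> complex) set \<Rightarrow> ennreal" where
  "modulus \<Gamma> = (INF \<rho> \<in> {\<rho>. admissible \<Gamma> \<rho>}. \<integral>\<^sup>+ z. (\<rho> z)\<^sup>2 \<partial>lborel)"

definition connecting_paths :: "complex set \<Rightarrow> complex set \<Rightarrow> (real \<Rightarrow> complex) set" where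
  "connecting_paths E F = {\<gamma>. path \<gamma> \<and> pathstart \<gamma> \<in> E \<and> pathfinish \<gamma> \<in> F}"

definition continuum :: "complex set \<Rightarrow> bool" where
  "continuum E \<longleftrightarrow> compact E \<and> connected E \<and> E \<noteq> {}"

definition modulus_constant :: "real \<Rightarrow> bool" where
  "modulus_constant Ct \<longleftrightarrow> Ct > 0 \<and>
     (\<forall>E F. continuum E \<and> continuum F \<and> E \<inter> F = {} \<longrightarrow>
        modulus (connecting_paths E F)
          \<ge> ennreal (Ct * ln (1 + min (diameter E) (diameter F) / setdist E F)))"

end

theory Submission
  imports Defs "HOL-Real_Asymp.Real_Asymp"
begin

text \<open>
  Fix \<open>z \<noteq> q\<close>, let \<open>t = |f q - f z|\<close> and \<open>u = ln (max |f - f z| t / t)\<close>. The function \<open>u\<close> vanishes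
  on the preimage of the segment from \<open>f z\<close> to \<open>f q\<close>, a curve from \<open>z\<close> to \<open>q\<close>. A Poincare
  inequality on the smallest dyadic square \<open>Q\<^sub>n\<close> about \<open>z\<close> that this curve crosses, and a comparison
  of the integrals of \<open>u\<close> over consecutive dyadic squares \<open>Q\<^sub>j\<close> of side about \<open>2\<^sup>-\<^sup>j\<close>, bound \<open>ln (1/t)\<close>
  by a multiple of \<open>\<Sum>j\<le>n. 2\<^sup>j \<integral>\<^bsub>Q\<^sub>j\<^esub> |\<nabla>u|\<close>. As \<open>|Df|\<^sup>2 \<le> K J\<close>, Young's inequality splits the sum
  into a small multiple of \<open>\<integral> J / max |f - f z|\<^sup>2 t\<^sup>2\<close>, which is \<open>O(ln (1/t))\<close> by the area inequality
  and is absorbed, and a multiple of \<open>\<Sum>j\<le>n. 4\<^sup>j \<integral>\<^bsub>Q\<^sub>j\<^esub> K\<close>.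

  Outside a set of vanishing \<open>H\<^sup>s\<close>, the integral of \<open>exp (p K)\<close> over \<open>Q\<^sub>k\<close> is at most
  \<open>2\<^sup>-\<^sup>k\<^sup>(\<^sup>s\<^sup>-\<^sup>\<epsilon>\<^sup>)\<close> for large \<open>k\<close>, and by convexity the mean of \<open>K\<close> over \<open>Q\<^sub>k\<close> is \<open>O(k (2 - s + \<epsilon>) / p)\<close>.
  Hence \<open>ln (1/t) \<le> C\<^sub>z + C' (2 - s + \<epsilon>) / p * (ln (1/|q - z|))\<^sup>2\<close>, that is, \<open>|q - z|\<^sup>s \<le> M\<^sub>z h(t)\<close>,
  and covers of \<open>f ` A\<close> pull back to covers of \<open>A\<close>. The modulus enters only through an upper bound
  for its constant, as that bound makes a small absolute \<open>C\<close> work.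
\<close>

section \<open>Hausdorff measures\<close>

text \<open>No pointwise differentiability of the map is used: all that is extracted from the weak
  derivatives is absolute continuity on almost every line parallel to an axis. Every estimate is
  therefore an integrated increment bound along lines, and even the area inequality comes from
  lines: at a Lebesgue point of the derivatives, four well-chosen lines control the image of a small
  square. This costs a constant (128 instead of 1), which is harmless because only orders of
  magnitude matter. The square of the logarithm arises since about ln (1/|q - z|) scales each
  contribute a term of size linear in the scale index. No further factor may be lost there: at each
  point the weights 2^j of the squares containing it form a sum of distinct powers of 2, dominated
  by its largest term. The constant C = 2^-19 is composed as follows: 2^24 from the absorption, 2^3
  from summing over scales and 2^3 from passing from the number of scales to the logarithm give
  2^30, with root 2^15; the modulus constant is at most 72 < 2^8, with root below 2^4.\<close>

lemma premeasure_antimono: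
  "\<delta> \<le> \<delta>' \<Longrightarrow> hausdorff_premeasure h \<delta>' E \<le> hausdorff_premeasure h \<delta> E"
  unfolding hausdorff_premeasure_def by (rule INF_superset_mono) (auto intro: order_trans)

lemma premeasure_mono:
  "E \<subseteq> F \<Longrightarrow> hausdorff_premeasure h \<delta> E \<le> hausdorff_premeasure h \<delta> F"
  unfolding hausdorff_premeasure_def by (rule INF_superset_mono) auto

text \<open>Shrinking the scale leaves fewer admissible covers, so the premeasure grows as the scale
  decreases and its one-sided limit exists. This gives the \<open>Lim\<close> in the definition a
  value that can be computed with.\<close>

lemma hausdorff_gauge_measure_eq_SUP:
  "hausdorff_gauge_measure h E = (SUP \<delta>\<in>{0<..}. hausdorff_premeasure h \<delta> E)"
proof -
  let ?S = "SUP \<delta>\<in>{0<..}. hausdorff_premeasure h \<delta> E"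
  have "((\<lambda>\<delta>. hausdorff_premeasure h \<delta> E) \<longlongrightarrow> ?S) (at_right 0)"
  proof (rule order_tendstoI)
    fix a assume "a < ?S"
    then obtain d where d: "d > 0" "a < hausdorff_premeasure h d E"
      by (auto simp: less_SUP_iff)
    have "\<forall>\<^sub>F x in at_right 0. x < d" "\<forall>\<^sub>F x in at_right (0::real). 0 < x"
      using d(1) by (auto simp: eventually_at_right_less eventually_at_right_field)
    then show "\<forall>\<^sub>F x in at_right 0. a < hausdorff_premeasure h x E"
      by eventually_elim (use d premeasure_antimono in \<open>metis less_imp_le order_less_le_trans\<close>)
  next
    fix a assume "?S < a"
    have "\<forall>\<^sub>F x in at_right (0::real). 0 < x" by (simp add: eventually_at_right_less)
    then show "\<forall>\<^sub>F x in at_right 0. hausdorff_premeasure h x E < a"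
    proof eventually_elim
      case (elim x)
      then have "hausdorff_premeasure h x E \<le> ?S" by (intro SUP_upper) auto
      then show ?case using \<open>?S < a\<close> by simp
    qed
  qed
  then show ?thesis
    unfolding hausdorff_gauge_measure_def by (intro tendsto_Lim) auto
qed

lemma hausdorff_gauge_measure_eq_0_iff:
  "hausdorff_gauge_measure h E = 0 \<longleftrightarrow> (\<forall>\<delta>>0. hausdorff_premeasure h \<delta> E = 0)"
  unfolding hausdorff_gauge_measure_eq_SUP by (auto simp: SUP_eq_iff bot_ennreal[symmetric])

lemma premeasure_le_gauge:
  assumes "bounded S" "diameter S \<le> \<delta>"
  shows "hausdorff_premeasure h \<delta> S \<le> gauge_at h (diameter S)"
proof -
  let ?U = "\<lambda>i::nat. if i = 0 then S else {}"
  have "0 \<le> \<delta>" using assms diameter_ge_0 by (metis order_trans)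
  have "hausdorff_premeasure h \<delta> S \<le> (\<Sum>i. gauge_at h (diameter (?U i)))"
    unfolding hausdorff_premeasure_def
    by (rule INF_lower) (use assms \<open>0 \<le> \<delta>\<close> in \<open>auto split: if_splits\<close>)
  also have "\<dots> = (\<Sum>i\<in>{0}. gauge_at h (diameter (?U i)))"
    by (rule suminf_finite) (auto simp: gauge_at_def)
  finally show ?thesis by simp
qed

lemma premeasure_empty: "0 \<le> \<delta> \<Longrightarrow> hausdorff_premeasure h \<delta> {} = 0"
  using premeasure_le_gauge[of "{}" \<delta> h] by (simp add: gauge_at_def)

text \<open>Near-optimal covers with errors \<open>e / 2^(n+1)\<close> are merged into one sequence
  by the pairing \<open>prod_decode\<close>. The rule \<open>ennreal_le_epsilon\<close> lets the
  right side be finite, and finiteness is what makes near-optimal covers exist.\<close>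

lemma premeasure_UN_le:
  "hausdorff_premeasure h \<delta> (\<Union>n::nat. E n) \<le> (\<Sum>n. hausdorff_premeasure h \<delta> (E n))"
proof (rule ennreal_le_epsilon)
  let ?P = "\<lambda>n. hausdorff_premeasure h \<delta> (E n)"
  fix e :: real
  assume fin: "(\<Sum>n. ?P n) < top" and "0 < e"
  have finP: "?P n < top" for n
  proof -
    have "?P n \<le> (\<Sum>n. ?P n)" using sum_le_suminf[of ?P "{n}"] by auto
    then show ?thesis using fin by (rule order_le_less_trans)
  qed
  have "\<exists>U. (E n \<subseteq> (\<Union>i. U i) \<and> (\<forall>i. bounded (U i) \<and> diameter (U i) \<le> \<delta>)) \<and>
      (\<Sum>i::nat. gauge_at h (diameter (U i))) < ?P n + ennreal (e * (1/2)^Suc n)" for n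
  proof -
    have "?P n < ?P n + ennreal (e * (1/2)^Suc n)"
      using finP[of n] \<open>0 < e\<close> by (simp add: ennreal_zero_less_mult_iff less_top)
    then show ?thesis
      by (subst (asm) hausdorff_premeasure_def) (auto simp: INF_less_iff)
  qed
  then obtain U where U: "\<And>n. E n \<subseteq> (\<Union>i. U n i)" "\<And>n i. bounded (U n i)"
      "\<And>n i. diameter (U n i) \<le> \<delta>"
      "\<And>n. (\<Sum>i::nat. gauge_at h (diameter (U n i))) < ?P n + ennreal (e * (1/2)^Suc n)"
    by metis
  define V where "V = (\<lambda>k. case prod_decode k of (n, i) \<Rightarrow> U n i)"
  have "hausdorff_premeasure h \<delta> (\<Union>n::nat. E n) \<le> (\<Sum>k. gauge_at h (diameter (V k)))"
    unfolding hausdorff_premeasure_def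
  proof (rule INF_lower, safe)
    fix x n assume "x \<in> E n"
    then obtain i where "x \<in> U n i" using U(1) by auto
    then have "x \<in> V (prod_encode (n, i))" by (simp add: V_def)
    then show "x \<in> (\<Union>i. V i)" by blast
  qed (auto simp: V_def U split: prod.split)
  also have "\<dots> = (\<Sum>n. \<Sum>i. gauge_at h (diameter (U n i)))"
    using suminf_ennreal_2dimen[of "\<lambda>n. \<Sum>i. gauge_at h (diameter (U n i))"
        "\<lambda>(n, i). gauge_at h (diameter (U n i))"]
    by (simp add: V_def split_beta)
  also have "\<dots> \<le> (\<Sum>n. ?P n + ennreal (e * (1/2)^Suc n))"
    by (intro suminf_le less_imp_le U) auto
  also have "\<dots> = (\<Sum>n. ?P n) + (\<Sum>n. ennreal (e * (1/2)^Suc n))"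
    by (intro suminf_add[symmetric]) auto
  also have "(\<Sum>n. ennreal (e * (1/2)^Suc n)) = ennreal e"
  proof (rule suminf_ennreal_eq)
    show "(\<lambda>n. e * (1/2)^Suc n) sums e"
      using sums_mult[OF power_half_series, of e] by simp
  qed (use \<open>0 < e\<close> in auto)
  finally show "hausdorff_premeasure h \<delta> (\<Union>n::nat. E n) \<le> (\<Sum>n. ?P n) + ennreal e" .
qed

lemma premeasure_finite_UN_le:
  assumes "finite I" "0 \<le> \<delta>"
  shows "hausdorff_premeasure h \<delta> (\<Union>i\<in>I. E i) \<le> (\<Sum>i\<in>I. hausdorff_premeasure h \<delta> (E i))"
  using assms(1)
proof induction
  case empty
  then show ?case by (simp add: premeasure_empty assms)
next
  case (insert i I)
  define G where "G = (\<lambda>n::nat. if n = 0 then E i else if n = 1 then (\<Union>i\<in>I. E i) else {})"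
  have G: "G 0 = E i" "G 1 = (\<Union>i\<in>I. E i)" "n \<notin> {0, 1} \<Longrightarrow> G n = {}" for n
    by (simp_all add: G_def)
  have eq: "(\<Union>i\<in>insert i I. E i) = (\<Union>n. G n)"
  proof (intro equalityI subsetI)
    fix x assume "x \<in> (\<Union>n. G n)"
    then obtain n where n: "x \<in> G n" by blast
    have "n \<in> {0, 1}"
    proof (rule ccontr)
      assume "n \<notin> {0, 1}"
      then show False using G(3) n by simp
    qed
    then show "x \<in> (\<Union>i\<in>insert i I. E i)" using n G(1,2) by auto
  next
    fix x assume "x \<in> (\<Union>i\<in>insert i I. E i)"
    then have "x \<in> G 0 \<or> x \<in> G 1" unfolding G by simp
    then show "x \<in> (\<Union>n. G n)" by (elim disjE) (rule UN_I[OF UNIV_I], assumption)+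
  qed
  have "hausdorff_premeasure h \<delta> (\<Union>i\<in>insert i I. E i) \<le> (\<Sum>n. hausdorff_premeasure h \<delta> (G n))"
    unfolding eq by (rule premeasure_UN_le)
  also have "\<dots> = (\<Sum>n\<in>{0,1}. hausdorff_premeasure h \<delta> (G n))"
    by (rule suminf_finite) (simp_all add: G(3) premeasure_empty assms)
  also have "\<dots> = hausdorff_premeasure h \<delta> (E i) + hausdorff_premeasure h \<delta> (\<Union>i\<in>I. E i)" by (simp add: G_def)
  also have "\<dots> \<le> hausdorff_premeasure h \<delta> (E i) + (\<Sum>i\<in>I. hausdorff_premeasure h \<delta> (E i))"
    by (rule add_left_mono) (rule insert.IH)
  finally show ?case using insert.hyps by simp
qed

lemma hausdorff_gauge_measure_UN_eq_0:
  assumes "\<And>n::nat. hausdorff_gauge_measure h (E n) = 0"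
  shows "hausdorff_gauge_measure h (\<Union>n. E n) = 0"
  unfolding hausdorff_gauge_measure_eq_0_iff
proof safe
  fix d :: real assume "d > 0"
  then have "hausdorff_premeasure h d (E n) = 0" for n
    using assms by (auto simp: hausdorff_gauge_measure_eq_0_iff)
  then show "hausdorff_premeasure h d (\<Union>n. E n) = 0"
    using premeasure_UN_le[of h d E] by simp
qed

lemma hausdorff_gauge_measure_eq_0_mono:
  assumes "hausdorff_gauge_measure h F = 0" "E \<subseteq> F"
  shows "hausdorff_gauge_measure h E = 0"
  unfolding hausdorff_gauge_measure_eq_0_iff
proof (intro allI impI)
  fix d :: real assume "d > 0"
  then have "hausdorff_premeasure h d F = 0" using assms(1) by (simp add: hausdorff_gauge_measure_eq_0_iff)
  then show "hausdorff_premeasure h d E = 0" using premeasure_mono[OF assms(2), of h d] by simp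
qed

section \<open>Pulling back covers\<close>

lemma diameter_le_dist:
  fixes S :: "'a::metric_space set"
  assumes "0 \<le> d" "\<And>x y. x \<in> S \<Longrightarrow> y \<in> S \<Longrightarrow> dist x y \<le> d"
  shows "diameter S \<le> d"
proof (cases "S = {}")
  case False
  have "(SUP (x, y)\<in>S \<times> S. dist x y) \<le> d"
    by (rule cSUP_least) (use False assms(2) in auto)
  then show ?thesis using False by (simp add: diameter_def)
qed (use assms(1) in simp)

text \<open>A cover of the image by sets \<open>U i\<close> pulls back to the sets of points of
  \<open>A\<close> that are mapped into \<open>U i\<close>. Two such points have images at distance
  at most \<open>t = diameter (U i)\<close>, so \<open>cont\<close> and monotonicity bound their
  distance to the power \<open>s\<close> by \<open>M * h t\<close>: the \<open>s\<close>-sum of the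
  new cover is at most \<open>M\<close> times the \<open>h\<close>-sum of the old one.\<close>

lemma hausdorff_null_pullback:
  fixes f :: "'a::metric_space \<Rightarrow> 'b::metric_space" and h :: "real \<Rightarrow> real"
  assumes "s > 0" "d > 0" "M > 0"
    and inj: "\<And>x y. x \<in> A \<Longrightarrow> y \<in> A \<Longrightarrow> f x = f y \<Longrightarrow> x = y"
    and cont: "\<And>x y. x \<in> A \<Longrightarrow> y \<in> A \<Longrightarrow> x \<noteq> y \<Longrightarrow> dist (f x) (f y) < d \<Longrightarrow>
        dist x y powr s \<le> M * h (dist (f x) (f y))"
    and mono: "\<And>t u. 0 < t \<Longrightarrow> t \<le> u \<Longrightarrow> u < d \<Longrightarrow> h t \<le> h u"
    and pos: "\<And>t. h t \<ge> 0"
    and null: "hausdorff_gauge_measure h (f ` A) = 0"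
  shows "hausdorff_measure s A = 0"
  unfolding hausdorff_measure_def hausdorff_gauge_measure_eq_0_iff
proof safe
  fix \<delta> :: real assume "\<delta> > 0"
  have eps: "hausdorff_premeasure (\<lambda>t. t powr s) \<delta> A \<le> 0 + ennreal e" if "e > 0" for e
  proof -
    \<comment> \<open>\<open>M * \<eta>\<close> is at most \<open>e\<close>, which bounds the whole
      sum, and at most \<open>\<delta> powr s\<close>, which makes each pulled back set admissible
      at scale \<open>\<delta>\<close>.\<close>
    define \<eta> where "\<eta> = min e (\<delta> powr s) / M"
    have "\<eta> > 0" using that assms \<open>\<delta> > 0\<close> by (simp add: \<eta>_def)
    \<comment> \<open>Scale \<open>d/2\<close> keeps all diameters strictly below \<open>d\<close>,
      the range of \<open>cont\<close> and \<open>mono\<close>.\<close>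
    have "hausdorff_premeasure h (d/2) (f ` A) = 0"
      using null assms(2) by (auto simp: hausdorff_gauge_measure_eq_0_iff)
    then have "hausdorff_premeasure h (d/2) (f ` A) < ennreal \<eta>" using \<open>\<eta> > 0\<close> by simp
    then obtain U where U: "f ` A \<subseteq> (\<Union>i. U i)" "\<And>i. bounded (U i)" "\<And>i. diameter (U i) \<le> d/2"
      and sum: "(\<Sum>i::nat. gauge_at h (diameter (U i))) < ennreal \<eta>"
      unfolding hausdorff_premeasure_def INF_less_iff by auto
    define V where "V = (\<lambda>i. f -` U i \<inter> A)"
    have V: "bounded (V i) \<and> diameter (V i) \<le> \<delta> \<and>
        gauge_at (\<lambda>t. t powr s) (diameter (V i)) \<le> ennreal M * gauge_at h (diameter (U i))" for i
    proof (cases "diameter (U i) = 0")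
      \<comment> \<open>\<open>gauge_at\<close> assigns 0 to sets of diameter 0 whatever
        \<open>h 0\<close> is, so the gauge gives no information here; injectivity leaves at most
        one point in \<open>V i\<close>.\<close>
      case True
      have sing: "x = y" if "x \<in> V i" "y \<in> V i" for x y
      proof -
        have "dist (f x) (f y) \<le> 0"
          using diameter_bounded_bound[OF U(2), of "f x" i "f y"] that True by (auto simp: V_def)
        then have "f x = f y" by simp
        moreover have "x \<in> A" "y \<in> A" using that by (simp_all add: V_def)
        ultimately show ?thesis using inj by blast
      qed
      have d0: "dist x y \<le> 0" if "x \<in> V i" "y \<in> V i" for x y by (simp add: sing[OF that])
      then have "bounded (V i)" unfolding bounded_two_points by (intro exI ballI)
      moreover have "diameter (V i) \<le> 0" by (rule diameter_le_dist[OF order_refl d0])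
      ultimately have "bounded (V i) \<and> diameter (V i) = 0" using diameter_ge_0[of "V i"] by linarith
      then show ?thesis using \<open>\<delta> > 0\<close> by (simp add: gauge_at_def)
    next
      case False
      define t where "t = diameter (U i)"
      have t: "t > 0" "t < d" using False U(2,3)[of i] diameter_ge_0[of "U i"] assms(2)
        by (auto simp: t_def)
      have "gauge_at h t \<le> (\<Sum>i. gauge_at h (diameter (U i)))"
        unfolding t_def using sum_le_suminf[of "\<lambda>i. gauge_at h (diameter (U i))" "{i}"] by auto
      with sum have "ennreal (h t) < ennreal \<eta>" using t by (simp add: gauge_at_def)
      then have ht: "h t < \<eta>" using \<open>\<eta> > 0\<close> ennreal_less_iff[OF pos] by blast
      define r where "r = (M * h t) powr (1/s)"
      have "M * h t \<le> \<delta> powr s"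
      proof -
        have "M * h t \<le> M * \<eta>" using ht assms(3) by simp
        also have "\<dots> \<le> \<delta> powr s" using assms(3) by (simp add: \<eta>_def)
        finally show ?thesis .
      qed
      then have r: "r \<le> \<delta>"
        using powr_mono2[of "1/s" "M * h t" "\<delta> powr s"] assms(1,3) pos[of t] \<open>\<delta> > 0\<close>
        by (simp add: r_def powr_powr)
      have dr: "dist x y \<le> r" if "x \<in> V i" "y \<in> V i" for x y
      proof (cases "x = y")
        case True
        then show ?thesis by (simp add: r_def)
      next
        case xy: False
        have xy': "x \<in> A" "y \<in> A" "f x \<in> U i" "f y \<in> U i" using that by (auto simp: V_def)
        have le: "dist (f x) (f y) \<le> t" using diameter_bounded_bound[OF U(2)] xy' by (simp add: t_def)
        have "f x \<noteq> f y" using inj xy xy' by blast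
        then have gr: "0 < dist (f x) (f y)" by simp
        have "dist x y powr s \<le> M * h (dist (f x) (f y))"
          by (rule cont) (use xy xy' le t in simp_all)
        also have "\<dots> \<le> M * h t" using mono[OF gr le] t assms(3) by simp
        finally have "(dist x y powr s) powr (1/s) \<le> r"
          unfolding r_def using assms(1) by (intro powr_mono2) auto
        then show ?thesis using assms(1) by (simp add: powr_powr)
      qed
      have "bounded (V i)" unfolding bounded_two_points using dr by (intro exI ballI)
      moreover have dV: "diameter (V i) \<le> r"
        using dr by (intro diameter_le_dist) (auto simp: r_def)
      moreover have "gauge_at (\<lambda>t. t powr s) (diameter (V i)) \<le> ennreal M * gauge_at h t"
      proof -
        have "diameter (V i) powr s \<le> r powr s"
          using dV assms(1) diameter_ge_0[OF \<open>bounded (V i)\<close>] by (intro powr_mono2) auto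
        also have "\<dots> = M * h t" using assms(1,3) pos[of t] by (simp add: r_def powr_powr)
        finally show ?thesis using t assms(3) pos[of t]
          by (auto simp: gauge_at_def ennreal_mult[symmetric] intro!: ennreal_leI)
      qed
      ultimately show ?thesis using r by (simp add: t_def)
    qed
    have "hausdorff_premeasure (\<lambda>t. t powr s) \<delta> A \<le> (\<Sum>i. gauge_at (\<lambda>t. t powr s) (diameter (V i)))"
      unfolding hausdorff_premeasure_def
    proof (rule INF_lower, safe)
      fix x assume "x \<in> A"
      then obtain i where "f x \<in> U i" using U(1) by auto
      then show "x \<in> (\<Union>i. V i)" using \<open>x \<in> A\<close> by (auto simp: V_def)
    qed (use V in auto)
    also have "\<dots> \<le> (\<Sum>i. ennreal M * gauge_at h (diameter (U i)))"
      by (intro suminf_le) (use V in auto)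
    also have "\<dots> = ennreal M * (\<Sum>i. gauge_at h (diameter (U i)))" by (rule ennreal_suminf_cmult)
    also have "\<dots> \<le> ennreal M * ennreal \<eta>" using sum by (intro mult_left_mono) auto
    also have "\<dots> = ennreal (min e (\<delta> powr s))" using assms(3) \<open>\<eta> > 0\<close>
      by (subst ennreal_mult[symmetric]) (auto simp: \<eta>_def)
    also have "\<dots> \<le> ennreal e" by (intro ennreal_leI) simp
    finally show ?thesis by simp
  qed
  have "hausdorff_premeasure (\<lambda>t. t powr s) \<delta> A \<le> 0"
    by (rule ennreal_le_epsilon) (rule eps)
  then show "hausdorff_premeasure (\<lambda>t. t powr s) \<delta> A = 0" by simp
qed

section \<open>Points of large upper density\<close>

definition csquare :: "complex \<Rightarrow> real \<Rightarrow> complex set" where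
  "csquare z r = {w. \<bar>Re w - Re z\<bar> \<le> r \<and> \<bar>Im w - Im z\<bar> \<le> r}"

lemma csquare_borel [measurable]: "csquare z r \<in> sets borel"
  unfolding csquare_def by measurable

text \<open>
  At most \<open>O(2\<^sup>k\<^sup>(\<^sup>s\<^sup>-\<^sup>\<epsilon>\<^sup>))\<close> dyadic squares of side \<open>1/2^k\<close> carry mass above the threshold, so their total
  contribution to the \<open>s\<close>-dimensional premeasure is \<open>O(2\<^sup>-\<^sup>k\<^sup>\<epsilon>)\<close>.
\<close>

lemma hausdorff_null_upper_density:
  fixes w :: "complex \<Rightarrow> ennreal"
  assumes w [measurable]: "w \<in> borel_measurable borel"
    and fin: "\<And>R::real. (\<integral>\<^sup>+x. w x * indicator (cball 0 R) x \<partial>lborel) < \<infinity>"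
    and s: "s > 0" and \<epsilon>: "\<epsilon> > 0"
  shows "hausdorff_measure s {z. \<forall>m. \<exists>k\<ge>m. ennreal (2 powr (- (real k * (s - \<epsilon>)))) <
      (\<integral>\<^sup>+x. w x * indicator (csquare z (1/2^k)) x \<partial>lborel)} = 0"
    (is "hausdorff_measure s ?N = 0")
proof -
  have [measurable]: "cball (0::complex) R \<in> sets borel" for R by simp
  let ?I = "\<lambda>z k. \<integral>\<^sup>+x. w x * indicator (csquare z (1/2^k)) x \<partial>lborel"
  have "hausdorff_measure s (?N \<inter> cball 0 (real R)) = 0" for R :: nat
    unfolding hausdorff_measure_def hausdorff_gauge_measure_eq_0_iff
  proof safe
    fix \<delta> :: real assume "\<delta> > 0"
    \<comment> \<open>The relevant squares have their centre in the ball of radius \<open>R\<close>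
      and half-side at most 1, so the cut-off at radius \<open>R + 3\<close> does not affect them
      and makes the total mass finite.\<close>
    define \<mu> where "\<mu> = density lborel (\<lambda>x. w x * indicator (cball 0 (real R + 3)) x)"
    have [measurable_cong]: "sets \<mu> = sets borel" by (simp add: \<mu>_def)
    define W where "W = enn2real (emeasure \<mu> UNIV)"
    have "emeasure \<mu> UNIV = (\<integral>\<^sup>+x. w x * indicator (cball 0 (real R + 3)) x * indicator UNIV x \<partial>lborel)"
      unfolding \<mu>_def by (rule emeasure_density) (use w in simp_all)
    then have "emeasure \<mu> UNIV < \<infinity>" using fin[of "real R + 3"] by simp
    then have W: "emeasure \<mu> S \<le> ennreal W" if "S \<in> sets borel" for S
      using emeasure_mono[of S UNIV \<mu>] by (simp add: W_def \<mu>_def)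
    have "W \<ge> 0" by (simp add: W_def)
    define thr where "thr = (\<lambda>k::nat. 2 powr (- (real k * (s - \<epsilon>))))"
    have thr: "thr k > 0" for k by (simp add: thr_def)
    \<comment> \<open>The cells are half-open, so those of one generation are disjoint and their
      masses add up.\<close>
    define D where "D = (\<lambda>(k::nat) (i::int, j::int). {z::complex. \<lfloor>2^k * Re z\<rfloor> = i \<and> \<lfloor>2^k * Im z\<rfloor> = j})"
    have D [measurable]: "D k p \<in> sets borel" for k p
      unfolding D_def by (cases p) (simp, measurable)
    \<comment> \<open>A square of half-side \<open>1/2^k\<close> meets at most nine cells of side
      \<open>1/2^k\<close>; if its mass exceeds \<open>thr k\<close>, one of them carries more than
      a ninth of that. \<open>B k p\<close> enlarges the cell \<open>p\<close> so as to contain the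
      centre of every such square.\<close>
    define H where "H = (\<lambda>k. {p. ennreal (thr k / 9) < emeasure \<mu> (D k p)})"
    define B where "B = (\<lambda>(k::nat) (i::int, j::int). {z::complex. \<bar>2^k * Re z - i\<bar> \<le> 2 \<and> \<bar>2^k * Im z - j\<bar> \<le> 2})"
    have cardF: "real (card F) \<le> 9 * W / thr k" if "finite F" "F \<subseteq> H k" for F k
    proof -
      have "(\<Sum>p\<in>F. ennreal (thr k / 9)) \<le> (\<Sum>p\<in>F. emeasure \<mu> (D k p))"
        using that by (intro sum_mono) (auto simp: H_def)
      also have "\<dots> = emeasure \<mu> (\<Union>p\<in>F. D k p)"
        using that(1) by (intro sum_emeasure) (auto simp: disjoint_family_on_def D_def)
      also have "\<dots> \<le> ennreal W" using that by (intro W) auto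
      also have "(\<Sum>p\<in>F. ennreal (thr k / 9)) = ennreal (real (card F) * (thr k / 9))"
        using thr[of k] by (subst sum_ennreal) simp_all
      finally have "ennreal (real (card F) * (thr k / 9)) \<le> ennreal W" .
      then have "real (card F) * (thr k / 9) \<le> W" using \<open>W \<ge> 0\<close> by (simp add: ennreal_le_iff)
      then show ?thesis using thr[of k] by (simp add: field_simps)
    qed
    have H: "finite (H k) \<and> real (card (H k)) \<le> 9 * W / thr k" for k
    proof -
      have "card F \<le> nat \<lceil>9 * W / thr k\<rceil>" if "F \<subseteq> H k" "finite F" for F
        using cardF[OF that(2,1)] by linarith
      then have "finite (H k)" using finite_if_finite_subsets_card_bdd[of "H k"] by blast
      then show ?thesis using cardF by blast
    qed
    have B: "bounded (B k p) \<and> diameter (B k p) \<le> 8 / 2^k" for k p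
    proof -
      obtain i j where p: "p = (i, j)" by force
      have "dist x y \<le> 8 / 2^k" if "x \<in> B k p" "y \<in> B k p" for x y
      proof -
        have "\<bar>2^k * Re x - 2^k * Re y\<bar> \<le> 4" "\<bar>2^k * Im x - 2^k * Im y\<bar> \<le> 4"
          using that by (auto simp: B_def p)
        then have "\<bar>2^k * (Re x - Re y)\<bar> \<le> 4" "\<bar>2^k * (Im x - Im y)\<bar> \<le> 4"
          by (simp_all add: right_diff_distrib)
        then have "2^k * (\<bar>Re (x - y)\<bar> + \<bar>Im (x - y)\<bar>) \<le> 8" by (simp add: abs_mult distrib_left)
        moreover have "2^k * dist x y \<le> 2^k * (\<bar>Re (x - y)\<bar> + \<bar>Im (x - y)\<bar>)"
          using cmod_le[of "x - y"] by (simp add: dist_norm)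
        ultimately show ?thesis by (simp add: field_simps)
      qed
      then show ?thesis
        by (auto intro!: diameter_le_dist simp: bounded_two_points)
    qed
    have cover: "z \<in> (\<Union>p\<in>H k. B k p)" if z: "z \<in> cball 0 (real R)" "ennreal (thr k) < ?I z k" for z k
    proof (rule ccontr)
      assume neg: "z \<notin> (\<Union>p\<in>H k. B k p)"
      define i where "i = \<lfloor>2^k * Re z\<rfloor>"
      define j where "j = \<lfloor>2^k * Im z\<rfloor>"
      have ij: "of_int i \<le> 2^k * Re z" "2^k * Re z < of_int i + 1" "of_int j \<le> 2^k * Im z" "2^k * Im z < of_int j + 1"
        unfolding i_def j_def by linarith+
      define A where "A = {i-1..i+1} \<times> {j-1..j+1}"
      have cA: "card A = 9" "finite A" by (auto simp: A_def)
      have small: "emeasure \<mu> (D k p) \<le> ennreal (thr k / 9)" if "p \<in> A" for p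
      proof -
        have "z \<in> B k p" using that ij by (auto simp: A_def B_def)
        then have "p \<notin> H k" using neg by blast
        then show ?thesis by (simp add: H_def not_less)
      qed
      have sub: "csquare z (1/2^k) \<subseteq> (\<Union>p\<in>A. D k p)"
      proof
        fix x assume "x \<in> csquare z (1/2^k)"
        then have "2^k * \<bar>Re x - Re z\<bar> \<le> 1" "2^k * \<bar>Im x - Im z\<bar> \<le> 1"
          by (auto simp: csquare_def field_simps)
        then have "\<bar>2^k * (Re x - Re z)\<bar> \<le> 1" "\<bar>2^k * (Im x - Im z)\<bar> \<le> 1"
          by (simp_all add: abs_mult)
        then have "\<bar>2^k * Re x - 2^k * Re z\<bar> \<le> 1" "\<bar>2^k * Im x - 2^k * Im z\<bar> \<le> 1"
          by (simp_all add: right_diff_distrib)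
        then have "\<lfloor>2^k * Re x\<rfloor> \<in> {i-1..i+1}" "\<lfloor>2^k * Im x\<rfloor> \<in> {j-1..j+1}"
          using ij by (auto simp: le_floor_iff floor_le_iff)
        then show "x \<in> (\<Union>p\<in>A. D k p)" by (auto simp: A_def D_def)
      qed
      have sub2: "csquare z (1/2^k) \<subseteq> cball 0 (real R + 3)"
      proof
        fix x assume x: "x \<in> csquare z (1/2^k)"
        have "(1::real) / 2^k \<le> 1" by simp
        moreover have "\<bar>Re x - Re z\<bar> \<le> 1 / 2^k" "\<bar>Im x - Im z\<bar> \<le> 1 / 2^k"
          using x by (simp_all add: csquare_def)
        ultimately have "\<bar>Re (x - z)\<bar> + \<bar>Im (x - z)\<bar> \<le> 2" unfolding minus_complex.sel by linarith
        then have "cmod (x - z) \<le> 2" using cmod_le[of "x - z"] by linarith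
        moreover have "cmod x \<le> cmod z + cmod (x - z)" using norm_triangle_ineq[of z "x - z"] by simp
        ultimately show "x \<in> cball 0 (real R + 3)" using z(1) by auto
      qed
      have "?I z k = emeasure \<mu> (csquare z (1/2^k))"
        unfolding \<mu>_def by (subst emeasure_density)
          (use sub2 in \<open>auto intro!: nn_integral_cong split: split_indicator\<close>)
      also have "\<dots> \<le> emeasure \<mu> (\<Union>p\<in>A. D k p)" using cA by (intro emeasure_mono sub) auto
      also have "\<dots> \<le> (\<Sum>p\<in>A. emeasure \<mu> (D k p))"
        using cA by (intro emeasure_subadditive_finite) auto
      also have "\<dots> \<le> (\<Sum>p\<in>A. ennreal (thr k / 9))" by (intro sum_mono small)
      also have "\<dots> = ennreal (thr k)"
        using thr[of k] by (subst sum_ennreal) (auto simp: cA)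
      finally show False using z(2) by simp
    qed
    define q where "q = (2::real) powr (-\<epsilon>)"
    have q: "0 < q" "q < 1" using \<epsilon> by (auto simp: q_def powr_less_one)
    define c where "c = 9 * W * 8 powr s"
    have "c \<ge> 0" using \<open>W \<ge> 0\<close> by (simp add: c_def)
    have lvl: "hausdorff_premeasure (\<lambda>t. t powr s) \<delta> (\<Union>p\<in>H k. B k p) \<le> ennreal (c * q^k)"
      if k: "8 / 2^k \<le> \<delta>" for k
    proof -
      have "hausdorff_premeasure (\<lambda>t. t powr s) \<delta> (\<Union>p\<in>H k. B k p)
          \<le> (\<Sum>p\<in>H k. hausdorff_premeasure (\<lambda>t. t powr s) \<delta> (B k p))"
        using H \<open>\<delta> > 0\<close> by (intro premeasure_finite_UN_le) auto
      also have "\<dots> \<le> (\<Sum>p\<in>H k. ennreal ((8 / 2^k) powr s))"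
      proof (intro sum_mono)
        fix p
        have "hausdorff_premeasure (\<lambda>t. t powr s) \<delta> (B k p) \<le> gauge_at (\<lambda>t. t powr s) (diameter (B k p))"
          by (rule premeasure_le_gauge) (use B[of k p] k in auto)
        also have "\<dots> \<le> ennreal ((8 / 2^k) powr s)"
          using B[of k p] s diameter_ge_0[of "B k p"]
          by (auto simp: gauge_at_def intro!: ennreal_leI powr_mono2)
        finally show "hausdorff_premeasure (\<lambda>t. t powr s) \<delta> (B k p) \<le> ennreal ((8 / 2^k) powr s)" .
      qed
      also have "\<dots> = ennreal (real (card (H k)) * (8 / 2^k) powr s)" by (subst sum_ennreal) auto
      also have "\<dots> \<le> ennreal (9 * W / thr k * (8 / 2^k) powr s)"
        using H by (intro ennreal_leI mult_right_mono) auto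
      \<comment> \<open>The count is of order \<open>2 powr (k * (s - \<epsilon>))\<close> and each
        enlarged cell contributes of order \<open>2 powr (- k * s)\<close>; what remains is a
        geometric sequence of ratio \<open>2 powr (- \<epsilon>)\<close>.\<close>
      also have "9 * W / thr k * (8 / 2^k) powr s = c * q^k"
      proof -
        have "(8 / 2^k) powr s = 8 powr s * 2 powr (- real k * s)"
          by (simp add: powr_divide powr_realpow[symmetric] powr_powr powr_minus_divide)
        moreover have "q ^ k = 2 powr (- \<epsilon> * real k)"
          by (simp add: q_def powr_realpow[symmetric] powr_powr)
        moreover have "2 powr (- real k * s) / thr k = 2 powr (- \<epsilon> * real k)"
          unfolding thr_def powr_diff[symmetric] by (simp add: algebra_simps)
        moreover have "9 * W / thr k * (x * y) = 9 * W * x * (y / thr k)" for x y by simp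
        ultimately show ?thesis by (simp only: c_def)
      qed
      finally show ?thesis .
    qed
    have bound: "hausdorff_premeasure (\<lambda>t. t powr s) \<delta> (?N \<inter> cball 0 (real R)) \<le> ennreal (c * q^m / (1 - q))"
      if m: "8 / 2^m \<le> \<delta>" for m
    proof -
      \<comment> \<open>Points of \<open>?N\<close> have heavy squares at arbitrarily small scales,
        so the levels from any \<open>m\<close> on still cover; as \<open>m\<close> grows, the tail
        of the geometric series tends to 0.\<close>
      have "?N \<inter> cball 0 (real R) \<subseteq> (\<Union>n. \<Union>p\<in>H (m + n). B (m + n) p)"
      proof
        fix z assume z: "z \<in> ?N \<inter> cball 0 (real R)"
        then obtain k where k: "k \<ge> m" "ennreal (thr k) < ?I z k" by (auto simp: thr_def)
        then have "z \<in> (\<Union>p\<in>H (m + (k - m)). B (m + (k - m)) p)" using cover[of z k] z by simp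
        then show "z \<in> (\<Union>n. \<Union>p\<in>H (m + n). B (m + n) p)" by blast
      qed
      then have "hausdorff_premeasure (\<lambda>t. t powr s) \<delta> (?N \<inter> cball 0 (real R))
          \<le> hausdorff_premeasure (\<lambda>t. t powr s) \<delta> (\<Union>n. \<Union>p\<in>H (m + n). B (m + n) p)"
        by (rule premeasure_mono)
      also have "\<dots> \<le> (\<Sum>n. hausdorff_premeasure (\<lambda>t. t powr s) \<delta> (\<Union>p\<in>H (m + n). B (m + n) p))"
        by (rule premeasure_UN_le)
      also have "\<dots> \<le> (\<Sum>n. ennreal (c * q^(m + n)))"
      proof (intro suminf_le lvl)
        fix n
        have "(8::real) / 2^(m+n) \<le> 8 / 2^m" by (intro divide_left_mono) auto
        then show "8 / 2^(m+n) \<le> \<delta>" using m by linarith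
      qed auto
      also have "\<dots> = ennreal (c * q^m / (1 - q))"
      proof (rule suminf_ennreal_eq)
        have "(\<lambda>n. c * q^m * q^n) sums (c * q^m * (1 / (1 - q)))"
          using q by (intro sums_mult geometric_sums) auto
        then show "(\<lambda>n. c * q^(m + n)) sums (c * q^m / (1 - q))" by (simp add: power_add mult.assoc)
      qed (use q \<open>c \<ge> 0\<close> in auto)
      finally show ?thesis .
    qed
    have "(\<lambda>m. ennreal (c * q^m / (1 - q))) \<longlonglongrightarrow> ennreal (c * 0 / (1 - q))"
      using q by (intro tendsto_intros LIMSEQ_realpow_zero) auto
    moreover have "\<forall>\<^sub>F m in sequentially. hausdorff_premeasure (\<lambda>t. t powr s) \<delta> (?N \<inter> cball 0 (real R)) \<le> ennreal (c * q^m / (1 - q))"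
    proof -
      have "(\<lambda>m. 8 / (2::real)^m) \<longlonglongrightarrow> 0" by real_asymp
      then have "\<forall>\<^sub>F m in sequentially. 8 / (2::real)^m < \<delta>" using \<open>\<delta> > 0\<close> by (rule order_tendstoD)
      then show ?thesis by eventually_elim (use bound in simp)
    qed
    ultimately have "hausdorff_premeasure (\<lambda>t. t powr s) \<delta> (?N \<inter> cball 0 (real R)) \<le> ennreal (c * 0 / (1 - q))"
      by (intro tendsto_lowerbound) auto
    then show "hausdorff_premeasure (\<lambda>t. t powr s) \<delta> (?N \<inter> cball 0 (real R)) = 0" by simp
  qed
  then have "hausdorff_measure s (\<Union>R. ?N \<inter> cball 0 (real R)) = 0"
    unfolding hausdorff_measure_def by (rule hausdorff_gauge_measure_UN_eq_0)
  moreover have "(\<Union>R. ?N \<inter> cball 0 (real R)) = ?N"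
    by (auto intro: real_arch_simple)
  ultimately show ?thesis by simp
qed

section \<open>An upper bound for the modulus constant\<close>

abbreviation psum :: "(real \<Rightarrow> complex) \<Rightarrow> (nat \<Rightarrow> real) \<Rightarrow> nat \<Rightarrow> real" where
  "psum \<gamma> \<tau> n \<equiv> (\<Sum>i<n. dist (\<gamma> (\<tau> i)) (\<gamma> (\<tau> (Suc i))))"

lemma psum_le_path_length:
  "mono \<tau> \<Longrightarrow> range \<tau> \<subseteq> {a..b} \<Longrightarrow> ennreal (psum \<gamma> \<tau> n) \<le> path_length \<gamma> a b"
  unfolding path_length_def by (rule SUP_upper2[of "(n, \<tau>)"]) auto

lemma path_length_least:
  assumes "\<And>n \<tau>. mono \<tau> \<Longrightarrow> range \<tau> \<subseteq> {a..b} \<Longrightarrow> ennreal (psum \<gamma> \<tau> n) \<le> u"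
  shows "path_length \<gamma> a b \<le> u"
  unfolding path_length_def by (rule SUP_least) (use assms in auto)

lemma less_path_length:
  assumes "u < path_length \<gamma> a b"
  obtains n \<tau> where "mono \<tau>" "range \<tau> \<subseteq> {a..b}" "u < ennreal (psum \<gamma> \<tau> n)"
  using assms path_length_least[of a b \<gamma> u] by (metis not_le)

lemma path_length_mono:
  "a \<le> a' \<Longrightarrow> b' \<le> b \<Longrightarrow> path_length \<gamma> a' b' \<le> path_length \<gamma> a b"
  by (rule path_length_least, rule psum_le_path_length) auto

lemma dist_le_path_length:
  assumes "a \<le> b"
  shows "ennreal (dist (\<gamma> a) (\<gamma> b)) \<le> path_length \<gamma> a b"
proof -
  let ?\<tau> = "\<lambda>i::nat. if i = 0 then a else b"
  have "mono ?\<tau>" using assms by (auto simp: mono_def)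
  moreover have "range ?\<tau> \<subseteq> {a..b}" using assms by auto
  ultimately show ?thesis using psum_le_path_length[of ?\<tau> a b \<gamma> 1] by simp
qed

text \<open>A partition of \<open>{a..b}\<close> followed by one of \<open>{b..c}\<close> is a
  partition of \<open>{a..c}\<close>; the two sequences are joined after index \<open>n\<close>,
  where at most one extra nonnegative term appears.\<close>

lemma path_length_superadd:
  assumes "a \<le> b" "b \<le> c"
  shows "path_length \<gamma> a b + path_length \<gamma> b c \<le> path_length \<gamma> a c"
proof -
  have *: "ennreal (psum \<gamma> \<tau> n) + ennreal (psum \<gamma> \<sigma> m) \<le> path_length \<gamma> a c"
    if *: "mono \<tau>" "range \<tau> \<subseteq> {a..b}" "mono \<sigma>" "range \<sigma> \<subseteq> {b..c}" for \<tau> \<sigma> n m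
  proof -
    define \<kappa> where "\<kappa> = (\<lambda>i. if i \<le> n then \<tau> i else \<sigma> (i - Suc n))"
    have "\<tau> i \<le> \<sigma> j" for i j using * by (meson atLeastAtMost_iff order_trans rangeI subsetD)
    then have "mono \<kappa>" using *(1,3) by (auto simp: \<kappa>_def mono_def)
    moreover have "\<tau> i \<in> {a..c}" "\<sigma> i \<in> {a..c}" for i
      using *(2,4) assms by (meson atLeastAtMost_iff order_trans rangeI subsetD)+
    then have "range \<kappa> \<subseteq> {a..c}" by (auto simp: \<kappa>_def)
    ultimately have "ennreal (psum \<gamma> \<kappa> (Suc n + m)) \<le> path_length \<gamma> a c"
      by (rule psum_le_path_length)
    moreover have "psum \<gamma> \<tau> n + psum \<gamma> \<sigma> m \<le> psum \<gamma> \<kappa> (Suc n + m)"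
    proof (induction m)
      case 0
      have "psum \<gamma> \<tau> n = psum \<gamma> \<kappa> n" by (rule sum.cong) (auto simp: \<kappa>_def)
      then show ?case by simp
    next
      case (Suc m)
      then show ?case by (auto simp: \<kappa>_def)
    qed
    then have "ennreal (psum \<gamma> \<tau> n) + ennreal (psum \<gamma> \<sigma> m) \<le> ennreal (psum \<gamma> \<kappa> (Suc n + m))"
      by (subst ennreal_plus[symmetric]) (simp_all add: sum_nonneg ennreal_leI del: sum.lessThan_Suc ennreal_plus)
    ultimately show ?thesis by (rule order_trans[rotated])
  qed
  then show ?thesis
  proof -
    let ?I = "\<lambda>a b. (UNIV :: nat set) \<times> {\<tau> :: nat \<Rightarrow> real. mono \<tau> \<and> range \<tau> \<subseteq> {a..b}}"
    have ne: "?I a b \<noteq> {}" if "a \<le> b" for a b :: real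
      using that by (auto intro!: exI[of _ "\<lambda>_. a"] simp: mono_def)
    show ?thesis
      unfolding path_length_def[of _ a b] path_length_def[of _ b c]
      by (subst ennreal_SUP_add_right[OF ne[OF assms(2)]], rule SUP_least,
          subst ennreal_SUP_add_left[OF ne[OF assms(1)], symmetric], rule SUP_least)
        (use * in auto)
  qed
qed

text \<open>Clamping the partition at \<open>b\<close> from the right and at \<open>c\<close> from
  the left splits the sum. As no partition point lies strictly between \<open>b\<close> and
  \<open>c\<close>, only one increment can jump the gap, and the triangle inequality through
  \<open>\<gamma> b\<close> and \<open>\<gamma> c\<close> charges the jump once.\<close>

lemma psum_split_le:
  assumes "mono \<tau>" "b < c" "\<And>i. i \<le> n \<Longrightarrow> \<tau> i \<notin> {b<..<c}"
  shows "psum \<gamma> \<tau> n \<le> psum \<gamma> (\<lambda>i. min (\<tau> i) b) n + psum \<gamma> (\<lambda>i. max (\<tau> i) c) n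
    + (if \<tau> n \<ge> c then dist (\<gamma> b) (\<gamma> c) else 0)"
  using assms(3)
proof (induction n)
  case 0
  then show ?case by simp
next
  case (Suc n)
  have IH: "psum \<gamma> \<tau> n \<le> psum \<gamma> (\<lambda>i. min (\<tau> i) b) n + psum \<gamma> (\<lambda>i. max (\<tau> i) c) n
    + (if \<tau> n \<ge> c then dist (\<gamma> b) (\<gamma> c) else 0)"
    using Suc by auto
  have le: "\<tau> n \<le> \<tau> (Suc n)" using assms(1) by (auto simp: mono_def)
  have "\<tau> n \<le> b \<or> \<tau> n \<ge> c" "\<tau> (Suc n) \<le> b \<or> \<tau> (Suc n) \<ge> c"
    using Suc.prems[of n] Suc.prems[of "Suc n"] by auto
  then consider "\<tau> n \<ge> c" | "\<tau> (Suc n) \<le> b" | "\<tau> n \<le> b" "\<tau> (Suc n) \<ge> c" by blast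
  then show ?case
  proof cases
    case 1
    then show ?thesis using IH le assms(2) by (simp add: max_absorb1 min_absorb2)
  next
    case 2
    then show ?thesis using IH le assms(2) by (simp add: max_absorb2 min_absorb1)
  next
    case 3
    have "dist (\<gamma> (\<tau> n)) (\<gamma> (\<tau> (Suc n))) \<le> dist (\<gamma> (\<tau> n)) (\<gamma> b) + dist (\<gamma> b) (\<gamma> c) + dist (\<gamma> c) (\<gamma> (\<tau> (Suc n)))"
      by (metis add.assoc add_mono_thms_linordered_semiring(2) dist_triangle order_trans)
    then show ?thesis using IH 3 assms(2) by (simp add: max_absorb1 max_absorb2 min_absorb1 min_absorb2)
  qed
qed

lemma path_length_refl [simp]: "path_length \<gamma> a a = 0"
proof -
  have "path_length \<gamma> a a \<le> 0"
  proof (rule path_length_least)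
    fix n and \<tau> :: "nat \<Rightarrow> real" assume "range \<tau> \<subseteq> {a..a}"
    then have "\<tau> i = a" for i by (metis atLeastAtMost_singleton rangeI singletonD subsetD)
    then show "ennreal (psum \<gamma> \<tau> n) \<le> 0" by simp
  qed
  then show ?thesis by simp
qed

text \<open>Lower semicontinuity of length: for a fixed partition clamped at \<open>t\<close>, the
  polygonal sum depends continuously on \<open>t\<close>, and for \<open>t < b\<close> it is bounded
  by \<open>u\<close>.\<close>

lemma path_length_le_left_limit:
  assumes "continuous_on {a..b} \<gamma>" "a < b" "\<And>t. a \<le> t \<Longrightarrow> t < b \<Longrightarrow> path_length \<gamma> a t \<le> u"
  shows "path_length \<gamma> a b \<le> u"
proof (rule path_length_least)
  fix n and \<tau> :: "nat \<Rightarrow> real" assume \<tau>: "mono \<tau>" "range \<tau> \<subseteq> {a..b}"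
  have \<tau>': "a \<le> \<tau> i" "\<tau> i \<le> b" for i using \<tau>(2) by (auto dest!: subsetD[OF _ rangeI])
  let ?S = "\<lambda>t. psum \<gamma> (\<lambda>i. min (\<tau> i) t) n"
  have c: "continuous_on {a..b} (\<lambda>t. \<gamma> (min (\<tau> i) t))" for i
    by (rule continuous_on_compose2[OF assms(1)])
      (use \<tau>' in \<open>auto intro!: continuous_on_min continuous_intros simp: min_le_iff_disj\<close>)
  have "continuous_on {a..b} (\<lambda>t. ennreal (?S t))"
    by (intro continuous_intros continuous_on_ennreal c)
  then have "((\<lambda>t. ennreal (?S t)) \<longlongrightarrow> ennreal (?S b)) (at_left b)"
    by (rule continuous_on_Icc_at_leftD) (fact assms(2))
  moreover have "\<forall>\<^sub>F t in at_left b. ennreal (?S t) \<le> u"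
    unfolding eventually_at_left_field
  proof (intro exI[of _ a] conjI allI impI)
    fix t assume t: "a < t" "t < b"
    have "ennreal (?S t) \<le> path_length \<gamma> a t"
      using \<tau>(1) \<tau>' t by (intro psum_le_path_length) (auto simp: mono_def min_le_iff_disj)
    then show "ennreal (?S t) \<le> u" using assms(3)[of t] t by simp
  qed (use assms in auto)
  ultimately have "ennreal (?S b) \<le> u" by (intro tendsto_upperbound) auto
  then show "ennreal (psum \<gamma> \<tau> n) \<le> u" using \<tau>' by (simp add: min_absorb1)
qed

lemma mono_max_const: "mono \<tau> \<Longrightarrow> mono (\<lambda>i. max (\<tau> i) (c::real))"
  unfolding mono_def by (meson max.mono order_refl)

text \<open>The length function of a rectifiable path is continuous and thus takes all intermediate
  values; this is what gives the choice in \<open>arclength_param\<close> a meaning. The time sought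
  is the supremum \<open>b\<close> of the times up to which the length is at most
  \<open>s\<close>.\<close>

lemma path_length_attains:
  assumes \<gamma>: "continuous_on {0..1} \<gamma>" and fin: "path_length \<gamma> 0 1 < \<infinity>"
    and s: "0 \<le> s" "ennreal s \<le> path_length \<gamma> 0 1"
  shows "\<exists>t\<in>{0..1}. path_length \<gamma> 0 t = ennreal s"
proof -
  define T where "T = {t\<in>{0..1}. path_length \<gamma> 0 t \<le> ennreal s}"
  have "0 \<in> T" by (simp add: T_def)
  have bdd: "bdd_above T" by (rule bdd_aboveI[of _ 1]) (simp add: T_def)
  define b where "b = Sup T"
  have b0: "0 \<le> b" using cSup_upper[OF \<open>0 \<in> T\<close> bdd] by (simp add: b_def)
  have b1: "b \<le> 1" unfolding b_def by (rule cSup_least) (use \<open>0 \<in> T\<close> in blast, simp add: T_def)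
  have fin': "path_length \<gamma> x y < \<infinity>" if "0 \<le> x" "y \<le> 1" for x y
    using path_length_mono[OF that, of \<gamma>] fin by auto
  have le: "path_length \<gamma> 0 b \<le> ennreal s"
  proof (cases "b = 0")
    case False
    show ?thesis
    proof (rule path_length_le_left_limit)
      show "continuous_on {0..b} \<gamma>" using \<gamma> b1 by (auto intro: continuous_on_subset)
      show "0 < b" using b0 False by simp
      fix t assume "0 \<le> t" "t < b"
      then obtain t' where "t' \<in> T" "t < t'" using less_cSup_iff[of T t] \<open>0 \<in> T\<close> bdd b_def by auto
      then show "path_length \<gamma> 0 t \<le> ennreal s"
        using path_length_mono[of 0 0 t t' \<gamma>] by (auto simp: T_def intro: order_trans)
    qed
  qed simp
  moreover have "\<not> path_length \<gamma> 0 b < ennreal s"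
  proof
    assume lt: "path_length \<gamma> 0 b < ennreal s"
    then have "b < 1" using s(2) b1 by (cases "b = 1") auto
    define l where "l = (\<lambda>x y. enn2real (path_length \<gamma> x y))"
    have l: "path_length \<gamma> x y = ennreal (l x y)" if "0 \<le> x" "y \<le> 1" for x y
      using fin'[OF that] by (simp add: l_def)
    have l0: "0 \<le> l x y" for x y by (simp add: l_def)
    \<comment> \<open>The assumed deficit at \<open>b\<close>. A partition that exhausts the total
      length up to \<open>e/2\<close>, and a time \<open>c > b\<close> up to which
      \<open>\<gamma>\<close> moves by less than \<open>e/2\<close>, force the length up to
      \<open>c\<close> below \<open>s\<close>; but \<open>c\<close> lies beyond the
      supremum.\<close>
    define e where "e = s - l 0 b"
    have "e > 0" using lt b1 l[of 0 b] l0[of 0 b] by (simp add: e_def ennreal_less_iff)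
    have "ennreal (l 0 1 - e/2) < path_length \<gamma> 0 1 \<or> l 0 1 - e/2 < 0"
      using \<open>e > 0\<close> l0[of 0 1] by (auto simp: l ennreal_less_iff)
    moreover have "s \<le> l 0 1" using s l[of 0 1] l0[of 0 1] by (simp add: ennreal_le_iff)
    then have "l 0 1 - e/2 \<ge> 0" using l0[of 0 b] s(1) by (simp add: e_def)
    ultimately have "ennreal (l 0 1 - e/2) < path_length \<gamma> 0 1" by auto
    then obtain n \<tau> where \<tau>: "mono \<tau>" "range \<tau> \<subseteq> {0..1}" "ennreal (l 0 1 - e/2) < ennreal (psum \<gamma> \<tau> n)"
      by (rule less_path_length)
    then have big: "l 0 1 - e/2 < psum \<gamma> \<tau> n"
      using \<open>l 0 1 - e/2 \<ge> 0\<close> by (simp add: ennreal_less_iff)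
    have "continuous (at b within {0..1}) \<gamma>" using \<gamma> b0 b1 by (auto simp: continuous_on_eq_continuous_within)
    then obtain d where d: "d > 0" "\<And>x. x \<in> {0..1} \<Longrightarrow> dist x b < d \<Longrightarrow> dist (\<gamma> x) (\<gamma> b) < e/2"
      unfolding continuous_within_eps_delta using \<open>e > 0\<close> by (metis half_gt_zero)
    \<comment> \<open>\<open>c\<close> comes no later than the next partition point after
      \<open>b\<close>, so the partition skips the gap from \<open>b\<close> to \<open>c\<close> and
      \<open>psum_split_le\<close> applies.\<close>
    define P where "P = insert 1 (insert (b + d/2) (\<tau> ` {..n} \<inter> {b<..}))"
    define c where "c = Min P"
    have P: "finite P" "P \<noteq> {}" "\<And>x. x \<in> P \<Longrightarrow> b < x" using d \<open>b < 1\<close> by (auto simp: P_def)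
    then have "b < c" by (simp add: c_def)
    have cle: "c \<le> x" if "x \<in> P" for x using P that by (simp add: c_def)
    have c1: "c \<le> 1" "c \<le> b + d/2" using cle by (auto simp: P_def)
    have dc: "dist (\<gamma> b) (\<gamma> c) < e/2"
      using d(2)[of c] c1 b0 \<open>b < c\<close> d(1) by (auto simp: dist_real_def dist_commute)
    have no: "\<tau> i \<notin> {b<..<c}" if "i \<le> n" for i
    proof
      assume "\<tau> i \<in> {b<..<c}"
      then have "\<tau> i \<in> P" using that by (auto simp: P_def)
      then show False using cle[of "\<tau> i"] \<open>\<tau> i \<in> {b<..<c}\<close> by auto
    qed
    have \<tau>': "0 \<le> \<tau> i" "\<tau> i \<le> 1" for i using \<tau>(2) by (auto dest!: subsetD[OF _ rangeI])
    have "ennreal (psum \<gamma> (\<lambda>i. min (\<tau> i) b) n) \<le> path_length \<gamma> 0 b"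
      using \<tau>(1) \<tau>' b0 by (intro psum_le_path_length) (auto simp: mono_def min_le_iff_disj)
    then have p1: "psum \<gamma> (\<lambda>i. min (\<tau> i) b) n \<le> l 0 b" using b1 l0 by (simp add: l)
    have "ennreal (psum \<gamma> (\<lambda>i. max (\<tau> i) c) n) \<le> path_length \<gamma> c 1"
      using \<tau>(1) \<tau>' c1 by (intro psum_le_path_length) (auto intro: mono_max_const)
    then have p2: "psum \<gamma> (\<lambda>i. max (\<tau> i) c) n \<le> l c 1" using b0 \<open>b < c\<close> l0 by (simp add: l)
    have "psum \<gamma> \<tau> n \<le> l 0 b + l c 1 + e/2"
      using psum_split_le[OF \<tau>(1) \<open>b < c\<close> no, of n \<gamma>] p1 p2 dc \<open>e > 0\<close> by (auto split: if_splits)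
    moreover have "l 0 c + l c 1 \<le> l 0 1"
    proof -
      have "path_length \<gamma> 0 c + path_length \<gamma> c 1 \<le> path_length \<gamma> 0 1"
        using path_length_superadd[of 0 c 1 \<gamma>] b0 \<open>b < c\<close> c1 by auto
      then show ?thesis using b0 \<open>b < c\<close> c1 l0 by (simp add: l ennreal_plus[symmetric] del: ennreal_plus)
    qed
    moreover have "s < l 0 c"
    proof -
      have "c \<notin> T" using bdd \<open>b < c\<close> cSup_upper[of c T] by (auto simp: b_def)
      then have "ennreal s < ennreal (l 0 c)"
        using c1 b0 \<open>b < c\<close> by (auto simp: T_def l)
      then show ?thesis using s(1) by (simp add: ennreal_less_iff)
    qed
    ultimately show False using big e_def by linarith
  qed
  ultimately have "path_length \<gamma> 0 b = ennreal s" by auto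
  then show ?thesis using b0 b1 by auto
qed

text \<open>Length dominates distance, so the initial piece of length \<open>s\<close> of a path
  stays in the disc of radius \<open>s\<close> about its start.\<close>

lemma dist_arclength_param_le:
  assumes "rectifiable \<gamma>" "0 \<le> s" "ennreal s \<le> path_length \<gamma> 0 1"
  shows "dist (\<gamma> 0) (arclength_param \<gamma> s) \<le> s"
proof -
  let ?t = "SOME t. t \<in> {0..1} \<and> path_length \<gamma> 0 t = ennreal s"
  have "\<exists>t. t \<in> {0..1} \<and> path_length \<gamma> 0 t = ennreal s"
    using path_length_attains[of \<gamma> s] assms by (auto simp: rectifiable_def path_def)
  then have "?t \<in> {0..1} \<and> path_length \<gamma> 0 ?t = ennreal s" by (rule someI_ex)
  then have "ennreal (dist (\<gamma> 0) (\<gamma> ?t)) \<le> ennreal s" using dist_le_path_length[of 0 ?t \<gamma>] by auto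
  then show ?thesis using assms(2) by (simp add: arclength_param_def)
qed

text \<open>For two parallel unit segments at distance \<open>1\<close>, the indicator of a square of side \<open>6\<close> is admissible.\<close>

lemma modulus_constant_le:
  assumes "modulus_constant Ct"
  shows "Ct \<le> 72"
proof -
  define E where "E = closed_segment 0 (1::complex)"
  define F where "F = closed_segment \<i> (1 + \<i>)"
  define Q where "Q = cbox (Complex (-3) (-3)) (Complex 3 3)"
  have E: "\<bar>Re z\<bar> \<le> 1 \<and> Im z = 0" if "z \<in> E" for z
    using that by (auto simp: E_def in_segment)
  have F: "Im z = 1" if "z \<in> F" for z
    using that by (auto simp: F_def in_segment algebra_simps)
  have dist1: "1 \<le> dist x y" if "x \<in> E" "y \<in> F" for x y
    using abs_Im_le_cmod[of "x - y"] E[OF that(1)] F[OF that(2)] by (simp add: dist_norm)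
  have ends: "0 \<in> E" "1 \<in> E" "\<i> \<in> F" "1 + \<i> \<in> F" by (auto simp: E_def F_def)
  have sd: "setdist E F = 1"
  proof (rule antisym)
    show "setdist E F \<le> 1" using setdist_le_dist[OF ends(1,3)] by simp
    show "1 \<le> setdist E F" using ends dist1 by (intro le_setdistI) auto
  qed
  have "bounded E" "bounded F" by (auto simp: E_def F_def compact_imp_bounded)
  then have "1 \<le> diameter E" "1 \<le> diameter F"
    using diameter_bounded_bound[of E 0 1] diameter_bounded_bound[of F \<i> "1 + \<i>"] ends
    by (auto simp: dist_norm)
  then have "ln 2 \<le> ln (1 + min (diameter E) (diameter F) / setdist E F)" by (simp add: sd)
  moreover have "(1/2::real) \<le> ln 2" using ln_le_minus_one[of "1/2"] by (simp add: ln_div)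
  ultimately have ln: "1/2 \<le> ln (1 + min (diameter E) (diameter F) / setdist E F)" by linarith
  have "admissible (connecting_paths E F) (indicator Q)"
    unfolding admissible_def
  proof (intro conjI ballI impI)
    show "indicator Q \<in> borel_measurable borel" by (simp add: Q_def)
    fix \<gamma> assume \<gamma>: "\<gamma> \<in> connecting_paths E F" "rectifiable \<gamma>"
    then have g: "\<gamma> 0 \<in> E" "\<gamma> 1 \<in> F" by (auto simp: connecting_paths_def pathstart_def pathfinish_def)
    have fin: "path_length \<gamma> 0 1 < \<infinity>" using \<gamma>(2) by (simp add: rectifiable_def)
    have "ennreal 1 \<le> ennreal (dist (\<gamma> 0) (\<gamma> 1))" by (intro ennreal_leI dist1 g)
    also have "\<dots> \<le> path_length \<gamma> 0 1" by (rule dist_le_path_length) simp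
    finally have len: "ennreal 1 \<le> path_length \<gamma> 0 1" .
    then have len': "1 \<le> enn2real (path_length \<gamma> 0 1)" using fin
      by (metis ennreal_1 ennreal_enn2real ennreal_ge_1 infinity_ennreal_def)
    \<comment> \<open>The path starts on \<open>E\<close> and has length at least 1, so its first
      unit of arc length stays in \<open>Q\<close>; this piece alone contributes 1 to the line
      integral.\<close>
    have "(\<integral>\<^sup>+ s. indicator {0..1} s \<partial>(lborel::real measure)) \<le> line_integral (indicator Q) \<gamma>"
      unfolding line_integral_def
    proof (rule nn_integral_mono)
      fix s :: real
      show "indicator {0..1} s \<le> (indicator Q (arclength_param \<gamma> s) :: ennreal) *
          indicator {0..enn2real (path_length \<gamma> 0 1)} s"
      proof (cases "s \<in> {0..1}")
        case True
        have "ennreal s \<le> path_length \<gamma> 0 1"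
          using True len by (auto intro: order_trans[OF ennreal_leI])
        then have "dist (\<gamma> 0) (arclength_param \<gamma> s) \<le> 1"
          using dist_arclength_param_le[OF \<gamma>(2), of s] True by auto
        then have "\<bar>Re (\<gamma> 0 - arclength_param \<gamma> s)\<bar> \<le> 1" "\<bar>Im (\<gamma> 0 - arclength_param \<gamma> s)\<bar> \<le> 1"
          using abs_Re_le_cmod[of "\<gamma> 0 - arclength_param \<gamma> s"] abs_Im_le_cmod[of "\<gamma> 0 - arclength_param \<gamma> s"]
          by (auto simp: dist_norm)
        then have "arclength_param \<gamma> s \<in> Q"
          using E[OF g(1)] by (auto simp: Q_def in_cbox_complex_iff)
        then show ?thesis using True len' by (auto simp: indicator_def)
      qed auto
    qed
    then show "1 \<le> line_integral (indicator Q) \<gamma>" by simp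
  qed
  then have "modulus (connecting_paths E F) \<le> (\<integral>\<^sup>+ z. (indicator Q z)\<^sup>2 \<partial>lborel)"
    unfolding modulus_def by (intro INF_lower) auto
  also have "(\<lambda>z. (indicator Q z :: ennreal)\<^sup>2) = indicator Q" by (auto simp: indicator_def)
  also have "(\<integral>\<^sup>+ z. indicator Q z \<partial>lborel) = emeasure lborel Q" by (simp add: Q_def)
  also have "\<dots> = 36" unfolding Q_def
    by (subst emeasure_lborel_cbox) (auto simp: Basis_complex_def)
  finally have "modulus (connecting_paths E F) \<le> ennreal 36" by simp
  moreover have "continuum E" "continuum F" "E \<inter> F = {}"
    using E F by (auto simp: continuum_def E_def F_def) force
  ultimately have "ennreal (Ct * ln (1 + min (diameter E) (diameter F) / setdist E F)) \<le> ennreal 36"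
    using assms unfolding modulus_constant_def by (meson order_trans)
  \<comment> \<open>Area 36 against a logarithm of at least 1/2 gives the bound 72.\<close>
  then have "Ct * ln (1 + min (diameter E) (diameter F) / setdist E F) \<le> 36"
    by (subst (asm) ennreal_le_iff) auto
  moreover have "Ct > 0" using assms by (simp add: modulus_constant_def)
  then have "Ct * (1/2) \<le> Ct * ln (1 + min (diameter E) (diameter F) / setdist E F)"
    using ln by (intro mult_left_mono) auto
  ultimately show ?thesis by simp
qed

section \<open>Weak derivatives and absolute continuity on lines\<close>

lemma C_k_Suc_D: "C_k (Suc k) \<phi> \<Longrightarrow> C_k k \<phi>"
proof (induction k arbitrary: \<phi>)
  case 0
  then show ?case
    by (auto intro!: continuous_at_imp_continuous_on differentiable_imp_continuous_within)
next
  case (Suc k)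
  then show ?case by (simp only: C_k.simps(2)) blast
qed

text \<open>Lets smoothness be checked on explicit derivatives instead of on
  \<open>frechet_derivative\<close>.\<close>

lemma C_k_SucI:
  assumes "\<And>z. (\<phi> has_derivative D z) (at z)" "\<And>v. v \<in> {1, \<i>} \<Longrightarrow> C_k k (\<lambda>z. D z v)"
  shows "C_k (Suc k) \<phi>"
proof -
  have "frechet_derivative \<phi> (at z) = D z" for z
    using assms(1) by (rule frechet_derivative_at[symmetric])
  then show ?thesis using assms by (auto simp: differentiable_def)
qed

lemma C_k_Suc_has_derivative:
  "C_k (Suc k) \<phi> \<Longrightarrow> (\<phi> has_derivative frechet_derivative \<phi> (at z)) (at z)"
  by (simp add: frechet_derivative_works)

lemma C_k_add: "C_k k \<phi> \<Longrightarrow> C_k k \<psi> \<Longrightarrow> C_k k (\<lambda>z. \<phi> z + \<psi> z)"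
proof (induction k arbitrary: \<phi> \<psi>)
  case 0
  then show ?case by (auto intro: continuous_on_add)
next
  case (Suc k)
  show ?case
    by (rule C_k_SucI, rule has_derivative_add[OF C_k_Suc_has_derivative[OF Suc.prems(1)]
          C_k_Suc_has_derivative[OF Suc.prems(2)]]) (use Suc in auto)
qed

lemma C_k_mult: "C_k k \<phi> \<Longrightarrow> C_k k \<psi> \<Longrightarrow> C_k k (\<lambda>z. \<phi> z * \<psi> z)"
proof (induction k arbitrary: \<phi> \<psi>)
  case 0
  then show ?case by (auto intro: continuous_on_mult)
next
  case (Suc k)
  have *: "C_k k \<phi>" "C_k k \<psi>" using Suc.prems C_k_Suc_D by blast+
  show ?case
    by (rule C_k_SucI, rule has_derivative_mult[OF C_k_Suc_has_derivative[OF Suc.prems(1)]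
          C_k_Suc_has_derivative[OF Suc.prems(2)]])
      (use Suc.prems in \<open>auto intro!: C_k_add Suc.IH *\<close>)
qed

lemma C_k_const: "C_k k (\<lambda>z. c)"
  by (induction k arbitrary: c) auto

lemma C_k_cmult: "C_k k \<phi> \<Longrightarrow> C_k k (\<lambda>z. c * \<phi> z)"
  by (intro C_k_mult C_k_const)

section \<open>Smooth cut-off functions\<close>

definition expinv :: "nat \<Rightarrow> real \<Rightarrow> real" where
  "expinv m x = (if x > 0 then inverse x ^ m * exp (- inverse x) else 0)"

lemma expinv_tendsto_0: "(expinv m \<longlongrightarrow> 0) (at_right 0)"
proof -
  have "((\<lambda>x. inverse x ^ m / exp (inverse x)) \<longlongrightarrow> 0) (at_right (0::real))"
    by (rule filterlim_compose[OF tendsto_power_div_exp_0 filterlim_inverse_at_top_right])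
  moreover have "\<forall>\<^sub>F x in at_right (0::real). inverse x ^ m / exp (inverse x) = expinv m x"
    using eventually_at_right_less[of 0] by eventually_elim (simp add: expinv_def exp_minus divide_inverse)
  ultimately show ?thesis by (rule Lim_transform_eventually)
qed

text \<open>The flat functions \<open>inverse x ^ m * exp (- inverse x)\<close>, extended by 0, are
  closed under differentiation up to linear combinations, so one induction will give smoothness of
  every order. At 0 the difference quotient of \<open>expinv m\<close> from the right is
  \<open>expinv (m+1)\<close>, which tends to 0.\<close>

lemma expinv_has_derivative:
  "(expinv m has_real_derivative (- real m * expinv (m+1) x + expinv (m+2) x)) (at x)"
proof -
  consider "x > 0" | "x < 0" | "x = 0" by linarith
  then show ?thesis
  proof cases
    case 1
    have "((\<lambda>x. inverse x ^ m * exp (- inverse x)) has_real_derivative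
        real m * (inverse x ^ (m - 1) * (- (inverse x * inverse x))) * exp (- inverse x)
        + inverse x ^ m * (exp (- inverse x) * (inverse x * inverse x))) (at x)"
      using 1 by (auto intro!: derivative_eq_intros)
    also have "real m * (inverse x ^ (m - 1) * (- (inverse x * inverse x))) * exp (- inverse x)
        + inverse x ^ m * (exp (- inverse x) * (inverse x * inverse x))
        = - real m * expinv (m+1) x + expinv (m+2) x"
      using 1 by (cases m) (simp_all add: expinv_def algebra_simps)
    finally have "((\<lambda>x. inverse x ^ m * exp (- inverse x)) has_real_derivative
        (- real m * expinv (m+1) x + expinv (m+2) x)) (at x)" .
    then show ?thesis
      by (rule has_field_derivative_transform_within_open[of _ _ _ "{0<..}"]) (use 1 in \<open>auto simp: expinv_def\<close>)
  next
    case 2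
    have "((\<lambda>x. 0) has_real_derivative (- real m * expinv (m+1) x + expinv (m+2) x)) (at x)"
      using 2 by (auto simp: expinv_def)
    then show ?thesis
      by (rule has_field_derivative_transform_within_open[of _ _ _ "{..<0}"]) (use 2 in \<open>auto simp: expinv_def\<close>)
  next
    case 3
    have "((\<lambda>h. expinv m h / h) \<longlongrightarrow> 0) (at 0)"
    proof (rule filterlim_split_at)
      have "\<forall>\<^sub>F x in at_left (0::real). expinv m x / x = 0"
        using eventually_at_left_real[of "-1" 0] by (auto elim!: eventually_mono simp: expinv_def)
      then show "((\<lambda>h. expinv m h / h) \<longlongrightarrow> 0) (at_left 0)" by (rule tendsto_eventually)
      have "\<forall>\<^sub>F x in at_right (0::real). expinv (m+1) x = expinv m x / x"
        using eventually_at_right_less[of 0] by eventually_elim (simp add: expinv_def divide_inverse)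
      with expinv_tendsto_0 show "((\<lambda>h. expinv m h / h) \<longlongrightarrow> 0) (at_right 0)"
        by (rule Lim_transform_eventually)
    qed
    then show ?thesis using 3 by (simp add: has_field_derivative_iff expinv_def)
  qed
qed

lemma continuous_on_expinv: "continuous_on S (expinv m)"
  using DERIV_continuous[OF expinv_has_derivative] continuous_at_imp_continuous_on by blast

lemma C_k_expinv:
  assumes l: "bounded_linear l"
  shows "C_k k (\<lambda>z. expinv m (l z + b))"
proof (induction k arbitrary: m)
  case 0
  show ?case unfolding C_k.simps
    by (rule continuous_on_compose2[OF continuous_on_expinv[of UNIV]])
      (auto intro!: continuous_on_add linear_continuous_on[OF l])
next
  case (Suc k)
  have d: "((\<lambda>z. expinv m (l z + b)) has_derivative
     (\<lambda>h. (- real m * expinv (m+1) (l z + b) + expinv (m+2) (l z + b)) * l h)) (at z)" for z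
  proof -
    have "((\<lambda>z. l z + b) has_derivative l) (at z)"
      using bounded_linear_imp_has_derivative[OF l] has_derivative_add_const by blast
    from has_derivative_compose[OF this expinv_has_derivative[unfolded has_field_derivative_def]]
    show ?thesis by simp
  qed
  have eq: "(\<lambda>z. (- real m * expinv (m+1) (l z + b) + expinv (m+2) (l z + b)) * l v)
    = (\<lambda>z. l v * (- real m * expinv (m+1) (l z + b) + expinv (m+2) (l z + b)))" for v
    by auto
  show ?case
    by (rule C_k_SucI[OF d], subst eq) (intro C_k_cmult C_k_add Suc)
qed

definition bump0 :: "real \<Rightarrow> real" where "bump0 x = expinv 0 x * expinv 0 (1 - x)"

lemma bump0_nonneg: "0 \<le> bump0 x"
  by (simp add: bump0_def expinv_def)

lemma bump0_eq_0: "x \<le> 0 \<or> 1 \<le> x \<Longrightarrow> bump0 x = 0"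
  by (auto simp: bump0_def expinv_def)

lemma continuous_on_bump0: "continuous_on S bump0"
  unfolding bump0_def
  by (intro continuous_intros continuous_on_expinv continuous_on_compose2[OF continuous_on_expinv[of UNIV]]) auto

lemma bump0_integrable: "bump0 integrable_on {a..b}"
  by (intro integrable_continuous_interval continuous_on_bump0)

definition bump_mass :: real where "bump_mass = integral {-1..1} bump0"

lemma bump_mass_pos: "bump_mass > 0"
proof -
  have "bump_mass \<ge> 0" unfolding bump_mass_def by (intro integral_nonneg bump0_integrable bump0_nonneg)
  moreover have "bump_mass \<noteq> 0"
  proof
    assume "bump_mass = 0"
    then have "\<forall>x\<in>{-1..1}. bump0 x = 0" unfolding bump_mass_def
      by (subst (asm) integral_eq_0_iff) (auto intro: continuous_on_bump0 bump0_nonneg)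
    then have "bump0 (1/2) = 0" by auto
    then show False by (simp add: bump0_def expinv_def)
  qed
  ultimately show ?thesis by simp
qed

definition bump :: "real \<Rightarrow> real" where "bump x = bump0 x / bump_mass"

text \<open>A smooth Heaviside function: 0 up to 0, and 1 from 1 on. Starting the integral at -1, to
  the left of the support of the bump, makes every \<open>x \<ge> 0\<close> an interior point of the
  interval on which the primitive is differentiated.\<close>

definition step :: "real \<Rightarrow> real" where "step x = integral {-1..x} bump0 / bump_mass"

lemma bump_nonneg: "0 \<le> bump x" using bump0_nonneg bump_mass_pos by (simp add: bump_def)

lemma bump_eq_0: "x \<le> 0 \<or> 1 \<le> x \<Longrightarrow> bump x = 0" using bump0_eq_0 by (simp add: bump_def)

lemma continuous_on_bump: "continuous_on S bump"
  unfolding bump_def using bump_mass_pos by (intro continuous_intros continuous_on_bump0) auto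

lemma step_eq_0: "x \<le> 0 \<Longrightarrow> step x = 0"
proof -
  assume "x \<le> 0"
  then have "integral {-1..x} bump0 = integral {-1..x} (\<lambda>_. 0)"
    by (intro integral_cong) (auto simp: bump0_eq_0)
  then show ?thesis by (simp add: step_def)
qed

lemma step_eq_1: "1 \<le> x \<Longrightarrow> step x = 1"
proof -
  assume "1 \<le> x"
  then have "integral {-1..1} bump0 + integral {1..x} bump0 = integral {-1..x} bump0"
    by (intro Henstock_Kurzweil_Integration.integral_combine bump0_integrable) auto
  moreover have "integral {1..x} bump0 = integral {1..x} (\<lambda>_. 0)"
    by (intro integral_cong) (auto simp: bump0_eq_0)
  ultimately show ?thesis using bump_mass_pos by (simp add: step_def bump_mass_def)
qed

lemma step_has_derivative: "(step has_real_derivative bump x) (at x)"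
proof (cases "x < 0")
  case True
  have "((\<lambda>x. 0) has_real_derivative bump x) (at x)" using True by (simp add: bump_eq_0)
  then show ?thesis
    by (rule has_field_derivative_transform_within_open[of _ _ _ "{..<0}"]) (use True in \<open>auto simp: step_eq_0\<close>)
next
  case False
  have "((\<lambda>u. integral {-1..u} bump0) has_vector_derivative bump0 x) (at x within {-1..x+1})"
    by (rule integral_has_vector_derivative) (use False in \<open>auto intro: continuous_on_bump0\<close>)
  then have "((\<lambda>u. integral {-1..u} bump0) has_real_derivative bump0 x) (at x)"
    using False at_within_interior[of x "{-1..x+1}"]
    by (simp add: has_real_derivative_iff_has_vector_derivative)
  then show ?thesis unfolding step_def[abs_def] bump_def by (rule DERIV_cdivide)
qed

lemma step_bounds: "0 \<le> step x \<and> step x \<le> 1"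
proof -
  have mono: "step x \<le> step y" if "x \<le> y" for x y
    by (rule DERIV_nonneg_imp_nondecreasing[OF that]) (use step_has_derivative bump_nonneg in blast)
  show ?thesis
    using mono[of "min 0 x" x] mono[of x "max 1 x"] by (simp add: step_eq_0 step_eq_1)
qed

text \<open>The induction has been done for \<open>expinv\<close>: the derivative of
  \<open>step\<close> is a multiple of a product of two such functions.\<close>

lemma C_k_step:
  assumes l: "bounded_linear l"
  shows "C_k k (\<lambda>z. step (l z + b))"
proof -
  have "C_k (Suc k) (\<lambda>z. step (l z + b))"
  proof (rule C_k_SucI)
    fix z
    have "((\<lambda>z. l z + b) has_derivative l) (at z)"
      using bounded_linear_imp_has_derivative[OF l] has_derivative_add_const by blast
    from has_derivative_compose[OF this step_has_derivative[unfolded has_field_derivative_def]]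
    show "((\<lambda>z. step (l z + b)) has_derivative (\<lambda>h. bump (l z + b) * l h)) (at z)" by simp
  next
    fix v
    have "C_k k (\<lambda>z. (l v / bump_mass) * (expinv 0 (l z + b) * expinv 0 ((- l z) + (1 - b))))"
      by (intro C_k_cmult C_k_mult C_k_expinv bounded_linear_minus l)
    then show "C_k k (\<lambda>z. bump (l z + b) * l v)" by (simp add: bump_def bump0_def algebra_simps)
  qed
  then show ?thesis by (rule C_k_Suc_D)
qed

lemma integral_bump: "integrable lborel bump" "(\<integral>u. bump u \<partial>lborel) = 1"
proof -
  have eq: "bump = (\<lambda>u. indicator {-1..1} u *\<^sub>R bump u)"
  proof
    fix u show "bump u = indicator {-1..1} u *\<^sub>R bump u"
      using bump_eq_0[of u] by (cases "u \<in> {-1..1}") auto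
  qed
  have si: "set_integrable lborel {-1..1} bump"
    unfolding set_integrable_def by (rule borel_integrable_compact) (auto intro: continuous_on_bump)
  then show "integrable lborel bump" unfolding set_integrable_def using eq by simp
  have "(\<integral>u. bump u \<partial>lborel) = (LINT u:{-1..1}|lborel. bump u)"
    unfolding set_lebesgue_integral_def using eq by simp
  also have "\<dots> = integral {-1..1} bump" using si by (rule set_borel_integral_eq_integral)
  also have "\<dots> = step 1" by (simp add: bump_def[abs_def] step_def)
  also have "\<dots> = 1" by (simp add: step_eq_1)
  finally show "(\<integral>u. bump u \<partial>lborel) = 1" .
qed

text \<open>A smoothed indicator, rising on \<open>[a, a + d]\<close> and falling on
  \<open>[b, b + d]\<close>. Both transitions lie to the right of their end point, so for
  \<open>d\<close> tending to 0 the limit is the indicator of the half-open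
  \<open>{a<..b}\<close>.\<close>

definition bcut :: "real \<Rightarrow> real \<Rightarrow> real \<Rightarrow> real \<Rightarrow> real" where
  "bcut d a b x = step ((x - a) / d) - step ((x - b) / d)"

lemma bcut_eq_0: "d > 0 \<Longrightarrow> a \<le> b \<Longrightarrow> x \<le> a \<or> b + d \<le> x \<Longrightarrow> bcut d a b x = 0"
  by (auto simp: bcut_def step_eq_0 step_eq_1 divide_nonpos_pos field_simps)

lemma abs_bcut_le: "\<bar>bcut d a b x\<bar> \<le> 1"
  using step_bounds[of "(x - a) / d"] step_bounds[of "(x - b) / d"] by (auto simp: bcut_def)

lemma continuous_on_step: "continuous_on S step"
  using DERIV_continuous[OF step_has_derivative] continuous_at_imp_continuous_on by blast

lemma continuous_on_bcut: "d > 0 \<Longrightarrow> continuous_on S (bcut d a b)"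
  unfolding bcut_def
  by (intro continuous_intros continuous_on_compose2[OF continuous_on_step[of UNIV]]) auto

lemma bcut_LIMSEQ:
  assumes "a < b"
  shows "(\<lambda>n. bcut (1 / Suc n) a b x) \<longlonglongrightarrow> indicator {a<..b} x"
proof -
  have ev: "\<forall>\<^sub>F n in sequentially. 1 \<le> (x - c) / (1 / Suc n)" if "c < x" for c
  proof -
    have "filterlim (\<lambda>n. (x - c) * real (Suc n)) at_top sequentially"
      using that by (intro filterlim_tendsto_pos_mult_at_top[OF tendsto_const]
          filterlim_compose[OF filterlim_real_sequentially] filterlim_Suc) auto
    then show ?thesis by (simp add: filterlim_at_top)
  qed
  consider "x \<le> a" | "a < x" "x \<le> b" | "b < x" by linarith
  then show ?thesis
  proof cases
    case 1
    then show ?thesis using assms by (simp add: bcut_eq_0)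
  next
    case 2
    have "\<forall>\<^sub>F n in sequentially. bcut (1 / Suc n) a b x = indicator {a<..b} x"
      using ev[OF 2(1)]
      by eventually_elim (use 2 in \<open>auto simp: bcut_def step_eq_1 step_eq_0 mult_nonpos_nonneg\<close>)
    then show ?thesis by (rule tendsto_eventually)
  next
    case 3
    have "\<forall>\<^sub>F n in sequentially. bcut (1 / Suc n) a b x = indicator {a<..b} x"
      using ev[OF 3] ev[OF less_trans[OF assms 3]]
      by eventually_elim (use 3 in \<open>auto simp: bcut_def step_eq_1\<close>)
    then show ?thesis by (rule tendsto_eventually)
  qed
qed

section \<open>Absolute continuity on lines\<close>

text \<open>
  Treats both coordinate directions at once: the derivative of \<open>f\<close> in direction \<open>v\<close> is the derivative
  of \<open>f \<circ> cc\<close> in the second variable.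
\<close>

locale coords =
  fixes l1 l2 :: "complex \<Rightarrow> real" and cc :: "real \<times> real \<Rightarrow> complex" and v :: complex
  assumes bl1: "bounded_linear l1" and bl2: "bounded_linear l2"
    and l1 [simp]: "l1 (cc (s, t)) = t" and l2 [simp]: "l2 (cc (s, t)) = s"
    and cc [simp]: "cc (l2 z, l1 z) = z"
    and l1v: "l1 v = 1" and l2v: "l2 v = 0"
    and cont: "continuous_on S cc"
    and distr: "distr lborel borel cc = lborel"
begin

lemma cc_measurable [measurable]: "cc \<in> borel_measurable borel"
  using cont by (rule borel_measurable_continuous_onI)

lemma test_function_product:
  assumes "d > 0" "a \<le> b" "c \<le> e"
  shows "test_function (\<lambda>z. bcut d a b (l1 z) * bcut d c e (l2 z))"
  unfolding test_function_def
proof safe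
  fix k
  have *: "C_k k (\<lambda>z. bcut d a b (l z))" if "bounded_linear l" for l a b
  proof -
    have "C_k k (\<lambda>z. step (l z / d + (- a / d)) + (-1) * step (l z / d + (- b / d)))"
      by (intro C_k_add C_k_cmult C_k_step bounded_linear_divide[THEN bounded_linear_compose] that)
    then show ?thesis by (simp add: bcut_def diff_divide_distrib)
  qed
  show "C_k k (\<lambda>z. bcut d a b (l1 z) * bcut d c e (l2 z))" by (intro C_k_mult * bl1 bl2)
next
  have "{z. bcut d a b (l1 z) * bcut d c e (l2 z) \<noteq> 0} \<subseteq> cc ` ({c..e+d} \<times> {a..b+d})"
  proof
    fix z assume "z \<in> {z. bcut d a b (l1 z) * bcut d c e (l2 z) \<noteq> 0}"
    then have "(l2 z, l1 z) \<in> {c..e+d} \<times> {a..b+d}"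
      using bcut_eq_0[OF assms(1,2), of "l1 z"] bcut_eq_0[OF assms(1,3), of "l2 z"] by force
    then show "z \<in> cc ` ({c..e+d} \<times> {a..b+d})" by (metis cc image_eqI)
  qed
  moreover have "compact (cc ` ({c..e+d} \<times> {a..b+d}))"
    by (intro compact_continuous_image cont compact_Times) auto
  ultimately show "compact (closure {z. bcut d a b (l1 z) * bcut d c e (l2 z) \<noteq> 0})"
    unfolding compact_closure by (rule bounded_subset[OF compact_imp_bounded, rotated])
qed

lemma frechet_derivative_product:
  assumes "d > 0"
  shows "frechet_derivative (\<lambda>z. bcut d a b (l1 z) * bcut d c e (l2 z)) (at z) v
    = (bump ((l1 z - a) / d) - bump ((l1 z - b) / d)) / d * bcut d c e (l2 z)"
proof -
  have s: "((\<lambda>z. step ((l z - a) / d)) has_derivative (\<lambda>h. bump ((l z - a) / d) * (l h / d))) (at z)"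
    if l: "bounded_linear l" for l a
  proof -
    have "((\<lambda>z. (l z - a) / d) has_derivative (\<lambda>h. l h / d)) (at z)"
      using bounded_linear_imp_has_derivative[OF l, of "at z"] assms
      by (auto intro!: derivative_eq_intros)
    from has_derivative_compose[OF this step_has_derivative[unfolded has_field_derivative_def]]
    show ?thesis by simp
  qed
  have "((\<lambda>z. bcut d a b (l1 z) * bcut d c e (l2 z)) has_derivative
     (\<lambda>h. bcut d a b (l1 z) * (bump ((l2 z - c) / d) * (l2 h / d) - bump ((l2 z - e) / d) * (l2 h / d))
      + (bump ((l1 z - a) / d) * (l1 h / d) - bump ((l1 z - b) / d) * (l1 h / d)) * bcut d c e (l2 z))) (at z)"
    unfolding bcut_def by (intro has_derivative_mult has_derivative_diff s bl1 bl2)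
  from fun_cong[OF frechet_derivative_at[OF this], of v, symmetric] show ?thesis
    by (simp add: l1v l2v diff_divide_distrib)
qed

end

text \<open>Half-open intervals are an intersection-stable generator of the Borel sets, so Dynkin's
  argument spreads the vanishing of the integral to all Borel sets. The passage to complements uses
  that the integral over the whole line vanishes, which follows by exhaustion.\<close>

lemma AE_eq_0_of_intervals:
  fixes u :: "real \<Rightarrow> complex"
  assumes u: "integrable lborel u"
    and 0: "\<And>c d. c < d \<Longrightarrow> (LINT y:{c<..d}|lborel. u y) = 0"
  shows "AE y in lborel. u y = 0"
proof (rule sigma_finite_measure.density_zero[OF sigma_finite_lborel u])
  have si: "set_integrable lborel A u" if "A \<in> sets borel" for A
    unfolding set_integrable_def using u that by (intro integrable_mult_indicator) auto
  have Z: "(LINT y:{c<..d}|lborel. u y) = 0" for c d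
    using 0[of c d] by (cases "c < d") (auto simp: set_lebesgue_integral_def)
  have tot: "(LINT y:UNIV|lborel. u y) = 0"
  proof -
    have UN: "(\<Union>n. {- real n<..real n}) = (UNIV :: real set)"
    proof safe
      fix x :: real
      obtain n where "\<bar>x\<bar> < real n" using reals_Archimedean2 by blast
      then show "x \<in> (\<Union>n. {- real n<..real n})" by (intro UN_I[of n]) auto
    qed simp
    have "(\<lambda>n. LINT y:{- real n<..real n}|lborel. u y) \<longlonglongrightarrow> (LINT y:(\<Union>n. {- real n<..real n})|lborel. u y)"
      by (rule set_integral_cont_up) (auto simp: incseq_def intro!: si)
    then show ?thesis unfolding UN by (simp add: Z LIMSEQ_const_iff)
  qed
  let ?G = "range (\<lambda>(a, b). {a<..b::real})"
  fix A :: "real set" assume "A \<in> sets lborel"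
  then have A: "A \<in> sigma_sets UNIV ?G" by (simp add: borel_sigma_sets_Ioc)
  have st: "Int_stable ?G" by (auto simp: Int_stable_def)
  have bor: "B \<in> sets borel" if "B \<in> sigma_sets UNIV ?G" for B
    using that by (simp add: borel_sigma_sets_Ioc)
  show "(LINT y:A|lborel. u y) = 0"
  proof (rule sigma_sets_induct_disjoint[OF st _ A])
    show "(LINT y:B|lborel. u y) = 0" if "B \<in> ?G" for B using that Z by auto
    show "(LINT y:{}|lborel. u y) = 0" by (simp add: set_lebesgue_integral_def)
  next
    fix B assume B: "B \<in> sigma_sets UNIV ?G" "(LINT y:B|lborel. u y) = 0"
    have "(LINT y:(UNIV - B) \<union> B|lborel. u y) = (LINT y:UNIV - B|lborel. u y) + (LINT y:B|lborel. u y)"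
      using bor[OF B(1)] by (intro set_integral_Un si) auto
    then show "(LINT y:UNIV - B|lborel. u y) = 0" using B(2) tot by simp
  next
    fix B :: "nat \<Rightarrow> real set"
    assume B: "disjoint_family B" "range B \<subseteq> sigma_sets UNIV ?G" "\<And>i. (LINT y:B i|lborel. u y) = 0"
    have "B i \<in> sets borel" for i using B(2) bor by blast
    then have "(LINT y:(\<Union>i. B i)|lborel. u y) = (\<Sum>i. LINT y:B i|lborel. u y)"
      using B(1) by (intro lebesgue_integral_countable_add si sets.countable_UN) (auto simp: disjoint_family_on_def)
    then show "(LINT y:(\<Union>i. B i)|lborel. u y) = 0" using B(3) by simp
  qed auto
qed

text \<open>
  The difference of bumps is the derivative of the cut-off \<open>bcut d a b\<close>: these products are all the
  test functions that absolute continuity on lines needs.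
\<close>

definition weak_partial2 :: "(real \<times> real \<Rightarrow> complex) \<Rightarrow> (real \<times> real \<Rightarrow> complex) \<Rightarrow> bool" where
  "weak_partial2 F G \<longleftrightarrow> continuous_on UNIV F \<and> G \<in> borel_measurable borel \<and>
    (\<forall>S. compact S \<longrightarrow> set_integrable lborel S G) \<and>
    (\<forall>d a b c e. 0 < d \<longrightarrow> a \<le> b \<longrightarrow> c \<le> e \<longrightarrow>
      (LINT p|lborel. ((bump ((snd p - a) / d) - bump ((snd p - b) / d)) / d * bcut d c e (fst p)) *\<^sub>R F p)
      = - (LINT p|lborel. (bcut d a b (snd p) * bcut d c e (fst p)) *\<^sub>R G p))"

lemma integrable_lborel_compact_support:
  fixes f :: "'a::euclidean_space \<Rightarrow> 'b::euclidean_space"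
  assumes "continuous_on UNIV f" "compact S" "\<And>x. x \<notin> S \<Longrightarrow> f x = 0"
  shows "integrable lborel f"
proof -
  have "integrable lborel (\<lambda>x. indicator S x *\<^sub>R f x)"
    using assms by (intro borel_integrable_compact) (auto intro: continuous_on_subset)
  also have "(\<lambda>x. indicator S x *\<^sub>R f x) = f" using assms(3) by (auto simp: indicator_def fun_eq_iff)
  finally show ?thesis .
qed

lemma LINT_scaled_bump:
  fixes f :: "real \<Rightarrow> complex"
  assumes "d > 0"
  shows "(LINT t|lborel. (bump ((t - a) / d) / d) *\<^sub>R f t) = (LINT u|lborel. bump u *\<^sub>R f (a + d * u))"
  using lborel_integral_real_affine[of d "\<lambda>t. (bump ((t - a) / d) / d) *\<^sub>R f t" a] assms
  by (simp flip: integral_scaleR_right)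

text \<open>Test functions tending to the indicator of the rectangle: the side with \<open>G\<close>
  converges by domination, while the derivative of the cut-off concentrates on the edges at
  \<open>a\<close> and \<open>b\<close>, where continuity of \<open>F\<close> identifies the
  limit.\<close>

lemma rectangle_formula:
  fixes F G :: "real \<times> real \<Rightarrow> complex"
  assumes wp: "weak_partial2 F G" and ab: "a < b" and ce: "c < e"
  shows "(LINT s:{c<..e}|lborel. F (s, b) - F (s, a)) = (LINT p:{c<..e} \<times> {a<..b}|lborel. G p)"
proof -
  have F: "continuous_on UNIV F" and G [measurable]: "G \<in> borel_measurable borel"
    and GI: "\<And>S. compact S \<Longrightarrow> set_integrable lborel S G"
    using wp by (auto simp: weak_partial2_def)
  have F' [measurable]: "F \<in> borel_measurable borel" using F by (rule borel_measurable_continuous_onI)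
  define \<delta> where "\<delta> = (\<lambda>n. 1 / real (Suc n))"
  have \<delta>: "0 < \<delta> n" "\<delta> n \<le> 1" for n by (auto simp: \<delta>_def)
  define R where "R = {c..e+1} \<times> {a..b+1}"
  have R: "compact R" by (auto simp: R_def intro: compact_Times)
  have cutc: "bcut (\<delta> n) c e s = 0" if "s \<notin> {c..e+1}" for s n
    using bcut_eq_0[OF \<delta>(1)[of n], of c e s] ce \<delta>(2)[of n] that by auto
  have cuta: "bcut (\<delta> n) a b s = 0" if "s \<notin> {a..b+1}" for s n
    using bcut_eq_0[OF \<delta>(1)[of n], of a b s] ab \<delta>(2)[of n] that by auto
  have meas_cut [measurable]: "bcut (\<delta> n) x y \<in> borel_measurable borel" for n x y
    using \<delta> by (intro borel_measurable_continuous_onI continuous_on_bcut)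
  have meas_bump [measurable]: "bump \<in> borel_measurable borel"
    by (intro borel_measurable_continuous_onI continuous_on_bump)
  have sqR: "set_integrable lborel R G" by (rule GI[OF R])
  have [measurable]: "fst \<in> borel_measurable (borel :: (real \<times> real) measure)"
    "snd \<in> borel_measurable (borel :: (real \<times> real) measure)"
    by (intro borel_measurable_continuous_onI continuous_intros)+
  have [measurable]: "{c<..e} \<times> {a<..b} \<in> sets borel"
    by (subst borel_prod[symmetric]) auto

  have limR: "(\<lambda>n. LINT p|lborel. (bcut (\<delta> n) a b (snd p) * bcut (\<delta> n) c e (fst p)) *\<^sub>R G p)
      \<longlonglongrightarrow> (LINT p|lborel. indicator ({c<..e} \<times> {a<..b}) p *\<^sub>R G p)"
  proof (rule integral_dominated_convergence[where w="\<lambda>p. norm (indicator R p *\<^sub>R G p)"])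
    show "integrable lborel (\<lambda>p. norm (indicator R p *\<^sub>R G p))"
      using sqR unfolding set_integrable_def by (rule integrable_norm)
    show "AE p in lborel. (\<lambda>n. (bcut (\<delta> n) a b (snd p) * bcut (\<delta> n) c e (fst p)) *\<^sub>R G p)
        \<longlonglongrightarrow> indicator ({c<..e} \<times> {a<..b}) p *\<^sub>R G p"
    proof (rule AE_I2)
      fix p :: "real \<times> real"
      have "(\<lambda>n. (bcut (\<delta> n) a b (snd p) * bcut (\<delta> n) c e (fst p)) *\<^sub>R G p)
        \<longlonglongrightarrow> (indicator {a<..b} (snd p) * indicator {c<..e} (fst p)) *\<^sub>R G p"
        unfolding \<delta>_def by (intro tendsto_intros bcut_LIMSEQ ab ce)
      then show "(\<lambda>n. (bcut (\<delta> n) a b (snd p) * bcut (\<delta> n) c e (fst p)) *\<^sub>R G p)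
        \<longlonglongrightarrow> indicator ({c<..e} \<times> {a<..b}) p *\<^sub>R G p"
        by (cases p) (simp add: indicator_times mult.commute)
    qed
    fix n show "AE p in lborel. norm ((bcut (\<delta> n) a b (snd p) * bcut (\<delta> n) c e (fst p)) *\<^sub>R G p)
        \<le> norm (indicator R p *\<^sub>R G p)"
    proof (rule AE_I2)
      fix p :: "real \<times> real"
      show "norm ((bcut (\<delta> n) a b (snd p) * bcut (\<delta> n) c e (fst p)) *\<^sub>R G p)
        \<le> norm (indicator R p *\<^sub>R G p)"
      proof (cases "p \<in> R")
        case True
        have "\<bar>bcut (\<delta> n) a b (snd p)\<bar> * \<bar>bcut (\<delta> n) c e (fst p)\<bar> \<le> 1 * 1"
          by (intro mult_mono abs_bcut_le) auto
        then show ?thesis using True by (simp add: abs_mult mult_left_le_one_le)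
      next
        case False
        then have z: "bcut (\<delta> n) a b (snd p) * bcut (\<delta> n) c e (fst p) = 0"
          using cuta cutc by (cases p) (auto simp: R_def)
        show ?thesis unfolding z by simp
      qed
    qed
  qed measurable

  obtain M where M: "\<And>p. p \<in> R \<Longrightarrow> norm (F p) \<le> M"
    using compact_imp_bounded[OF compact_continuous_image[OF continuous_on_subset[OF F] R]]
    unfolding bounded_iff by auto
  \<comment> \<open>The average of \<open>F (s, _)\<close> over \<open>[x, x + \<delta> n]\<close>
    against the scaled bump; the substitution has moved the scale from the bump into the argument of
    \<open>F\<close>.\<close>
  define A where "A = (\<lambda>n x s. LINT u|lborel. bump u *\<^sub>R F (s, x + \<delta> n * u))"
  have A_meas [measurable]: "A n x \<in> borel_measurable borel" for n x
    unfolding A_def by measurable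
  have bM: "norm (bump u *\<^sub>R F (s, x + \<delta> n * u)) \<le> bump u * M" if "x \<in> {a..b}" "s \<in> {c..e+1}" for u x s n
  proof (cases "0 \<le> u \<and> u \<le> 1")
    case True
    then have "0 \<le> \<delta> n * u" "\<delta> n * u \<le> 1" using \<delta>[of n] by (auto simp: mult_le_one)
    then have "(s, x + \<delta> n * u) \<in> R" using that by (auto simp: R_def)
    then show ?thesis using M bump_nonneg by (auto intro: mult_left_mono)
  qed (auto simp: bump_eq_0)
  have A_bound: "norm (A n x s) \<le> M" if "x \<in> {a..b}" "s \<in> {c..e+1}" for n x s
  proof -
    have "norm (A n x s) \<le> (LINT u|lborel. bump u * M)"
      unfolding A_def
    proof (rule order_trans[OF integral_norm_bound integral_mono])
      have "continuous_on UNIV (\<lambda>u. bump u *\<^sub>R F (s, x + \<delta> n * u))"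
        by (intro continuous_intros continuous_on_bump continuous_on_compose2[OF F]) auto
      then have "integrable lborel (\<lambda>u. bump u *\<^sub>R F (s, x + \<delta> n * u))"
        by (rule integrable_lborel_compact_support[of _ "{0..1}"]) (auto simp: bump_eq_0)
      then show "integrable lborel (\<lambda>u. norm (bump u *\<^sub>R F (s, x + \<delta> n * u)))"
        by (rule integrable_norm)
      show "integrable lborel (\<lambda>u. bump u * M)" using integral_bump by auto
      fix u
      show "norm (bump u *\<^sub>R F (s, x + \<delta> n * u)) \<le> bump u * M" by (rule bM) (use that in auto)
    qed
    then show ?thesis using integral_bump by simp
  qed
  have A_lim: "(\<lambda>n. A n x s) \<longlonglongrightarrow> F (s, x)" if "x \<in> {a..b}" "s \<in> {c..e+1}" for x s
  proof -
    have "(\<lambda>n. A n x s) \<longlonglongrightarrow> (LINT u|lborel. bump u *\<^sub>R F (s, x))"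
      unfolding A_def
    proof (rule integral_dominated_convergence[where w="\<lambda>u. bump u * M"])
      show "integrable lborel (\<lambda>u. bump u * M)" using integral_bump by auto
      show "AE u in lborel. (\<lambda>n. bump u *\<^sub>R F (s, x + \<delta> n * u)) \<longlonglongrightarrow> bump u *\<^sub>R F (s, x)"
      proof (rule AE_I2)
        fix u :: real
        have "\<delta> \<longlonglongrightarrow> 0" unfolding \<delta>_def using LIMSEQ_inverse_real_of_nat by (simp add: divide_inverse)
        then have "(\<lambda>n. (s, x + \<delta> n * u)) \<longlonglongrightarrow> (s, x + 0 * u)" by (intro tendsto_intros)
        then have "(\<lambda>n. F (s, x + \<delta> n * u)) \<longlonglongrightarrow> F (s, x + 0 * u)"
          by (rule continuous_on_tendsto_compose[OF F]) auto
        then show "(\<lambda>n. bump u *\<^sub>R F (s, x + \<delta> n * u)) \<longlonglongrightarrow> bump u *\<^sub>R F (s, x)"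
          by (intro tendsto_intros) simp
      qed
      fix n
      show "AE u in lborel. norm (bump u *\<^sub>R F (s, x + \<delta> n * u)) \<le> bump u * M"
        by (rule AE_I2, rule bM) (use that in auto)
    qed measurable
    moreover have "(LINT u|lborel. bump u *\<^sub>R F (s, x)) = F (s, x)"
      using integral_bump by simp
    ultimately show ?thesis by simp
  qed

  have limL: "(\<lambda>n. LINT s|lborel. bcut (\<delta> n) c e s *\<^sub>R (A n a s - A n b s))
      \<longlonglongrightarrow> (LINT s|lborel. indicator {c<..e} s *\<^sub>R (F (s, a) - F (s, b)))"
  proof (rule integral_dominated_convergence[where w="\<lambda>s. indicator {c..e+1} s * (2 * M)"])
    show "integrable lborel (\<lambda>s. indicator {c..e+1} s * (2 * M))"
      by (intro integrable_mult_left integrable_real_indicator) (simp_all add: emeasure_lborel_Icc_eq)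
    show "AE s in lborel. (\<lambda>n. bcut (\<delta> n) c e s *\<^sub>R (A n a s - A n b s))
        \<longlonglongrightarrow> indicator {c<..e} s *\<^sub>R (F (s, a) - F (s, b))"
    proof (rule AE_I2)
      fix s
      show "(\<lambda>n. bcut (\<delta> n) c e s *\<^sub>R (A n a s - A n b s))
        \<longlonglongrightarrow> indicator {c<..e} s *\<^sub>R (F (s, a) - F (s, b))"
      proof (cases "s \<in> {c..e+1}")
        case True
        have "(\<lambda>n. bcut (\<delta> n) c e s) \<longlonglongrightarrow> indicator {c<..e} s"
          unfolding \<delta>_def by (rule bcut_LIMSEQ[OF ce])
        then show ?thesis using True ab by (intro tendsto_intros A_lim) auto
      next
        case False
        then have "s \<notin> {c<..e}" by auto
        then show ?thesis using cutc[OF False] by simp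
      qed
    qed
    fix n
    show "AE s in lborel. norm (bcut (\<delta> n) c e s *\<^sub>R (A n a s - A n b s)) \<le> indicator {c..e+1} s * (2 * M)"
    proof (rule AE_I2)
      fix s
      show "norm (bcut (\<delta> n) c e s *\<^sub>R (A n a s - A n b s)) \<le> indicator {c..e+1} s * (2 * M)"
      proof (cases "s \<in> {c..e+1}")
        case True
        have "norm (A n a s - A n b s) \<le> 2 * M"
          using norm_triangle_ineq4[of "A n a s" "A n b s"] A_bound[of a s n] A_bound[of b s n] True ab
          by auto
        then have "\<bar>bcut (\<delta> n) c e s\<bar> * norm (A n a s - A n b s) \<le> 1 * (2 * M)"
          by (intro mult_mono abs_bcut_le) auto
        then show ?thesis using True by simp
      next
        case False
        then show ?thesis using cutc[OF False] by simp
      qed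
    qed
  qed measurable

  \<comment> \<open>The identity in \<open>weak_partial2\<close>, with its left side evaluated by
    Fubini.\<close>
  have eq: "(LINT s|lborel. bcut (\<delta> n) c e s *\<^sub>R (A n a s - A n b s))
      = - (LINT p|lborel. (bcut (\<delta> n) a b (snd p) * bcut (\<delta> n) c e (fst p)) *\<^sub>R G p)" for n
  proof -
    let ?d = "\<delta> n"
    let ?H = "\<lambda>x p. ((bump ((snd p - x) / ?d)) / ?d * bcut ?d c e (fst p)) *\<^sub>R F p"
    have int: "integrable lborel (?H x)" if "x \<in> {a..b}" for x
    proof (rule integrable_lborel_compact_support[OF _ R])
      show "continuous_on UNIV (?H x)"
        using \<delta>(1)[of n]
        by (intro continuous_intros F continuous_on_compose2[OF continuous_on_bump[of UNIV]]
            continuous_on_compose2[OF continuous_on_bcut[of ?d UNIV]]) auto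
      fix p assume "p \<notin> R"
      show "?H x p = 0"
      proof (cases "fst p \<in> {c..e+1}")
        case True
        then have "snd p < a \<or> b + 1 < snd p" using \<open>p \<notin> R\<close> by (cases p) (auto simp: R_def)
        then have "(snd p - x) / ?d \<le> 0 \<or> 1 \<le> (snd p - x) / ?d"
          using that \<delta>[of n] by (auto simp: field_simps)
        then show ?thesis by (simp add: bump_eq_0)
      qed (simp add: cutc)
    qed
    have fub: "(LINT p|lborel. ?H x p) = (LINT s|lborel. bcut ?d c e s *\<^sub>R A n x s)" if "x \<in> {a..b}" for x
    proof -
      have "(LINT p|lborel. ?H x p) = (LINT s|lborel. LINT t|lborel. ?H x (s, t))"
        using lborel_pair.integral_fst'[of "?H x"] int[OF that] by (simp add: lborel_prod)
      also have "\<dots> = (LINT s|lborel. bcut ?d c e s *\<^sub>R (LINT t|lborel. (bump ((t - x) / ?d) / ?d) *\<^sub>R F (s, t)))"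
        by (simp flip: integral_scaleR_right add: mult.commute)
      also have "\<dots> = (LINT s|lborel. bcut ?d c e s *\<^sub>R A n x s)"
        unfolding A_def by (subst LINT_scaled_bump[OF \<delta>(1)]) simp
      finally show ?thesis .
    qed
    have intA: "integrable lborel (\<lambda>s. bcut ?d c e s *\<^sub>R A n x s)" if "x \<in> {a..b}" for x
    proof -
      have "integrable lborel (\<lambda>s. LINT t|lborel. ?H x (s, t))"
        using lborel_pair.integrable_fst'[of "?H x"] int[OF that] by (simp add: lborel_prod)
      also have "(\<lambda>s. LINT t|lborel. ?H x (s, t)) = (\<lambda>s. bcut ?d c e s *\<^sub>R (LINT t|lborel. (bump ((t - x) / ?d) / ?d) *\<^sub>R F (s, t)))"
        by (simp flip: integral_scaleR_right add: mult.commute)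
      also have "\<dots> = (\<lambda>s. bcut ?d c e s *\<^sub>R A n x s)"
        unfolding A_def by (subst LINT_scaled_bump[OF \<delta>(1)]) simp
      finally show ?thesis .
    qed
    have "(LINT s|lborel. bcut ?d c e s *\<^sub>R (A n a s - A n b s))
        = (LINT s|lborel. bcut ?d c e s *\<^sub>R A n a s) - (LINT s|lborel. bcut ?d c e s *\<^sub>R A n b s)"
      using ab by (subst Bochner_Integration.integral_diff[symmetric]) (auto intro!: intA simp: scaleR_diff_right)
    also have "\<dots> = (LINT p|lborel. ?H a p) - (LINT p|lborel. ?H b p)"
      using ab by (simp only: fub atLeastAtMost_iff order_refl less_imp_le)
    also have "\<dots> = (LINT p|lborel. ?H a p - ?H b p)"
      using ab by (subst Bochner_Integration.integral_diff[OF int int]) auto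
    also have "\<dots> = (LINT p|lborel. ((bump ((snd p - a) / ?d) - bump ((snd p - b) / ?d)) / ?d * bcut ?d c e (fst p)) *\<^sub>R F p)"
      by (intro Bochner_Integration.integral_cong) (auto simp: algebra_simps diff_divide_distrib scaleR_diff_left)
    also have "\<dots> = - (LINT p|lborel. (bcut (\<delta> n) a b (snd p) * bcut (\<delta> n) c e (fst p)) *\<^sub>R G p)"
      using wp \<delta>(1)[of n] ab ce unfolding weak_partial2_def by simp
    finally show ?thesis .
  qed
  have "(LINT s|lborel. indicator {c<..e} s *\<^sub>R (F (s, a) - F (s, b)))
      = - (LINT p|lborel. indicator ({c<..e} \<times> {a<..b}) p *\<^sub>R G p)"
    using LIMSEQ_unique[OF limL[unfolded eq] tendsto_minus[OF limR]] .
  moreover have "(LINT s|lborel. indicator {c<..e} s *\<^sub>R (F (s, b) - F (s, a)))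
     = - (LINT s|lborel. indicator {c<..e} s *\<^sub>R (F (s, a) - F (s, b)))"
    by (subst integral_minus[symmetric]) (simp flip: scaleR_minus_right)
  ultimately show ?thesis unfolding set_lebesgue_integral_def by simp
qed

text \<open>For fixed end points, the rectangle formula says that two functions of \<open>s\<close>
  have the same integral over every interval, so they agree for almost every \<open>s\<close>.
  Countably many end points can be treated at once, and continuity in the second variable reaches
  the others.\<close>

lemma acl_of_weak_partial2:
  fixes F G :: "real \<times> real \<Rightarrow> complex"
  assumes wp: "weak_partial2 F G"
  shows "AE s in lborel. (\<forall>a b. set_integrable lborel {a..b} (\<lambda>t. G (s, t))) \<and>
    (\<forall>a b. a \<le> b \<longrightarrow> F (s, b) - F (s, a) = (LINT t:{a..b}|lborel. G (s, t)))"
proof -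
  have F: "continuous_on UNIV F" and G [measurable]: "G \<in> borel_measurable borel"
    and GI: "\<And>S. compact S \<Longrightarrow> set_integrable lborel S G"
    using wp by (auto simp: weak_partial2_def)
  have GB: "set_integrable lborel S G" if "S \<subseteq> {a..b} \<times> {c..d}" "S \<in> sets borel" for S a b c d
    by (rule set_integrable_subset[OF GI[OF compact_Times[OF compact_Icc compact_Icc]]]) (use that in simp_all)
  have boxm: "{c<..d} \<times> {a<..b} \<in> sets borel" for a b c d :: real
    unfolding borel_prod[symmetric] by (intro pair_measureI) simp_all
  have int: "AE s in lborel. \<forall>N::nat. s \<in> {- real N..real N} \<longrightarrow> set_integrable lborel {- real N..real N} (\<lambda>t. G (s, t))"
    unfolding AE_all_countable
  proof
    fix N :: nat
    let ?I = "{- real N..real N}"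
    have "integrable lborel (\<lambda>p. indicator (?I \<times> ?I) p *\<^sub>R G p)"
      using GI[of "?I \<times> ?I"] by (simp add: set_integrable_def compact_Times)
    then have "AE s in lborel. integrable lborel (\<lambda>t. indicator (?I \<times> ?I) (s, t) *\<^sub>R G (s, t))"
      using lborel_pair.AE_integrable_fst'[of "\<lambda>p. indicator (?I \<times> ?I) p *\<^sub>R G p"]
      by (simp only: lborel_prod)
    then show "AE s in lborel. s \<in> ?I \<longrightarrow> set_integrable lborel ?I (\<lambda>t. G (s, t))"
    proof eventually_elim
      case (elim s)
      then show ?case by (cases "s \<in> ?I") (auto simp: set_integrable_def indicator_times)
    qed
  qed
  \<comment> \<open>The exceptional set must not depend on the end points, hence the restriction to
    rational \<open>q\<close> and natural \<open>N\<close>.\<close>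
  have rat: "AE s in lborel. \<forall>N::nat. \<forall>q\<in>\<rat>. s \<in> {- real N<..real N} \<longrightarrow> q \<in> {- real N<..real N} \<longrightarrow>
      F (s, q) - F (s, - real N) = (LINT t:{- real N<..q}|lborel. G (s, t))"
    unfolding AE_all_countable
  proof
    fix N :: nat
    show "AE s in lborel. \<forall>q\<in>\<rat>. s \<in> {- real N<..real N} \<longrightarrow> q \<in> {- real N<..real N} \<longrightarrow>
      F (s, q) - F (s, - real N) = (LINT t:{- real N<..q}|lborel. G (s, t))"
    proof (subst AE_ball_countable[OF countable_rat], rule ballI)
      fix q :: real
      let ?I = "{- real N<..real N}"
      show "AE s in lborel. s \<in> ?I \<longrightarrow> q \<in> ?I \<longrightarrow>
        F (s, q) - F (s, - real N) = (LINT t:{- real N<..q}|lborel. G (s, t))"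
      proof (cases "q \<in> ?I")
        case q: True
        let ?B = "?I \<times> {- real N<..q}"
        have intB: "integrable lborel (\<lambda>p. indicator ?B p *\<^sub>R G p)"
          using GB[of ?B "- real N" "real N" "- real N" q] boxm unfolding set_integrable_def by force
        have intF: "integrable lborel (\<lambda>s. indicator ?I s *\<^sub>R (F (s, q) - F (s, - real N)))"
        proof -
          have "set_integrable lborel {- real N..real N} (\<lambda>s. F (s, q) - F (s, - real N))"
            unfolding set_integrable_def
            by (intro borel_integrable_compact continuous_intros continuous_on_compose2[OF F]) auto
          then have "set_integrable lborel ?I (\<lambda>s. F (s, q) - F (s, - real N))"
            by (rule set_integrable_subset) auto
          then show ?thesis by (simp add: set_integrable_def)
        qed
        define u where "u = (\<lambda>s. indicator ?I s *\<^sub>R (F (s, q) - F (s, - real N)) - (LINT t|lborel. indicator ?B (s, t) *\<^sub>R G (s, t)))"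
        have intL: "integrable lborel (\<lambda>s. LINT t|lborel. indicator ?B (s, t) *\<^sub>R G (s, t))"
          using lborel_pair.integrable_fst'[of "\<lambda>p. indicator ?B p *\<^sub>R G p"] intB
          by (simp only: lborel_prod)
        have "AE s in lborel. u s = 0"
        proof (rule AE_eq_0_of_intervals)
          show "integrable lborel u" unfolding u_def using intF intL by (rule Bochner_Integration.integrable_diff)
          fix c d :: real assume "c < d"
          let ?c = "max c (- real N)" and ?d = "min d (real N)"
          have ind: "indicator {c<..d} s *\<^sub>R indicator ?I s = (indicator {?c<..?d} s :: real)" for s
            by (auto simp: indicator_def)
          have indB: "indicator {c<..d} s * indicator ?B (s, t) = (indicator ({?c<..?d} \<times> {- real N<..q}) (s, t) :: real)" for s t
            by (auto simp: indicator_def)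
          have mi: "set_integrable lborel {c<..d} f" if "integrable lborel f" for f :: "real \<Rightarrow> complex"
            unfolding set_integrable_def using that by (intro integrable_mult_indicator) simp_all
          have "(LINT s:{c<..d}|lborel. u s)
            = (LINT s:{c<..d}|lborel. indicator ?I s *\<^sub>R (F (s, q) - F (s, - real N)))
             - (LINT s:{c<..d}|lborel. LINT t|lborel. indicator ?B (s, t) *\<^sub>R G (s, t))"
            unfolding u_def by (intro set_integral_diff(2) mi intF intL)
          also have "(LINT s:{c<..d}|lborel. indicator ?I s *\<^sub>R (F (s, q) - F (s, - real N)))
             = (LINT s:{?c<..?d}|lborel. F (s, q) - F (s, - real N))"
            unfolding set_lebesgue_integral_def using ind by simp
          also have "(LINT s:{c<..d}|lborel. LINT t|lborel. indicator ?B (s, t) *\<^sub>R G (s, t))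
             = (LINT s|lborel. LINT t|lborel. indicator ({?c<..?d} \<times> {- real N<..q}) (s, t) *\<^sub>R G (s, t))"
            unfolding set_lebesgue_integral_def
            by (simp only: integral_scaleR_right[symmetric] scaleR_scaleR indB)
          also have "\<dots> = (LINT p|lborel. indicator ({?c<..?d} \<times> {- real N<..q}) p *\<^sub>R G p)"
          proof -
            have "integrable lborel (\<lambda>p. indicator ({?c<..?d} \<times> {- real N<..q}) p *\<^sub>R G p)"
              using GB[of "{?c<..?d} \<times> {- real N<..q}" ?c ?d "- real N" q] boxm
              unfolding set_integrable_def by force
            then show ?thesis
              using lborel_pair.integral_fst'[of "\<lambda>p. indicator ({?c<..?d} \<times> {- real N<..q}) p *\<^sub>R G p"]
              by (simp add: lborel_prod)
          qed
          also have "\<dots> = (LINT s:{?c<..?d}|lborel. F (s, q) - F (s, - real N))"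
          proof (cases "?c < ?d")
            case True
            then show ?thesis using rectangle_formula[OF wp _ True, of "- real N" q] q
              by (simp add: set_lebesgue_integral_def)
          next
            case False
            then have e: "{?c<..?d} = {}" unfolding not_less by (rule greaterThanAtMost_empty)
            show ?thesis unfolding e set_lebesgue_integral_def by simp
          qed
          finally show "(LINT s:{c<..d}|lborel. u s) = 0" by simp
        qed
        then show ?thesis
        proof eventually_elim
          case (elim s)
          then show ?case
            by (cases "s \<in> ?I") (auto simp: u_def indicator_times set_lebesgue_integral_def)
        qed
      next
        case False
        then show ?thesis by (intro AE_I2) auto
      qed
    qed
  qed
  from int rat show ?thesis
  proof eventually_elim
    case (elim s)
    have si: "set_integrable lborel {a..b} (\<lambda>t. G (s, t))" for a b
    proof -
      obtain N where "max \<bar>s\<bar> (max \<bar>a\<bar> \<bar>b\<bar>) < real N" using reals_Archimedean2 by blast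
      then have N: "s \<in> {- real N..real N}" "{a..b} \<subseteq> {- real N..real N}" by auto
      then have "set_integrable lborel {- real N..real N} (\<lambda>t. G (s, t))"
        using elim(1) by blast
      then show ?thesis by (rule set_integrable_subset) (use N in simp_all)
    qed
    have hk: "(\<lambda>t. G (s, t)) integrable_on {a..b}" "(LINT t:{a..b}|lborel. G (s, t)) = integral {a..b} (\<lambda>t. G (s, t))" for a b
      using set_borel_integral_eq_integral[OF si] by auto
    have "F (s, b) - F (s, a) = integral {a..b} (\<lambda>t. G (s, t))" if "a \<le> b" for a b
    proof -
      obtain N where N: "max \<bar>s\<bar> (max \<bar>a\<bar> \<bar>b\<bar>) < real N" using reals_Archimedean2 by blast
      let ?N = "real N"
      \<comment> \<open>The defect is continuous and vanishes at the rationals of the open interval,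
        so it vanishes throughout it.\<close>
      define H where "H = (\<lambda>t. F (s, t) - F (s, - ?N) - integral {- ?N..t} (\<lambda>t. G (s, t)))"
      have "continuous_on {- ?N..?N} H"
        unfolding H_def
        by (intro continuous_intros indefinite_integral_continuous_1 hk continuous_on_compose2[OF F]) auto
      then have closed: "closed {t \<in> {- ?N..?N}. H t = 0}"
        by (intro continuous_closed_preimage_constant) auto
      have Q0: "H q = 0" if "q \<in> \<rat>" "q \<in> {- ?N<..?N}" for q
      proof -
        have "s \<in> {- ?N<..?N}" "q \<in> {- ?N<..?N}" using N that by auto
        then have "F (s, q) - F (s, - ?N) = (LINT t:{- ?N<..q}|lborel. G (s, t))"
          using elim(2) that(1) by blast
        also have "\<dots> = (LINT t:{- ?N..q}|lborel. G (s, t))"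
          unfolding set_lebesgue_integral_def
        proof (rule integral_cong_AE)
          show "AE t in lborel. indicat_real {- ?N<..q} t *\<^sub>R G (s, t) = indicat_real {- ?N..q} t *\<^sub>R G (s, t)"
            using AE_lborel_singleton[of "- ?N"] by eventually_elim (auto simp: indicator_def)
        qed measurable
        finally show ?thesis by (simp add: H_def hk)
      qed
      have H0: "H t = 0" if "t \<in> {- ?N<..<?N}" for t
      proof -
        have "t \<in> closure {t \<in> {- ?N..?N}. H t = 0}"
          unfolding closure_approachable
        proof safe
          fix e :: real assume "0 < e"
          then obtain q where "q \<in> \<rat>" "max (- ?N) (t - e) < q" "q < t"
            using Rats_dense_in_real[of "max (- ?N) (t - e)" t] \<open>t \<in> _\<close> by auto
          then show "\<exists>y\<in>{t \<in> {- ?N..?N}. H t = 0}. dist y t < e"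
            using Q0[of q] that by (intro bexI[of _ q]) (auto simp: dist_real_def)
        qed
        then show ?thesis using closed by simp
      qed
      have "integral {- ?N..a} (\<lambda>t. G (s, t)) + integral {a..b} (\<lambda>t. G (s, t)) = integral {- ?N..b} (\<lambda>t. G (s, t))"
        using N that by (intro Henstock_Kurzweil_Integration.integral_combine hk) auto
      moreover have "H a = 0" "H b = 0" using N by (auto intro!: H0)
      ultimately show ?thesis by (simp add: H_def algebra_simps)
    qed
    then show ?case using si hk by auto
  qed
qed

text \<open>Fubini on \<open>lborel\<close> asks for Borel functions, while weak derivatives are
  only Lebesgue measurable. Measurability follows by exhausting the plane with discs, and each
  coordinate then agrees almost everywhere with a Borel function.\<close>

lemma locally_integrable_borel_version:
  fixes g :: "complex \<Rightarrow> 'b::euclidean_space"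
  assumes "locally_integrable g"
  obtains g' where "g' \<in> borel_measurable borel" "g \<in> borel_measurable lebesgue"
    "AE z in lborel. g z = g' z" "\<And>S. compact S \<Longrightarrow> set_integrable lborel S g'"
proof -
  have gi: "integrable lebesgue (\<lambda>z. indicator (cball 0 (real n)) z *\<^sub>R g z)" for n
    using assms by (auto simp: locally_integrable_def set_integrable_def)
  have g: "g \<in> borel_measurable lebesgue"
  proof (rule borel_measurable_LIMSEQ_metric)
    show "(\<lambda>z. indicator (cball 0 (real n)) z *\<^sub>R g z) \<in> borel_measurable lebesgue" for n
      using gi by (rule borel_measurable_integrable)
    fix z :: complex
    have "\<forall>\<^sub>F n in sequentially. norm z \<le> real n"
      by (rule eventually_sequentiallyI[of "nat \<lceil>norm z\<rceil>"]) linarith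
    then have "\<forall>\<^sub>F n in sequentially. indicator (cball 0 (real n)) z *\<^sub>R g z = g z"
      by eventually_elim simp
    then show "(\<lambda>n. indicator (cball 0 (real n)) z *\<^sub>R g z) \<longlonglongrightarrow> g z" by (rule tendsto_eventually)
  qed
  have "\<exists>h. h \<in> borel_measurable lborel \<and> (AE z in lborel. g z \<bullet> b = h z)" for b
  proof -
    have "(\<lambda>z. g z \<bullet> b) \<in> borel_measurable lebesgue" using g by simp
    from completion_ex_borel_measurable_real[OF this] show ?thesis by blast
  qed
  then obtain h where h: "\<And>b. h b \<in> borel_measurable lborel" "\<And>b. AE z in lborel. g z \<bullet> b = h b z"
    by metis
  define g' where "g' = (\<lambda>z. \<Sum>b\<in>Basis. h b z *\<^sub>R b)"
  have g': "g' \<in> borel_measurable lborel" "AE z in lborel. g z = g' z"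
  proof -
    show "g' \<in> borel_measurable lborel" using h(1) unfolding g'_def by simp
    have "AE z in lborel. \<forall>b\<in>Basis. g z \<bullet> b = h b z" using h(2) by (intro AE_finite_allI) auto
    then show "AE z in lborel. g z = g' z"
    proof eventually_elim
      case (elim z)
      have "g z = (\<Sum>b\<in>Basis. (g z \<bullet> b) *\<^sub>R b)" by (simp add: euclidean_representation)
      also have "\<dots> = g' z" unfolding g'_def using elim by (intro sum.cong) auto
      finally show ?case .
    qed
  qed
  have "set_integrable lborel S g'" if "compact S" for S
  proof -
    have S: "S \<in> sets borel" using that by (simp add: compact_imp_closed)
    have m: "(\<lambda>z. indicator S z *\<^sub>R g' z) \<in> borel_measurable lborel"
      using g'(1) S by (intro borel_measurable_scaleR borel_measurable_indicator) simp_all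
    have "integrable lebesgue (\<lambda>z. indicator S z *\<^sub>R g z)"
      using assms that by (auto simp: locally_integrable_def set_integrable_def)
    moreover have "AE z in lebesgue. indicat_real S z *\<^sub>R g z = indicat_real S z *\<^sub>R g' z"
      using AE_completion[OF g'(2)] by eventually_elim simp
    ultimately have "integrable lebesgue (\<lambda>z. indicator S z *\<^sub>R g' z)"
      using integrable_cong_AE[OF borel_measurable_integrable measurable_completion[OF m]] by blast
    then show ?thesis unfolding set_integrable_def using integrable_completion[OF m] by simp
  qed
  then show ?thesis using that g g' by auto
qed

text \<open>The test function is specialised to a product of cut-offs, and the measure-preserving
  map \<open>cc\<close> carries the identity over to pairs of reals; on the way
  \<open>lebesgue\<close> and \<open>g\<close> are exchanged for \<open>lborel\<close> and the Borel
  version \<open>g'\<close>.\<close>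

lemma (in coords) weak_partial2_of_has_weak_partial:
  assumes hw: "has_weak_partial v f g" and f: "continuous_on UNIV f"
    and g: "g \<in> borel_measurable lebesgue" and g': "g' \<in> borel_measurable borel"
    and ae: "AE z in lborel. g z = g' z" and loc: "\<And>S. compact S \<Longrightarrow> set_integrable lborel S g'"
  shows "weak_partial2 (\<lambda>p. f (cc p)) (\<lambda>p. g' (cc p))"
  unfolding weak_partial2_def
proof (intro conjI allI impI)
  note [measurable] = g'
  have f' [measurable]: "f \<in> borel_measurable borel" using f by (rule borel_measurable_continuous_onI)
  show "continuous_on UNIV (\<lambda>p. f (cc p))" by (rule continuous_on_compose2[OF f cont]) auto
  show "(\<lambda>p. g' (cc p)) \<in> borel_measurable borel" by measurable
  have cl1: "continuous_on UNIV l1" and cl2: "continuous_on UNIV l2"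
    using bl1 bl2 by (auto intro: linear_continuous_on)
  {
    fix S :: "(real \<times> real) set" assume S: "compact S"
    have "compact (cc ` S)" using S cont by (intro compact_continuous_image)
    then have "integrable lborel (\<lambda>z. indicator (cc ` S) z *\<^sub>R g' z)"
      using loc by (auto simp: set_integrable_def)
    then have "integrable (distr lborel borel cc) (\<lambda>z. indicator (cc ` S) z *\<^sub>R g' z)"
      by (simp only: distr)
    then have "integrable lborel (\<lambda>p. indicator (cc ` S) (cc p) *\<^sub>R g' (cc p))"
      by (rule integrable_distr[rotated]) measurable
    moreover have "indicator (cc ` S) (cc p) = (indicator S p :: real)" for p
    proof -
      have "inj cc" by (rule injI) (metis l1 l2 surj_pair)
      then show ?thesis by (auto simp: indicator_def inj_image_mem_iff)
    qed
    ultimately show "set_integrable lborel S (\<lambda>p. g' (cc p))" by (simp add: set_integrable_def)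
  }
  fix d a b c e :: real assume d: "0 < d" and ab: "a \<le> b" and ce: "c \<le> e"
  define \<phi> where "\<phi> = (\<lambda>z. bcut d a b (l1 z) * bcut d c e (l2 z))"
  define D where "D = (\<lambda>z. (bump ((l1 z - a) / d) - bump ((l1 z - b) / d)) / d * bcut d c e (l2 z))"
  have D: "frechet_derivative \<phi> (at z) v = D z" for z
    unfolding \<phi>_def D_def by (rule frechet_derivative_product[OF d])
  have c\<phi>: "continuous_on UNIV \<phi>" unfolding \<phi>_def
    by (intro continuous_intros continuous_on_compose2[OF continuous_on_bcut[OF d, of UNIV]] cl1 cl2) auto
  have cD: "continuous_on UNIV D" unfolding D_def using d
    by (intro continuous_intros continuous_on_compose2[OF continuous_on_bcut[OF d, of UNIV]]
        continuous_on_compose2[OF continuous_on_bump[of UNIV]] cl1 cl2) auto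
  have [measurable]: "\<phi> \<in> borel_measurable borel" "D \<in> borel_measurable borel"
    using c\<phi> cD by (auto intro: borel_measurable_continuous_onI)
  have "test_function \<phi>" unfolding \<phi>_def by (rule test_function_product[OF d ab ce])
  then have "(\<integral>z. frechet_derivative \<phi> (at z) v *\<^sub>R f z \<partial>lebesgue) = - (\<integral>z. \<phi> z *\<^sub>R g z \<partial>lebesgue)"
    using hw unfolding has_weak_partial_def by blast
  then have "(\<integral>z. D z *\<^sub>R f z \<partial>lebesgue) = - (\<integral>z. \<phi> z *\<^sub>R g z \<partial>lebesgue)"
    unfolding D .
  also have "(\<integral>z. \<phi> z *\<^sub>R g z \<partial>lebesgue) = (\<integral>z. \<phi> z *\<^sub>R g' z \<partial>lebesgue)"
  proof (rule integral_cong_AE)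
    show "AE z in lebesgue. \<phi> z *\<^sub>R g z = \<phi> z *\<^sub>R g' z"
      using AE_completion[OF ae] by eventually_elim simp
    have "\<phi> \<in> borel_measurable lebesgue" "g' \<in> borel_measurable lebesgue"
      by (auto intro!: measurable_completion)
    then show "(\<lambda>z. \<phi> z *\<^sub>R g z) \<in> borel_measurable lebesgue" "(\<lambda>z. \<phi> z *\<^sub>R g' z) \<in> borel_measurable lebesgue"
      using g by (auto intro!: borel_measurable_scaleR)
  qed
  also have "(\<integral>z. \<phi> z *\<^sub>R g' z \<partial>lebesgue) = (\<integral>z. \<phi> z *\<^sub>R g' z \<partial>lborel)"
    by (rule integral_completion) measurable
  also have "(\<integral>z. D z *\<^sub>R f z \<partial>lebesgue) = (\<integral>z. D z *\<^sub>R f z \<partial>lborel)"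
    by (rule integral_completion) measurable
  finally have eq: "(\<integral>z. D z *\<^sub>R f z \<partial>lborel) = - (\<integral>z. \<phi> z *\<^sub>R g' z \<partial>lborel)" .
  have tr: "(\<integral>z. h z \<partial>lborel) = (\<integral>p. h (cc p) \<partial>lborel)" if [measurable]: "h \<in> borel_measurable borel" for h :: "complex \<Rightarrow> complex"
  proof -
    have "(\<integral>z. h z \<partial>lborel) = (\<integral>z. h z \<partial>distr lborel borel cc)" by (simp only: distr)
    also have "\<dots> = (\<integral>p. h (cc p) \<partial>lborel)" by (rule integral_distr) measurable
    finally show ?thesis .
  qed
  have l12: "l1 (cc p) = snd p" "l2 (cc p) = fst p" for p by (cases p; simp)+
  show "(LINT p|lborel. ((bump ((snd p - a) / d) - bump ((snd p - b) / d)) / d * bcut d c e (fst p)) *\<^sub>R f (cc p))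
      = - (LINT p|lborel. (bcut d a b (snd p) * bcut d c e (fst p)) *\<^sub>R g' (cc p))"
  proof -
    have "(\<integral>z. D z *\<^sub>R f z \<partial>lborel) = (\<integral>p. D (cc p) *\<^sub>R f (cc p) \<partial>lborel)" by (rule tr) measurable
    moreover have "(\<integral>z. \<phi> z *\<^sub>R g' z \<partial>lborel) = (\<integral>p. \<phi> (cc p) *\<^sub>R g' (cc p) \<partial>lborel)" by (rule tr) measurable
    ultimately show ?thesis using eq by (simp add: D_def \<phi>_def l12)
  qed
qed

section \<open>The two coordinate directions\<close>

lemma distr_Complex: "distr lborel borel (\<lambda>p. Complex (fst p) (snd p)) = lborel"
proof (rule lborel_eqI[symmetric])
  have c: "continuous_on UNIV (\<lambda>p. Complex (fst p) (snd p))"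
    by (simp add: Complex_eq) (intro continuous_intros)
  fix l u :: complex assume lu: "\<And>b. b \<in> Basis \<Longrightarrow> l \<bullet> b \<le> u \<bullet> b"
  then have le: "Re l \<le> Re u" "Im l \<le> Im u"
    using lu[of 1] lu[of \<i>] by (auto simp: Basis_complex_def inner_complex_def)
  have mem: "(x, y) \<in> box (a, b) (c, d) \<longleftrightarrow> a < x \<and> x < c \<and> b < y \<and> y < d" for x y a b c d :: real
    by (auto simp: box_def Basis_prod_def)
  have "emeasure (distr lborel borel (\<lambda>p. Complex (fst p) (snd p))) (box l u)
      = emeasure lborel ((\<lambda>p. Complex (fst p) (snd p)) -` box l u \<inter> space lborel)"
    using c by (intro emeasure_distr) (auto intro: borel_measurable_continuous_onI)
  also have "(\<lambda>p. Complex (fst p) (snd p)) -` box l u \<inter> space lborel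
     = box (Re l, Im l) (Re u, Im u)"
    by (auto simp: in_box_complex_iff mem)
  also have "emeasure lborel (box (Re l, Im l) (Re u, Im u)) = ennreal (\<Prod>b\<in>Basis. (u - l) \<bullet> b)"
    using le by (subst emeasure_lborel_box)
      (auto simp: Basis_prod_def Basis_complex_def prod.union_disjoint image_iff)
  finally show "emeasure (distr lborel borel (\<lambda>p. Complex (fst p) (snd p))) (box l u) = ennreal (\<Prod>b\<in>Basis. (u - l) \<bullet> b)" .
qed simp

lemma distr_swap: "distr lborel borel (\<lambda>p. (snd p, fst p)) = (lborel :: (real \<times> real) measure)"
proof -
  have "distr lborel borel (\<lambda>p. (snd p, fst p)) = distr lborel lborel (\<lambda>(x, y). (y, x :: real) :: real \<times> real)"
    by (rule distr_cong) auto
  then show ?thesis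
    using lborel_pair.distr_pair_swap[where 'a=real and 'b=real] by (simp only: lborel_prod)
qed

lemma coords_vertical: "coords Im Re (\<lambda>p. Complex (fst p) (snd p)) \<i>"
proof (rule coords.intro)
  show "continuous_on S (\<lambda>p. Complex (fst p) (snd p))" for S
    by (simp add: Complex_eq) (intro continuous_intros)
qed (rule bounded_linear_Re bounded_linear_Im | simp add: distr_Complex)+

lemma coords_horizontal: "coords Re Im (\<lambda>p. Complex (snd p) (fst p)) 1"
proof (rule coords.intro)
  show c: "continuous_on S (\<lambda>p. Complex (snd p) (fst p))" for S
    by (simp add: Complex_eq) (intro continuous_intros)
  have c': "continuous_on S (\<lambda>p. Complex (fst p) (snd p))" for S
    by (simp add: Complex_eq) (intro continuous_intros)
  have "distr (distr lborel borel (\<lambda>p. (snd p, fst p))) borel (\<lambda>p. Complex (fst p) (snd p))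
     = distr lborel borel ((\<lambda>p. Complex (fst p) (snd p)) \<circ> (\<lambda>p. (snd p, fst p)))"
    using c' by (intro distr_distr) (auto intro!: borel_measurable_continuous_onI continuous_intros)
  then show "distr lborel borel (\<lambda>p. Complex (snd p) (fst p)) = lborel"
    by (simp add: distr_swap distr_Complex o_def)
qed (rule bounded_linear_Re bounded_linear_Im | simp)+

section \<open>The Jacobian and the area of the image\<close>

lemma emeasure_UN_le_mult:
  assumes "countable C" "disjoint_family_on B C" "\<And>i. i \<in> C \<Longrightarrow> B i \<in> sets M"
    and "sets N = sets M" "\<And>i. i \<in> C \<Longrightarrow> emeasure M (B i) \<le> c * emeasure N (B i)"
  shows "emeasure M (\<Union>i\<in>C. B i) \<le> c * emeasure N (\<Union>i\<in>C. B i)"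
proof -
  have "emeasure M (\<Union>i\<in>C. B i) = (\<integral>\<^sup>+i. emeasure M (B i) \<partial>count_space C)"
    using assms by (intro emeasure_UN_countable) auto
  also have "\<dots> \<le> (\<integral>\<^sup>+i. c * emeasure N (B i) \<partial>count_space C)"
    using assms by (intro nn_integral_mono) auto
  also have "\<dots> = c * (\<integral>\<^sup>+i. emeasure N (B i) \<partial>count_space C)"
    by (intro nn_integral_cmult) auto
  also have "(\<integral>\<^sup>+i. emeasure N (B i) \<partial>count_space C) = emeasure N (\<Union>i\<in>C. B i)"
    using assms by (intro emeasure_UN_countable[symmetric]) auto
  finally show ?thesis .
qed

text \<open>The balls on which the comparison holds cover \<open>S\<close> finely; a countable
  disjoint subfamily covers almost all of \<open>S\<close>, and the inequalities add up over
  disjoint balls. This serves both as the weak-type estimate behind Lebesgue points and as the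
  passage from local to global in the area inequality.\<close>

lemma Vitali_comparison:
  fixes S :: "'a::euclidean_space set"
  assumes M: "sets M = sets borel" "sets N = sets borel"
    and S: "\<And>x d. x \<in> S \<Longrightarrow> 0 < d \<Longrightarrow>
        \<exists>r. 0 < r \<and> r < d \<and> ball x r \<subseteq> G \<and> emeasure M (ball x r) \<le> c * emeasure N (ball x r)"
  obtains U where "open U" "U \<subseteq> G" "negligible (S - U)" "emeasure M U \<le> c * emeasure N U"
proof -
  define K where "K = {(x, r). 0 < r \<and> ball x r \<subseteq> G \<and> emeasure M (ball x r) \<le> c * emeasure N (ball x r)}"
  have "\<exists>i. i \<in> K \<and> x \<in> ball (fst i) (snd i) \<and> snd i < d" if xd: "x \<in> S" "0 < d" for x d
  proof -
    obtain r where "0 < r" "r < d" "ball x r \<subseteq> G" "emeasure M (ball x r) \<le> c * emeasure N (ball x r)"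
      using S[OF xd] by blast
    then show ?thesis by (intro exI[of _ "(x, r)"]) (auto simp: K_def)
  qed
  then obtain C where C: "countable C" "C \<subseteq> K"
     "pairwise (\<lambda>i j. disjnt (ball (fst i) (snd i)) (ball (fst j) (snd j))) C"
     "negligible (S - (\<Union>i \<in> C. ball (fst i) (snd i)))"
    by (rule Vitali_covering_theorem_balls)
  let ?U = "\<Union>i \<in> C. ball (fst i) (snd i)"
  have "emeasure M ?U \<le> c * emeasure N ?U"
    using C M by (intro emeasure_UN_le_mult)
      (auto simp: disjoint_family_on_def pairwise_def disjnt_def K_def split_beta)
  moreover have "?U \<subseteq> G" using C(2) by (auto simp: K_def split_beta subset_iff)
  ultimately show ?thesis using C(4) by (intro that[of ?U]) auto
qed

text \<open>\<open>g\<close> is an almost everywhere limit of continuous functions, but without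
  domination. Composing with the continuous radial truncation \<open>T M\<close> supplies a
  dominating constant; \<open>M\<close> is fixed beforehand so that truncating \<open>g\<close>
  costs less than \<open>e/2\<close>.\<close>

lemma L1_approx_continuous:
  fixes g :: "'a::euclidean_space \<Rightarrow> 'b::euclidean_space"
  assumes g [measurable]: "g \<in> borel_measurable borel" and B [measurable]: "B \<in> sets borel"
    and fin: "emeasure lborel B < \<infinity>" "(\<integral>\<^sup>+x. ennreal (norm (g x)) * indicator B x \<partial>lborel) < \<infinity>" and e: "(e::real) > 0"
  obtains h where "continuous_on UNIV h" "(\<integral>\<^sup>+x. ennreal (norm (g x - h x)) * indicator B x \<partial>lborel) < ennreal e"
proof -
  define T :: "nat \<Rightarrow> 'b \<Rightarrow> 'b" where "T = (\<lambda>n z. z /\<^sub>R max 1 (norm z / Suc n))"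
  have cT: "continuous_on UNIV (T n)" for n
    unfolding T_def by (intro continuous_intros) (auto simp: max_def)
  have [measurable]: "T n \<in> borel_measurable borel" for n
    using cT by (rule borel_measurable_continuous_onI)
  have T1: "norm (T n z) \<le> norm z" for n z
  proof -
    have "norm z / max 1 (norm z / Suc n) \<le> norm z / 1" by (intro divide_left_mono) auto
    then show ?thesis by (simp add: T_def divide_inverse mult.commute)
  qed
  have T2: "norm (T n z) \<le> Suc n" for n z
  proof -
    have "norm z / max 1 (norm z / Suc n) \<le> Suc n"
      by (simp add: divide_le_eq max_def)
    then show ?thesis by (simp add: T_def divide_inverse mult.commute)
  qed
  have Tlim: "(\<lambda>n. T n z) \<longlonglongrightarrow> z" for z
  proof (rule tendsto_eventually)
    show "\<forall>\<^sub>F n in sequentially. T n z = z"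
    proof (rule eventually_sequentiallyI[of "nat \<lceil>norm z\<rceil>"])
      fix n assume "nat \<lceil>norm z\<rceil> \<le> n"
      then have "norm z \<le> Suc n" by linarith
      then have "max 1 (norm z / Suc n) = 1" by (simp add: max_def divide_le_eq)
      then show "T n z = z" by (simp add: T_def)
    qed
  qed
  have "(\<lambda>n. \<integral>\<^sup>+x. norm (indicator B x *\<^sub>R g x - indicator B x *\<^sub>R T n (g x)) \<partial>lborel) \<longlonglongrightarrow> 0"
  proof (rule nn_integral_dominated_convergence_norm[where w="\<lambda>x. norm (g x) * indicator B x"])
    show "AE x in lborel. norm (indicator B x *\<^sub>R T j (g x)) \<le> norm (g x) * indicator B x" for j
      by (rule AE_I2) (simp add: T1 split: split_indicator)
    show "AE x in lborel. (\<lambda>i. indicat_real B x *\<^sub>R T i (g x)) \<longlonglongrightarrow> indicat_real B x *\<^sub>R g x"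
      by (rule AE_I2) (intro tendsto_intros Tlim)
    show "(\<integral>\<^sup>+ x. ennreal (norm (g x) * indicat_real B x) \<partial>lborel) < \<infinity>"
      using fin(2) by (simp add: ennreal_mult ennreal_indicator)
  qed measurable
  then have "\<forall>\<^sub>F n in sequentially. (\<integral>\<^sup>+x. norm (indicator B x *\<^sub>R g x - indicator B x *\<^sub>R T n (g x)) \<partial>lborel) < ennreal (e/2)"
    by (rule order_tendstoD) (use e in simp)
  then obtain M where M: "(\<integral>\<^sup>+x. norm (indicator B x *\<^sub>R g x - indicator B x *\<^sub>R T M (g x)) \<partial>lborel) < ennreal (e/2)"
    by (auto simp: eventually_sequentially)
  have "g measurable_on UNIV"
    by (rule lebesgue_measurable_imp_measurable_on) (auto intro: measurable_completion)
  then obtain N k where N: "negligible N" and k: "\<And>n. continuous_on UNIV (k n)"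
      and lim: "\<And>x. x \<notin> N \<Longrightarrow> (\<lambda>n. k n x) \<longlonglongrightarrow> g x"
    unfolding measurable_on_def by auto
  have [measurable]: "k n \<in> borel_measurable borel" for n
    using k by (rule borel_measurable_continuous_onI)
  have ae: "AE x in lborel. x \<notin> N"
  proof -
    have "AE x in lebesgue. x \<notin> N" using N by (auto simp: negligible_iff_null_sets intro: AE_not_in)
    then show ?thesis by (simp add: AE_completion_iff)
  qed
  have "(\<lambda>n. \<integral>\<^sup>+x. norm (indicator B x *\<^sub>R T M (g x) - indicator B x *\<^sub>R T M (k n x)) \<partial>lborel) \<longlonglongrightarrow> 0"
  proof (rule nn_integral_dominated_convergence_norm[where w="\<lambda>x. real (Suc M) * indicator B x"])
    show "AE x in lborel. norm (indicator B x *\<^sub>R T M (k j x)) \<le> real (Suc M) * indicator B x" for j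
      using T2[of M] by (intro AE_I2) (simp split: split_indicator)
    show "AE x in lborel. (\<lambda>i. indicat_real B x *\<^sub>R T M (k i x)) \<longlonglongrightarrow> indicat_real B x *\<^sub>R T M (g x)"
      using ae by eventually_elim
        (intro tendsto_intros continuous_on_tendsto_compose[OF cT[of M]] lim, auto)
    show "(\<integral>\<^sup>+ x. ennreal (real (Suc M) * indicat_real B x) \<partial>lborel) < \<infinity>"
      using fin(1) by (simp add: ennreal_mult ennreal_indicator nn_integral_cmult ennreal_mult_less_top)
  qed measurable
  then have "\<forall>\<^sub>F n in sequentially. (\<integral>\<^sup>+x. norm (indicator B x *\<^sub>R T M (g x) - indicator B x *\<^sub>R T M (k n x)) \<partial>lborel) < ennreal (e/2)"
    by (rule order_tendstoD) (use e in simp)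
  then obtain n where n: "(\<integral>\<^sup>+x. norm (indicator B x *\<^sub>R T M (g x) - indicator B x *\<^sub>R T M (k n x)) \<partial>lborel) < ennreal (e/2)"
    by (auto simp: eventually_sequentially)
  show ?thesis
  proof (rule that[of "\<lambda>x. T M (k n x)"])
    show "continuous_on UNIV (\<lambda>x. T M (k n x))" by (rule continuous_on_compose2[OF cT k]) auto
    have "(\<integral>\<^sup>+x. ennreal (norm (g x - T M (k n x))) * indicator B x \<partial>lborel)
      \<le> (\<integral>\<^sup>+x. ennreal (norm (indicator B x *\<^sub>R g x - indicator B x *\<^sub>R T M (g x)))
         + ennreal (norm (indicator B x *\<^sub>R T M (g x) - indicator B x *\<^sub>R T M (k n x))) \<partial>lborel)"
    proof (rule nn_integral_mono)
      fix x
      have "norm (g x - T M (k n x)) \<le> norm (g x - T M (g x)) + norm (T M (g x) - T M (k n x))"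
        using norm_triangle_ineq[of "g x - T M (g x)" "T M (g x) - T M (k n x)"] by simp
      then show "ennreal (norm (g x - T M (k n x))) * indicator B x
        \<le> ennreal (norm (indicator B x *\<^sub>R g x - indicator B x *\<^sub>R T M (g x)))
         + ennreal (norm (indicator B x *\<^sub>R T M (g x) - indicator B x *\<^sub>R T M (k n x)))"
        by (auto simp: ennreal_plus[symmetric] intro!: ennreal_leI split: split_indicator simp del: ennreal_plus)
    qed
    also have "\<dots> = (\<integral>\<^sup>+x. ennreal (norm (indicator B x *\<^sub>R g x - indicator B x *\<^sub>R T M (g x))) \<partial>lborel)
       + (\<integral>\<^sup>+x. ennreal (norm (indicator B x *\<^sub>R T M (g x) - indicator B x *\<^sub>R T M (k n x))) \<partial>lborel)"
      by (rule nn_integral_add) measurable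
    also have "\<dots> < ennreal (e/2) + ennreal (e/2)"
      using M n by (rule add_strict_mono)
    also have "\<dots> = ennreal e" using e by (subst ennreal_plus[symmetric]) auto
    finally show "(\<integral>\<^sup>+x. ennreal (norm (g x - T M (k n x))) * indicator B x \<partial>lborel) < ennreal e" .
  qed
qed

text \<open>Split \<open>g\<close> into a continuous \<open>h\<close> and a remainder that is small
  in the mean. A point can only be bad for \<open>\<eta>\<close> if the remainder is at least
  \<open>\<eta>/3\<close> there (the set \<open>A\<close>) or has mean at least
  \<open>\<eta>/3\<close> on arbitrarily small balls (the set \<open>S\<close>). Chebyshev bounds
  the first set, the Vitali comparison the second.\<close>

theorem Lebesgue_points:
  fixes g :: "'a::euclidean_space \<Rightarrow> 'b::euclidean_space"
  assumes g [measurable]: "g \<in> borel_measurable borel"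
    and loc: "\<And>R. (\<integral>\<^sup>+x. ennreal (norm (g x)) * indicator (ball 0 R) x \<partial>lborel) < \<infinity>"
  shows "AE x in lborel. \<forall>\<eta>>0. \<exists>d>0. \<forall>r. 0 < r \<longrightarrow> r < d \<longrightarrow>
     (\<integral>\<^sup>+y. ennreal (norm (g y - g x)) * indicator (ball x r) y \<partial>lborel) \<le> ennreal \<eta> * emeasure lborel (ball x r)"
proof -
  let ?P = "\<lambda>\<eta> x r. (\<integral>\<^sup>+y. ennreal (norm (g y - g x)) * indicator (ball x r) y \<partial>lborel) \<le> ennreal \<eta> * emeasure lborel (ball x r)"
  define Bad where "Bad = (\<lambda>\<eta> R. {x \<in> ball 0 R. \<forall>d>0. \<exists>r. 0 < r \<and> r < d \<and> \<not> ?P \<eta> x r})"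
  have "negligible (Bad \<eta> R)" if \<eta>: "\<eta> > 0" for \<eta> R
    unfolding negligible_outer_le
  proof safe
    fix e :: real assume e: "e > 0"
    \<comment> \<open>Radius \<open>R + 1\<close> leaves room for balls of radius below 1 about
      points of \<open>ball 0 R\<close>.\<close>
    let ?G = "ball (0::'a) (R + 1)"
    have finG: "emeasure lborel ?G < \<infinity>" by (rule emeasure_bounded_finite) simp
    \<comment> \<open>Chebyshev and Vitali both bring in the factor \<open>3/\<eta>\<close>, so an
      error of \<open>\<eta> * e / 6\<close> leaves measure \<open>e/2\<close> for each of the two
      sets.\<close>
    obtain h where h: "continuous_on UNIV h"
      and hg: "(\<integral>\<^sup>+x. ennreal (norm (g x - h x)) * indicator ?G x \<partial>lborel) < ennreal (\<eta> * e / 6)"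
      using L1_approx_continuous[OF g _ finG loc, of "\<eta> * e / 6"] \<eta> e by auto
    have [measurable]: "h \<in> borel_measurable borel" using h by (rule borel_measurable_continuous_onI)
    define \<nu> where "\<nu> = density lborel (\<lambda>x. ennreal (norm (g x - h x)) * indicator ?G x)"
    have s\<nu>: "sets \<nu> = sets borel" by (simp add: \<nu>_def)
    have [measurable]: "ball a r \<in> sets borel" for a :: 'a and r by simp
    have \<nu>: "emeasure \<nu> E = (\<integral>\<^sup>+x. ennreal (norm (g x - h x)) * indicator ?G x * indicator E x \<partial>lborel)" if [measurable]: "E \<in> sets borel" for E
      unfolding \<nu>_def by (rule emeasure_density) measurable
    have \<nu>tot: "emeasure \<nu> E \<le> ennreal (\<eta> * e / 6)" if "E \<in> sets borel" for E
    proof -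
      have "emeasure \<nu> E \<le> emeasure \<nu> UNIV" using that by (intro emeasure_mono) (auto simp: s\<nu>)
      then show ?thesis using hg by (simp add: \<nu>)
    qed
    define S where "S = {x \<in> ball 0 R. \<forall>d>0. \<exists>r. 0 < r \<and> r < d \<and> ennreal (\<eta>/3) * emeasure lborel (ball x r) \<le> emeasure \<nu> (ball x r)}"
    have "\<exists>r. 0 < r \<and> r < d \<and> ball x r \<subseteq> ?G \<and> emeasure lborel (ball x r) \<le> ennreal (3/\<eta>) * emeasure \<nu> (ball x r)"
      if "x \<in> S" "d > 0" for x d
    proof -
      obtain r where r: "0 < r" "r < min d 1" "ennreal (\<eta>/3) * emeasure lborel (ball x r) \<le> emeasure \<nu> (ball x r)"
        using \<open>x \<in> S\<close> \<open>d > 0\<close> unfolding S_def by (auto dest!: spec[of _ "min d 1"])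
      have "ennreal (3/\<eta>) * (ennreal (\<eta>/3) * emeasure lborel (ball x r)) \<le> ennreal (3/\<eta>) * emeasure \<nu> (ball x r)"
        using r(3) by (rule mult_left_mono) simp
      then have "emeasure lborel (ball x r) \<le> ennreal (3/\<eta>) * emeasure \<nu> (ball x r)"
        using \<eta> by (simp add: mult.assoc[symmetric] ennreal_mult[symmetric])
      moreover have "ball x r \<subseteq> ?G"
      proof
        fix y assume "y \<in> ball x r"
        then have "norm (y - x) < 1" using r by (auto simp: dist_norm norm_minus_commute)
        then show "y \<in> ?G" using \<open>x \<in> S\<close> norm_triangle_sub[of y x] by (auto simp: S_def)
      qed
      ultimately show ?thesis using r by auto
    qed
    then obtain U where U: "open U" "U \<subseteq> ?G" "negligible (S - U)" "emeasure lborel U \<le> ennreal (3/\<eta>) * emeasure \<nu> U"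
      using Vitali_comparison[of lborel \<nu> S ?G "ennreal (3/\<eta>)"] s\<nu> by (metis sets_lborel)
    define A where "A = {x \<in> ?G. \<eta>/3 \<le> norm (g x - h x)}"
    have A [measurable]: "A \<in> sets borel" unfolding A_def by measurable
    have "ennreal (\<eta>/3) * emeasure lborel A = (\<integral>\<^sup>+x. ennreal (\<eta>/3) * indicator A x \<partial>lborel)"
      by (simp add: nn_integral_cmult)
    also have "\<dots> \<le> (\<integral>\<^sup>+x. ennreal (norm (g x - h x)) * indicator ?G x \<partial>lborel)"
      by (rule nn_integral_mono) (auto simp: A_def ennreal_leI split: split_indicator)
    also have "\<dots> \<le> ennreal (\<eta> * e / 6)" using hg by simp
    finally have "ennreal (3/\<eta>) * (ennreal (\<eta>/3) * emeasure lborel A) \<le> ennreal (3/\<eta>) * ennreal (\<eta> * e / 6)"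
      by (rule mult_left_mono) simp
    then have mA: "emeasure lborel A \<le> ennreal (e/2)"
      using \<eta> e by (simp add: mult.assoc[symmetric] ennreal_mult[symmetric])
    have "emeasure lborel U \<le> ennreal (3/\<eta>) * ennreal (\<eta> * e / 6)"
      using U(4) \<nu>tot[of U] U(1) by (meson borel_open mult_left_mono order_trans zero_le)
    then have mU: "emeasure lborel U \<le> ennreal (e/2)"
      using \<eta> e by (simp add: ennreal_mult[symmetric])
    have sub: "Bad \<eta> R \<subseteq> A \<union> S"
    proof
      fix x assume x: "x \<in> Bad \<eta> R"
      show "x \<in> A \<union> S"
      proof (rule ccontr)
        assume "x \<notin> A \<union> S"
        have xR: "x \<in> ball 0 R" using x by (auto simp: Bad_def)
        have gh: "norm (g x - h x) \<le> \<eta>/3" using \<open>x \<notin> A \<union> S\<close> xR by (auto simp: A_def)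
        obtain d where d: "d > 0" "\<And>r. 0 < r \<Longrightarrow> r < d \<Longrightarrow> emeasure \<nu> (ball x r) < ennreal (\<eta>/3) * emeasure lborel (ball x r)"
          using \<open>x \<notin> A \<union> S\<close> xR unfolding S_def by (auto simp: not_le)
        have "isCont h x" using h by (simp add: continuous_on_eq_continuous_at)
        then obtain d' where d': "d' > 0" "\<And>y. dist y x < d' \<Longrightarrow> dist (h y) (h x) < \<eta>/3"
          unfolding continuous_at_eps_delta using \<eta> by (metis divide_pos_pos zero_less_numeral)
        obtain r where r: "0 < r" "r < min (min d d') 1" "\<not> ?P \<eta> x r"
          using x d(1) d'(1) unfolding Bad_def by (auto dest!: spec[of _ "min (min d d') 1"])
        have "(\<integral>\<^sup>+y. ennreal (norm (g y - g x)) * indicator (ball x r) y \<partial>lborel)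
          \<le> (\<integral>\<^sup>+y. ennreal (norm (g y - h y)) * indicator ?G y * indicator (ball x r) y
              + ennreal (2 * \<eta> / 3) * indicator (ball x r) y \<partial>lborel)"
        proof (rule nn_integral_mono)
          fix y
          show "ennreal (norm (g y - g x)) * indicator (ball x r) y \<le>
              ennreal (norm (g y - h y)) * indicator ?G y * indicator (ball x r) y
              + ennreal (2 * \<eta> / 3) * indicator (ball x r) y"
          proof (cases "y \<in> ball x r")
            case True
            have "norm (y - x) < 1" using True r by (auto simp: dist_norm norm_minus_commute)
            then have "y \<in> ?G" using xR norm_triangle_sub[of y x] by auto
            have "norm (h y - h x) \<le> \<eta>/3" using d'(2)[of y] True r by (auto simp: dist_norm norm_minus_commute)
            moreover have "norm (g y - g x) = norm ((g y - h y) + (h y - h x) - (g x - h x))" by simp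
            then have "norm (g y - g x) \<le> norm (g y - h y) + norm (h y - h x) + norm (g x - h x)"
              using norm_triangle_ineq4[of "(g y - h y) + (h y - h x)" "g x - h x"]
                norm_triangle_ineq[of "g y - h y" "h y - h x"] by linarith
            ultimately have "norm (g y - g x) \<le> norm (g y - h y) + 2 * \<eta> / 3" using gh by linarith
            then show ?thesis using True \<open>y \<in> ?G\<close> \<eta>
              by (simp add: ennreal_plus[symmetric] ennreal_leI del: ennreal_plus)
          qed simp
        qed
        also have "\<dots> = emeasure \<nu> (ball x r) + ennreal (2 * \<eta> / 3) * emeasure lborel (ball x r)"
          by (subst nn_integral_add) (auto simp: \<nu> nn_integral_cmult)
        also have "\<dots> \<le> ennreal (\<eta>/3) * emeasure lborel (ball x r) + ennreal (2 * \<eta> / 3) * emeasure lborel (ball x r)"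
          using d(2)[of r] r by (intro add_right_mono) auto
        also have "\<dots> = ennreal \<eta> * emeasure lborel (ball x r)"
          using \<eta> by (subst distrib_right[symmetric], subst ennreal_plus[symmetric]) auto
        finally show False using r(3) by simp
      qed
    qed
    \<comment> \<open>Measurability of \<open>S\<close> has not been established; it is covered by
      the open set \<open>U\<close> up to a null set.\<close>
    define T where "T = A \<union> U \<union> (S - U)"
    have "(S - U) \<in> null_sets lebesgue" using U(3) by (simp add: negligible_iff_null_sets)
    then have "emeasure lebesgue T = emeasure lebesgue (A \<union> U)"
      unfolding T_def using U(1) by (intro emeasure_Un_null_set) auto
    also have "\<dots> = emeasure lborel (A \<union> U)" using U(1) by simp
    also have "\<dots> \<le> emeasure lborel A + emeasure lborel U" using U(1) by (intro emeasure_subadditive) auto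
    also have "\<dots> \<le> ennreal (e/2) + ennreal (e/2)" using mA mU by (rule add_mono)
    also have "\<dots> = ennreal e" using e by (subst ennreal_plus[symmetric]) auto
    finally have mT: "emeasure lebesgue T \<le> ennreal e" .
    have "T \<in> sets lebesgue" unfolding T_def using U(1,3)
      by (intro sets.Un) (auto simp: negligible_imp_sets)
    then have "T \<in> lmeasurable" using mT by (intro fmeasurableI) (auto simp: le_less_trans)
    moreover have "measure lebesgue T \<le> e" using mT e by (simp add: measure_def enn2real_leI)
    moreover have "Bad \<eta> R \<subseteq> T" using sub by (auto simp: T_def)
    ultimately show "\<exists>T. Bad \<eta> R \<subseteq> T \<and> T \<in> lmeasurable \<and> measure lebesgue T \<le> e" by blast
  qed
  then have "AE x in lebesgue. x \<notin> Bad (1 / Suc k) (real n)" for k n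
    by (intro AE_not_in) (simp add: negligible_iff_null_sets[symmetric])
  then have "AE x in lborel. \<forall>k n. x \<notin> Bad (1 / Suc k) (real n)"
    by (simp add: AE_completion_iff AE_all_countable)
  then show ?thesis
  proof eventually_elim
    case (elim x)
    show ?case
    proof safe
      fix \<eta> :: real assume "\<eta> > 0"
      then obtain k where k: "1 / Suc k < \<eta>" using nat_approx_posE by blast
      obtain n where "norm x < real n" using reals_Archimedean2 by blast
      then have "\<exists>d>0. \<forall>r. 0 < r \<longrightarrow> r < d \<longrightarrow> ?P (1 / Suc k) x r"
        using elim[rule_format, of k n] unfolding Bad_def by auto
      then obtain d where d: "d > 0" "\<And>r. 0 < r \<Longrightarrow> r < d \<Longrightarrow> ?P (1 / Suc k) x r" by blast
      show "\<exists>d>0. \<forall>r. 0 < r \<longrightarrow> r < d \<longrightarrow> ?P \<eta> x r"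
      proof (intro exI[of _ d] conjI allI impI d)
        fix r assume "0 < r" "r < d"
        then have "?P (1 / Suc k) x r" by (rule d)
        also have "ennreal (1 / Suc k) * emeasure lborel (ball x r) \<le> ennreal \<eta> * emeasure lborel (ball x r)"
          using k by (intro mult_right_mono ennreal_leI) auto
        finally show "?P \<eta> x r" .
      qed
    qed
  qed
qed

text \<open>The arguments of \<open>\<psi>\<close> are Cramer's rule for the matrix with rows (a, b)
  and (c, d). If \<open>a\<close> is nonzero, two one-variable substitutions joined by Fubini
  contribute the factors \<open>D/a\<close> and \<open>a\<close>; otherwise exchanging the rows
  reduces to that case.\<close>

lemma nn_integral_linear_change:
  fixes \<psi> :: "real \<times> real \<Rightarrow> ennreal" and a b c d :: real
  assumes [measurable]: "\<psi> \<in> borel_measurable borel" and D: "a * d - b * c \<noteq> 0"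
  shows "(\<integral>\<^sup>+u. \<integral>\<^sup>+v. \<psi> ((d * u - b * v) / (a * d - b * c), (a * v - c * u) / (a * d - b * c)) \<partial>lborel \<partial>lborel)
    = ennreal \<bar>a * d - b * c\<bar> * (\<integral>\<^sup>+x. \<integral>\<^sup>+y. \<psi> (x, y) \<partial>lborel \<partial>lborel)"
proof -
  have main: "(\<integral>\<^sup>+u. \<integral>\<^sup>+v. \<psi> ((d * u - b * v) / (a * d - b * c), (a * v - c * u) / (a * d - b * c)) \<partial>lborel \<partial>lborel)
    = ennreal \<bar>a * d - b * c\<bar> * (\<integral>\<^sup>+x. \<integral>\<^sup>+y. \<psi> (x, y) \<partial>lborel \<partial>lborel)"
    if D: "a * d - b * c \<noteq> 0" and a: "a \<noteq> 0" for a b c d :: real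
  proof -
    define D where "D = a * d - b * c"
    have D0: "D \<noteq> 0" using D by (simp add: D_def)
    have inner: "(\<integral>\<^sup>+v. \<psi> ((d * u - b * v) / D, (a * v - c * u) / D) \<partial>lborel)
      = ennreal \<bar>D/a\<bar> * (\<integral>\<^sup>+y. \<psi> ((u - b * y) / a, y) \<partial>lborel)" for u
    proof -
      have e1: "(d * u - b * (c / a * u + D / a * y)) / D = (u - b * y) / a" for y
      proof -
        have "d * u - b * (c / a * u + D / a * y) = D * ((u - b * y) / a)"
          using a by (simp add: D_def field_simps)
        then show ?thesis using D0 by simp
      qed
      have e2: "(a * (c / a * u + D / a * y) - c * u) / D = y" for y
        using a D0 by (simp add: field_simps)
      have "(\<integral>\<^sup>+v. \<psi> ((d * u - b * v) / D, (a * v - c * u) / D) \<partial>lborel)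
        = ennreal \<bar>D/a\<bar> * (\<integral>\<^sup>+y. \<psi> ((d * u - b * (c / a * u + D / a * y)) / D, (a * (c / a * u + D / a * y) - c * u) / D) \<partial>lborel)"
        by (rule nn_integral_real_affine) (use a D0 in \<open>measurable, simp\<close>)
      then show ?thesis unfolding e1 e2 .
    qed
    have "(\<integral>\<^sup>+u. \<integral>\<^sup>+v. \<psi> ((d * u - b * v) / D, (a * v - c * u) / D) \<partial>lborel \<partial>lborel)
      = ennreal \<bar>D/a\<bar> * (\<integral>\<^sup>+u. \<integral>\<^sup>+y. \<psi> ((u - b * y) / a, y) \<partial>lborel \<partial>lborel)"
      unfolding inner by (rule nn_integral_cmult) measurable
    also have "(\<integral>\<^sup>+u. \<integral>\<^sup>+y. \<psi> ((u - b * y) / a, y) \<partial>lborel \<partial>lborel)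
      = (\<integral>\<^sup>+y. \<integral>\<^sup>+u. \<psi> ((u - b * y) / a, y) \<partial>lborel \<partial>lborel)"
      by (rule lborel_pair.Fubini'[symmetric]) measurable
    also have "\<dots> = (\<integral>\<^sup>+y. ennreal \<bar>a\<bar> * (\<integral>\<^sup>+x. \<psi> (x, y) \<partial>lborel) \<partial>lborel)"
    proof (rule nn_integral_cong)
      fix y :: real
      show "(\<integral>\<^sup>+u. \<psi> ((u - b * y) / a, y) \<partial>lborel) = ennreal \<bar>a\<bar> * (\<integral>\<^sup>+x. \<psi> (x, y) \<partial>lborel)"
        by (subst nn_integral_real_affine[of _ a "b*y"]) (use a in simp_all)
    qed
    also have "\<dots> = ennreal \<bar>a\<bar> * (\<integral>\<^sup>+y. \<integral>\<^sup>+x. \<psi> (x, y) \<partial>lborel \<partial>lborel)"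
      by (rule nn_integral_cmult) measurable
    also have "(\<integral>\<^sup>+y. \<integral>\<^sup>+x. \<psi> (x, y) \<partial>lborel \<partial>lborel) = (\<integral>\<^sup>+x. \<integral>\<^sup>+y. \<psi> (x, y) \<partial>lborel \<partial>lborel)"
      by (rule lborel_pair.Fubini') measurable
    also have "ennreal \<bar>D/a\<bar> * (ennreal \<bar>a\<bar> * (\<integral>\<^sup>+x. \<integral>\<^sup>+y. \<psi> (x, y) \<partial>lborel \<partial>lborel))
      = ennreal \<bar>D\<bar> * (\<integral>\<^sup>+x. \<integral>\<^sup>+y. \<psi> (x, y) \<partial>lborel \<partial>lborel)"
    proof -
      have "ennreal \<bar>D/a\<bar> * ennreal \<bar>a\<bar> = ennreal \<bar>D\<bar>"
        using a by (subst ennreal_mult[symmetric]) simp_all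
      then show ?thesis by (simp add: mult.assoc[symmetric])
    qed
    finally show ?thesis unfolding D_def .
  qed
  show ?thesis
  proof (cases "a = 0")
    case False
    then show ?thesis using main D by blast
  next
    case True
    then have c: "c \<noteq> 0" using D by auto
    have D': "c * b - d * a = - (a * d - b * c)" by simp
    have "(\<integral>\<^sup>+u. \<integral>\<^sup>+v. \<psi> ((d * u - b * v) / (a * d - b * c), (a * v - c * u) / (a * d - b * c)) \<partial>lborel \<partial>lborel)
      = (\<integral>\<^sup>+v. \<integral>\<^sup>+u. \<psi> ((d * u - b * v) / (a * d - b * c), (a * v - c * u) / (a * d - b * c)) \<partial>lborel \<partial>lborel)"
      by (rule lborel_pair.Fubini'[symmetric]) measurable
    also have "\<dots> = (\<integral>\<^sup>+v. \<integral>\<^sup>+u. \<psi> ((b * v - d * u) / (c * b - d * a), (c * u - a * v) / (c * b - d * a)) \<partial>lborel \<partial>lborel)"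
    proof -
      have "(b * v - d * u) / (c * b - d * a) = (d * u - b * v) / (a * d - b * c)"
        "(c * u - a * v) / (c * b - d * a) = (a * v - c * u) / (a * d - b * c)" for u v
        unfolding D' by (metis minus_diff_eq minus_divide_divide)+
      then show ?thesis by simp
    qed
    also have "\<dots> = ennreal \<bar>c * b - d * a\<bar> * (\<integral>\<^sup>+x. \<integral>\<^sup>+y. \<psi> (x, y) \<partial>lborel \<partial>lborel)"
      by (rule main) (use D in \<open>simp add: D'\<close>, use c in simp)
    finally show ?thesis by (simp only: D' abs_minus_cancel)
  qed
qed

section \<open>Fubini in the plane and areas of parallelograms\<close>

lemma nn_integral_lborel_fst:
  fixes w :: "real \<times> real \<Rightarrow> ennreal"
  assumes "w \<in> borel_measurable borel"
  shows "(\<integral>\<^sup>+p. w p \<partial>lborel) = (\<integral>\<^sup>+x. \<integral>\<^sup>+y. w (x, y) \<partial>lborel \<partial>lborel)"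
  using lborel.nn_integral_fst[of w lborel] assms by (simp add: lborel_prod)

lemma nn_integral_lborel_snd:
  fixes w :: "real \<times> real \<Rightarrow> ennreal"
  assumes "w \<in> borel_measurable borel"
  shows "(\<integral>\<^sup>+p. w p \<partial>lborel) = (\<integral>\<^sup>+y. \<integral>\<^sup>+x. w (x, y) \<partial>lborel \<partial>lborel)"
  using lborel_pair.nn_integral_snd[of w] assms by (simp add: lborel_prod)

lemma measurable_fst_real [measurable]: "fst \<in> borel_measurable (borel :: (real \<times> real) measure)"
  and measurable_snd_real [measurable]: "snd \<in> borel_measurable (borel :: (real \<times> real) measure)"
  by (intro borel_measurable_continuous_onI continuous_intros)+

lemma sets_borel_Times [measurable]: "A \<in> sets borel \<Longrightarrow> B \<in> sets borel \<Longrightarrow> (A :: real set) \<times> (B :: real set) \<in> sets borel"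
  unfolding borel_prod[symmetric] by (intro pair_measureI) simp_all

lemma emeasure_square: "0 \<le> r \<Longrightarrow> emeasure lborel ({a-r..a+r} \<times> {b-r..b+r::real}) = ennreal (4 * r\<^sup>2)"
  unfolding lborel_prod[symmetric]
  by (subst lborel.emeasure_pair_measure_Times)
    (auto simp: ennreal_mult[symmetric] power2_eq_square)

lemma Complex_pair_measurable [measurable]:
  "(\<lambda>p. Complex (fst p) (snd p)) \<in> borel_measurable (borel :: (real \<times> real) measure)"
  by (intro borel_measurable_continuous_onI) (simp add: Complex_eq, intro continuous_intros)

lemma nn_integral_complex:
  assumes [measurable]: "w \<in> borel_measurable borel"
  shows "(\<integral>\<^sup>+z. w z \<partial>lborel) = (\<integral>\<^sup>+p. w (Complex (fst p) (snd p)) \<partial>lborel)"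
proof -
  have "(\<integral>\<^sup>+z. w z \<partial>lborel) = (\<integral>\<^sup>+z. w z \<partial>distr lborel borel (\<lambda>p. Complex (fst p) (snd p)))"
    by (simp only: distr_Complex)
  also have "\<dots> = (\<integral>\<^sup>+p. w (Complex (fst p) (snd p)) \<partial>lborel)"
    by (rule nn_integral_distr) measurable
  finally show ?thesis .
qed

text \<open>By Cramer's rule the set is the image of the square of half-side \<open>h\<close> about
  (\<alpha>, \<beta>) under the matrix with rows (a, b) and (c, d), so the determinant scales the
  area.\<close>

lemma emeasure_parallelogram:
  assumes D: "a * d - b * c \<noteq> 0" and h: "h \<ge> 0"
  shows "emeasure lborel {\<zeta>. \<bar>(d * Re \<zeta> - b * Im \<zeta>) / (a * d - b * c) - \<alpha>\<bar> \<le> h \<and>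
      \<bar>(a * Im \<zeta> - c * Re \<zeta>) / (a * d - b * c) - \<beta>\<bar> \<le> h} = ennreal (\<bar>a * d - b * c\<bar> * (4 * h\<^sup>2))"
    (is "emeasure lborel ?S = _")
proof -
  let ?B = "{\<alpha>-h..\<alpha>+h} \<times> {\<beta>-h..\<beta>+h}"
  have [measurable]: "?S \<in> sets borel" by measurable
  have [measurable]: "?B \<in> sets borel" by (intro sets_borel_Times) auto
  have "emeasure lborel ?S = (\<integral>\<^sup>+z. indicator ?S z \<partial>lborel)" by simp
  also have "\<dots> = (\<integral>\<^sup>+p. indicator ?S (Complex (fst p) (snd p)) \<partial>lborel)"
    by (rule nn_integral_complex) measurable
  also have "\<dots> = (\<integral>\<^sup>+u. \<integral>\<^sup>+v. indicator ?S (Complex u v) \<partial>lborel \<partial>lborel)"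
    using nn_integral_lborel_fst[of "\<lambda>p. indicator ?S (Complex (fst p) (snd p))"] by simp
  also have "\<dots> = (\<integral>\<^sup>+u. \<integral>\<^sup>+v. indicator ?B ((d * u - b * v) / (a * d - b * c), (a * v - c * u) / (a * d - b * c)) \<partial>lborel \<partial>lborel)"
  proof (intro nn_integral_cong)
    fix u v
    have "Complex u v \<in> ?S \<longleftrightarrow> ((d * u - b * v) / (a * d - b * c), (a * v - c * u) / (a * d - b * c)) \<in> ?B"
      unfolding mem_Collect_eq complex.sel mem_Times_iff fst_conv snd_conv atLeastAtMost_iff by linarith
    then show "(indicator ?S (Complex u v) :: ennreal)
      = indicator ?B ((d * u - b * v) / (a * d - b * c), (a * v - c * u) / (a * d - b * c))"
      unfolding indicator_def by (simp only:)
  qed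
  also have "\<dots> = ennreal \<bar>a * d - b * c\<bar> * (\<integral>\<^sup>+x. \<integral>\<^sup>+y. indicator ?B (x, y) \<partial>lborel \<partial>lborel)"
    by (rule nn_integral_linear_change[OF _ D]) measurable
  also have "(\<integral>\<^sup>+x. \<integral>\<^sup>+y. indicator ?B (x, y) \<partial>lborel \<partial>lborel) = emeasure lborel ?B"
    using nn_integral_lborel_fst[of "indicator ?B"] by simp
  also have "\<dots> = ennreal (4 * h\<^sup>2)" by (rule emeasure_square[OF h])
  finally show ?thesis by (simp add: ennreal_mult)
qed

text \<open>Clamping \<open>q - G q\<close> to the rectangle gives a continuous self-map, with a
  fixed point by Brouwer. If a component of \<open>G\<close> were nonzero at the fixed point, the
  clamp would have to hold the point on a side; but there the sign condition makes
  \<open>q - G q\<close> point inwards.\<close>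

lemma Poincare_Miranda_2D:
  fixes G :: "real \<times> real \<Rightarrow> real \<times> real"
  assumes cont: "continuous_on ({x0..x1} \<times> {y0..y1}) G" and le: "x0 \<le> x1" "y0 \<le> y1"
    and l: "\<And>y. y \<in> {y0..y1} \<Longrightarrow> fst (G (x0, y)) < 0" and r: "\<And>y. y \<in> {y0..y1} \<Longrightarrow> fst (G (x1, y)) > 0"
    and b: "\<And>x. x \<in> {x0..x1} \<Longrightarrow> snd (G (x, y0)) < 0" and t: "\<And>x. x \<in> {x0..x1} \<Longrightarrow> snd (G (x, y1)) > 0"
  shows "\<exists>q\<in>{x0..x1} \<times> {y0..y1}. G q = 0"
proof -
  let ?Q = "{x0..x1} \<times> {y0..y1}"
  define \<Phi> where "\<Phi> = (\<lambda>q. (max x0 (min x1 (fst q - fst (G q))), max y0 (min y1 (snd q - snd (G q)))))"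
  obtain q where q: "q \<in> ?Q" "\<Phi> q = q"
  proof (rule brouwer[of ?Q \<Phi>])
    show "compact ?Q" by (auto intro: compact_Times)
    show "convex ?Q" by (auto intro: convex_Times)
    show "?Q \<noteq> {}" using le by auto
    show "continuous_on ?Q \<Phi>" unfolding \<Phi>_def by (intro continuous_intros cont)
    show "\<Phi> \<in> ?Q \<rightarrow> ?Q" using le by (auto simp: \<Phi>_def)
  qed auto
  obtain x y where xy: "q = (x, y)" by force
  have x: "max x0 (min x1 (x - fst (G q))) = x" and y: "max y0 (min y1 (y - snd (G q))) = y"
    using q(2) by (auto simp: \<Phi>_def xy)
  have clamp: "g = 0" if "max t0 (min t1 (t - g)) = t" "t0 \<le> t" "t \<le> t1" "t = t0 \<Longrightarrow> g < 0" "t = t1 \<Longrightarrow> g > 0"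
    for t t0 t1 g :: real
  proof (rule ccontr)
    assume "g \<noteq> 0"
    then consider "g < 0" | "g > 0" by linarith
    then show False
    proof cases
      case 1
      then have "min t1 (t - g) > t" using that(3,5) by (cases "t = t1") (auto simp: min_def)
      then show False using that(1) by (simp add: max_def split: if_splits)
    next
      case 2
      then have "t0 < t" using that(2,4) by (cases "t = t0") auto
      moreover have "min t1 (t - g) < t" using 2 by (simp add: min_less_iff_disj)
      ultimately have "max t0 (min t1 (t - g)) < t" by simp
      then show False using that(1) by simp
    qed
  qed
  have "fst (G q) = 0"
    by (rule clamp[OF x]) (use l r q(1) xy in auto)
  moreover have "snd (G q) = 0"
    by (rule clamp[OF y]) (use b t q(1) xy in auto)
  ultimately have "G q = 0" by (simp add: prod_eq_iff)
  then show ?thesis using q(1) by blast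
qed

text \<open>If \<open>f\<close> exceeded \<open>2 * M / (b - a)\<close> at every point with property
  \<open>P\<close>, the integral would be at least \<open>2 * M\<close>. Thus one point can be asked
  to satisfy an almost sure property and Markov's bound together.\<close>

lemma AE_Markov_choice:
  fixes f :: "real \<Rightarrow> ennreal"
  assumes [measurable]: "f \<in> borel_measurable borel" and P: "AE y in lborel. P y" and ab: "a < b"
    and int: "(\<integral>\<^sup>+y. f y * indicator {a..b} y \<partial>lborel) \<le> ennreal M" and M: "M > 0"
  obtains y where "y \<in> {a..b}" "P y" "f y \<le> ennreal (2 * M / (b - a))"
proof -
  have "\<exists>y. y \<in> {a..b} \<and> P y \<and> f y \<le> ennreal (2 * M / (b - a))"
  proof (rule ccontr)
    assume neg: "\<not> ?thesis"
    have "ennreal (2 * M) = (\<integral>\<^sup>+y. ennreal (2 * M / (b - a)) * indicator {a..b} y \<partial>lborel)"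
      using ab M by (simp add: nn_integral_cmult ennreal_mult[symmetric])
    also have "\<dots> \<le> (\<integral>\<^sup>+y. f y * indicator {a..b} y \<partial>lborel)"
    proof (rule nn_integral_mono_AE)
      show "AE y in lborel. ennreal (2 * M / (b - a)) * indicator {a..b} y \<le> f y * indicator {a..b} y"
        using P
      proof eventually_elim
        case (elim y)
        then have "y \<in> {a..b} \<Longrightarrow> ennreal (2 * M / (b - a)) \<le> f y" using neg by (meson linear)
        then show ?case by (cases "y \<in> {a..b}") simp_all
      qed
    qed
    also have "\<dots> \<le> ennreal M" by (rule int)
    finally show False using M by simp
  qed
  then show ?thesis using that by blast
qed

section \<open>The image of a square on which the derivative is nearly constant\<close>

text \<open>The shift \<open>A\<close> will be the value of the derivative at a Lebesgue point.\<close>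

locale acl_homeo =
  fixes F :: "real \<times> real \<Rightarrow> complex" and Fi :: "complex \<Rightarrow> real \<times> real"
    and gx gy :: "real \<times> real \<Rightarrow> complex"
  assumes homeo: "homeomorphism UNIV UNIV F Fi"
    and gx [measurable]: "gx \<in> borel_measurable borel" and gy [measurable]: "gy \<in> borel_measurable borel"
    and acl_x: "AE y in lborel. \<forall>a b A. a \<le> b \<longrightarrow> ennreal (norm (F (b, y) - F (a, y) - (b - a) *\<^sub>R A))
        \<le> (\<integral>\<^sup>+x. ennreal (norm (gx (x, y) - A)) * indicator {a..b} x \<partial>lborel)"
    and acl_y: "AE x in lborel. \<forall>a b A. a \<le> b \<longrightarrow> ennreal (norm (F (x, b) - F (x, a) - (b - a) *\<^sub>R A))
        \<le> (\<integral>\<^sup>+y. ennreal (norm (gy (x, y) - A)) * indicator {a..b} y \<partial>lborel)"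
begin

lemma contF: "continuous_on S F"
  using homeo by (metis homeomorphism_def continuous_on_subset subset_UNIV)

lemma contFi: "continuous_on S Fi"
  using homeo by (metis homeomorphism_def continuous_on_subset subset_UNIV)

lemma FiF [simp]: "Fi (F p) = p" and FFi [simp]: "F (Fi z) = z"
  using homeo unfolding homeomorphism_def by blast+

lemma F_measurable [measurable]: "F \<in> borel_measurable borel"
  and Fi_measurable [measurable]: "Fi \<in> borel_measurable borel"
  using contF contFi by (auto intro: borel_measurable_continuous_onI)

lemma image_eq_vimage: "F ` S = Fi -` S"
proof
  show "Fi -` S \<subseteq> F ` S" by (metis FFi image_eqI subsetI vimage_eq)
qed auto

text \<open>
  On many lines \<open>F\<close> is close to the affine map with derivative \<open>(A1, A2)\<close>, and four such lines bound a
  rectangle to which the Poincare--Miranda theorem applies.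
\<close>

lemma parallelogram_subset_image:
  fixes A1 A2 :: complex
  defines "D \<equiv> Re A1 * Im A2 - Re A2 * Im A1"
  assumes r: "r > 0" and D: "D > 0" and \<eta>: "\<eta> > 0" "32 * \<eta> * (norm A1 + norm A2) < D"
    and hx: "(\<integral>\<^sup>+p. ennreal (norm (gx p - A1)) * indicator ({a0-r..a0+r} \<times> {b0-r..b0+r}) p \<partial>lborel) \<le> ennreal (\<eta> * r\<^sup>2)"
    and hy: "(\<integral>\<^sup>+p. ennreal (norm (gy p - A2)) * indicator ({a0-r..a0+r} \<times> {b0-r..b0+r}) p \<partial>lborel) \<le> ennreal (\<eta> * r\<^sup>2)"
  shows "\<exists>\<alpha> \<beta>. {\<zeta>. \<bar>(Im A2 * Re \<zeta> - Re A2 * Im \<zeta>) / D - \<alpha>\<bar> \<le> r/4 \<and> \<bar>(Re A1 * Im \<zeta> - Im A1 * Re \<zeta>) / D - \<beta>\<bar> \<le> r/4}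
    \<subseteq> F ` ({a0-r..a0+r} \<times> {b0-r..b0+r})"
proof -
  let ?Q = "{a0-r..a0+r} \<times> {b0-r..b0+r}"
  \<comment> \<open>The total deviation of the derivative from \<open>A1\<close> along the
    horizontal line at height \<open>y\<close>; by Fubini its integral over the heights is
    controlled by \<open>hx\<close>.\<close>
  define lx where "lx = (\<lambda>y. \<integral>\<^sup>+x. ennreal (norm (gx (x, y) - A1)) * indicator {a0-r..a0+r} x \<partial>lborel)"
  define ly where "ly = (\<lambda>x. \<integral>\<^sup>+y. ennreal (norm (gy (x, y) - A2)) * indicator {b0-r..b0+r} y \<partial>lborel)"
  have [measurable]: "lx \<in> borel_measurable borel" "ly \<in> borel_measurable borel"
    unfolding lx_def ly_def by measurable
  have Ilx: "(\<integral>\<^sup>+y. lx y * indicator {s..t} y \<partial>lborel) \<le> ennreal (\<eta> * r\<^sup>2)" if "{s..t} \<subseteq> {b0-r..b0+r}" for s t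
  proof -
    have "(\<integral>\<^sup>+y. lx y * indicator {s..t} y \<partial>lborel)
      = (\<integral>\<^sup>+y. \<integral>\<^sup>+x. ennreal (norm (gx (x, y) - A1)) * indicator {a0-r..a0+r} x * indicator {s..t} y \<partial>lborel \<partial>lborel)"
      unfolding lx_def by (intro nn_integral_cong nn_integral_multc[symmetric]) measurable
    also have "\<dots> \<le> (\<integral>\<^sup>+y. \<integral>\<^sup>+x. ennreal (norm (gx (x, y) - A1)) * indicator ?Q (x, y) \<partial>lborel \<partial>lborel)"
      using that by (intro nn_integral_mono) (auto split: split_indicator)
    also have "\<dots> = (\<integral>\<^sup>+p. ennreal (norm (gx p - A1)) * indicator ?Q p \<partial>lborel)"
      by (rule nn_integral_lborel_snd[symmetric]) measurable
    finally show ?thesis using hx by simp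
  qed
  have Ily: "(\<integral>\<^sup>+x. ly x * indicator {s..t} x \<partial>lborel) \<le> ennreal (\<eta> * r\<^sup>2)" if "{s..t} \<subseteq> {a0-r..a0+r}" for s t
  proof -
    have "(\<integral>\<^sup>+x. ly x * indicator {s..t} x \<partial>lborel)
      = (\<integral>\<^sup>+x. \<integral>\<^sup>+y. ennreal (norm (gy (x, y) - A2)) * indicator {b0-r..b0+r} y * indicator {s..t} x \<partial>lborel \<partial>lborel)"
      unfolding ly_def by (intro nn_integral_cong nn_integral_multc[symmetric]) measurable
    also have "\<dots> \<le> (\<integral>\<^sup>+x. \<integral>\<^sup>+y. ennreal (norm (gy (x, y) - A2)) * indicator ?Q (x, y) \<partial>lborel \<partial>lborel)"
      using that by (intro nn_integral_mono) (auto split: split_indicator)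
    also have "\<dots> = (\<integral>\<^sup>+p. ennreal (norm (gy p - A2)) * indicator ?Q p \<partial>lborel)"
      by (rule nn_integral_lborel_fst[symmetric]) measurable
    finally show ?thesis using hy by simp
  qed
  have M0: "\<eta> * r\<^sup>2 > 0" using \<eta> r by simp
  have M1: "2 * (\<eta> * r\<^sup>2) / (t - s) = 4 * \<eta> * r" if "t - s = r/2" for s t
    using r unfolding that by (simp add: power2_eq_square)
  let ?Px = "\<lambda>y. \<forall>a b A. a \<le> b \<longrightarrow> ennreal (norm (F (b, y) - F (a, y) - (b - a) *\<^sub>R A))
        \<le> (\<integral>\<^sup>+x. ennreal (norm (gx (x, y) - A)) * indicator {a..b} x \<partial>lborel)"
  let ?Py = "\<lambda>x. \<forall>a b A. a \<le> b \<longrightarrow> ennreal (norm (F (x, b) - F (x, a) - (b - a) *\<^sub>R A))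
        \<le> (\<integral>\<^sup>+y. ennreal (norm (gy (x, y) - A)) * indicator {a..b} y \<partial>lborel)"
  have selx: "\<exists>y\<in>{s..t}. ?Px y \<and> lx y \<le> ennreal (4 * \<eta> * r)" if "t - s = r/2" "{s..t} \<subseteq> {b0-r..b0+r}" for s t
  proof -
    have st: "s < t" using that(1) r by simp
    show ?thesis
    proof (rule AE_Markov_choice[OF _ acl_x st Ilx[OF that(2)] M0])
      show "lx \<in> borel_measurable borel" by measurable
    qed (unfold M1[OF that(1)], blast)
  qed
  have sely: "\<exists>x\<in>{s..t}. ?Py x \<and> ly x \<le> ennreal (4 * \<eta> * r)" if "t - s = r/2" "{s..t} \<subseteq> {a0-r..a0+r}" for s t
  proof -
    have st: "s < t" using that(1) r by simp
    show ?thesis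
    proof (rule AE_Markov_choice[OF _ acl_y st Ily[OF that(2)] M0])
      show "ly \<in> borel_measurable borel" by measurable
    qed (unfold M1[OF that(1)], blast)
  qed
  \<comment> \<open>The four lines are taken in the outer quarters of the square, at distance at
    least \<open>r/2\<close> from the centre. Each strip has width \<open>r/2\<close>, so Markov's
    bound on the chosen line is \<open>4 * \<eta> * r\<close>.\<close>
  obtain y1 where y1: "y1 \<in> {b0+r/2..b0+r}" "?Px y1" "lx y1 \<le> ennreal (4 * \<eta> * r)"
  proof -
    have "\<exists>y\<in>{b0+r/2..b0+r}. ?Px y \<and> lx y \<le> ennreal (4 * \<eta> * r)" by (rule selx) (use r in auto)
    then show ?thesis using that by blast
  qed
  obtain y0 where y0: "y0 \<in> {b0-r..b0-r/2}" "?Px y0" "lx y0 \<le> ennreal (4 * \<eta> * r)"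
  proof -
    have "\<exists>y\<in>{b0-r..b0-r/2}. ?Px y \<and> lx y \<le> ennreal (4 * \<eta> * r)" by (rule selx) (use r in auto)
    then show ?thesis using that by blast
  qed
  obtain x1 where x1: "x1 \<in> {a0+r/2..a0+r}" "?Py x1" "ly x1 \<le> ennreal (4 * \<eta> * r)"
  proof -
    have "\<exists>y\<in>{a0+r/2..a0+r}. ?Py y \<and> ly y \<le> ennreal (4 * \<eta> * r)" by (rule sely) (use r in auto)
    then show ?thesis using that by blast
  qed
  obtain x0 where x0: "x0 \<in> {a0-r..a0-r/2}" "?Py x0" "ly x0 \<le> ennreal (4 * \<eta> * r)"
  proof -
    have "\<exists>y\<in>{a0-r..a0-r/2}. ?Py y \<and> ly y \<le> ennreal (4 * \<eta> * r)" by (rule sely) (use r in auto)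
    then show ?thesis using that by blast
  qed
  have ex: "norm (F (b, y) - F (a, y) - (b - a) *\<^sub>R A1) \<le> 4 * \<eta> * r"
    if "?Px y" "lx y \<le> ennreal (4 * \<eta> * r)" "a \<le> b" "{a..b} \<subseteq> {a0-r..a0+r}" for y a b
  proof -
    have "ennreal (norm (F (b, y) - F (a, y) - (b - a) *\<^sub>R A1))
       \<le> (\<integral>\<^sup>+x. ennreal (norm (gx (x, y) - A1)) * indicator {a..b} x \<partial>lborel)" using that by blast
    also have "\<dots> \<le> lx y" unfolding lx_def
      using that(4) by (intro nn_integral_mono) (auto split: split_indicator)
    also have "\<dots> \<le> ennreal (4 * \<eta> * r)" by fact
    finally show ?thesis using \<eta> r by (simp add: ennreal_le_iff)
  qed
  have ey: "norm (F (x, b) - F (x, a) - (b - a) *\<^sub>R A2) \<le> 4 * \<eta> * r"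
    if "?Py x" "ly x \<le> ennreal (4 * \<eta> * r)" "a \<le> b" "{a..b} \<subseteq> {b0-r..b0+r}" for x a b
  proof -
    have "ennreal (norm (F (x, b) - F (x, a) - (b - a) *\<^sub>R A2))
       \<le> (\<integral>\<^sup>+y. ennreal (norm (gy (x, y) - A2)) * indicator {a..b} y \<partial>lborel)" using that by blast
    also have "\<dots> \<le> ly x" unfolding ly_def
      using that(4) by (intro nn_integral_mono) (auto split: split_indicator)
    also have "\<dots> \<le> ennreal (4 * \<eta> * r)" by fact
    finally show ?thesis using \<eta> r by (simp add: ennreal_le_iff)
  qed
  \<comment> \<open>The affine map with derivative \<open>(A1, A2)\<close> that agrees with
    \<open>F\<close> at the corner \<open>(x0, y0)\<close>. The bottom and left sides are reached
    along one good line; the other two take two lines, which doubles the error to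
    \<open>8 * \<eta> * r\<close>.\<close>
  define L where "L = (\<lambda>x y. F (x0, y0) + (x - x0) *\<^sub>R A1 + (y - y0) *\<^sub>R A2)"
  have xs: "x0 \<le> x1" "{x0..x1} \<subseteq> {a0-r..a0+r}" and ys: "y0 \<le> y1" "{y0..y1} \<subseteq> {b0-r..b0+r}"
    using x0(1) x1(1) y0(1) y1(1) r by auto
  have pos: "0 \<le> 4 * \<eta> * r" using \<eta> r by simp
  have bot: "norm (F (x, y0) - L x y0) \<le> 4 * \<eta> * r" if "x \<in> {x0..x1}" for x
  proof -
    have "F (x, y0) - L x y0 = F (x, y0) - F (x0, y0) - (x - x0) *\<^sub>R A1" by (simp add: L_def)
    moreover have "norm (F (x, y0) - F (x0, y0) - (x - x0) *\<^sub>R A1) \<le> 4 * \<eta> * r"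
      by (rule ex[OF y0(2,3)]) (use that xs in auto)
    ultimately show ?thesis by (simp only:)
  qed
  have left: "norm (F (x0, y) - L x0 y) \<le> 4 * \<eta> * r" if "y \<in> {y0..y1}" for y
  proof -
    have "F (x0, y) - L x0 y = F (x0, y) - F (x0, y0) - (y - y0) *\<^sub>R A2" by (simp add: L_def)
    moreover have "norm (F (x0, y) - F (x0, y0) - (y - y0) *\<^sub>R A2) \<le> 4 * \<eta> * r"
      by (rule ey[OF x0(2,3)]) (use that ys in auto)
    ultimately show ?thesis by (simp only:)
  qed
  have top: "norm (F (x, y1) - L x y1) \<le> 8 * \<eta> * r" if "x \<in> {x0..x1}" for x
  proof -
    have e: "F (x, y1) - L x y1 = (F (x, y1) - F (x0, y1) - (x - x0) *\<^sub>R A1) + (F (x0, y1) - L x0 y1)"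
      by (simp add: L_def)
    have 1: "norm (F (x, y1) - F (x0, y1) - (x - x0) *\<^sub>R A1) \<le> 4 * \<eta> * r"
      by (rule ex[OF y1(2,3)]) (use that xs in auto)
    have 2: "norm (F (x0, y1) - L x0 y1) \<le> 4 * \<eta> * r" by (rule left) (use ys in simp)
    show ?thesis unfolding e by (rule order_trans[OF norm_triangle_ineq]) (use 1 2 in linarith)
  qed
  have right: "norm (F (x1, y) - L x1 y) \<le> 8 * \<eta> * r" if "y \<in> {y0..y1}" for y
  proof -
    have e: "F (x1, y) - L x1 y = (F (x1, y) - F (x1, y0) - (y - y0) *\<^sub>R A2) + (F (x1, y0) - L x1 y0)"
      by (simp add: L_def)
    have 1: "norm (F (x1, y) - F (x1, y0) - (y - y0) *\<^sub>R A2) \<le> 4 * \<eta> * r"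
      by (rule ey[OF x1(2,3)]) (use that ys in auto)
    have 2: "norm (F (x1, y0) - L x1 y0) \<le> 4 * \<eta> * r" by (rule bot) (use xs in simp)
    show ?thesis unfolding e by (rule order_trans[OF norm_triangle_ineq]) (use 1 2 in linarith)
  qed
  \<comment> \<open>\<open>B1\<close> and \<open>B2\<close> are the coordinates of a vector in the
    basis \<open>A1\<close>, \<open>A2\<close>, by Cramer's rule.\<close>
  define B1 where "B1 = (\<lambda>\<zeta>. (Im A2 * Re \<zeta> - Re A2 * Im \<zeta>) / D)"
  define B2 where "B2 = (\<lambda>\<zeta>. (Re A1 * Im \<zeta> - Im A1 * Re \<zeta>) / D)"
  have B_add: "B1 (z + w) = B1 z + B1 w" "B2 (z + w) = B2 z + B2 w" for z w
    by (simp_all add: B1_def B2_def add_divide_distrib[symmetric] algebra_simps)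
  have B_diff: "B1 (z - w) = B1 z - B1 w" "B2 (z - w) = B2 z - B2 w" for z w
    by (simp_all add: B1_def B2_def diff_divide_distrib[symmetric] algebra_simps)
  have B_sc: "B1 (t *\<^sub>R z) = t * B1 z" "B2 (t *\<^sub>R z) = t * B2 z" for t z
    by (simp_all add: B1_def B2_def algebra_simps)
  have B_A: "B1 A1 = 1" "B1 A2 = 0" "B2 A1 = 0" "B2 A2 = 1"
    using D by (simp_all add: B1_def B2_def D_def algebra_simps)
  have B_id: "B1 z *\<^sub>R A1 + B2 z *\<^sub>R A2 = z" for z
  proof -
    have "D * Re z = (Im A2 * Re z - Re A2 * Im z) * Re A1 + (Re A1 * Im z - Im A1 * Re z) * Re A2"
      "D * Im z = (Im A2 * Re z - Re A2 * Im z) * Im A1 + (Re A1 * Im z - Im A1 * Re z) * Im A2"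
      by (simp_all add: D_def algebra_simps)
    then have "((Im A2 * Re z - Re A2 * Im z) * Re A1 + (Re A1 * Im z - Im A1 * Re z) * Re A2) / D = Re z"
      "((Im A2 * Re z - Re A2 * Im z) * Im A1 + (Re A1 * Im z - Im A1 * Re z) * Im A2) / D = Im z"
      using D by (simp_all add: nonzero_divide_eq_eq mult.commute)
    then show ?thesis by (simp add: complex_eq_iff B1_def B2_def add_divide_distrib)
  qed
  \<comment> \<open>The hypothesis on \<open>\<eta>\<close> is spent here: the coordinates of the
    error stay below \<open>r/4\<close>.\<close>
  have small: "8 * \<eta> * r * (norm A1 + norm A2) / D < r / 4"
  proof -
    have "r * (32 * \<eta> * (norm A1 + norm A2)) < r * D" using \<eta>(2) r by (rule mult_strict_left_mono)
    then show ?thesis using D by (simp add: field_simps)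
  qed
  have B_small: "\<bar>B1 \<zeta>\<bar> < r/4" "\<bar>B2 \<zeta>\<bar> < r/4" if "norm \<zeta> \<le> 8 * \<eta> * r" for \<zeta>
  proof -
    have *: "\<bar>u * Re \<zeta> - v * Im \<zeta>\<bar> \<le> norm \<zeta> * norm A" if "norm (Complex u v) = norm A" for u v and A :: complex
    proof -
      have "\<bar>u * Re \<zeta> - v * Im \<zeta>\<bar> = \<bar>Re (Complex u v * \<zeta>)\<bar>" by simp
      also have "\<dots> \<le> norm (Complex u v * \<zeta>)" by (rule abs_Re_le_cmod)
      finally show ?thesis using that by (simp add: norm_mult mult.commute)
    qed
    have n: "norm (Complex (Im A2) (Re A2)) = norm A2" "norm (Complex (- Im A1) (- Re A1)) = norm A1"
      by (simp_all add: cmod_def add.commute)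
    have le: "norm \<zeta> * norm A2 \<le> 8 * \<eta> * r * (norm A1 + norm A2)" "norm \<zeta> * norm A1 \<le> 8 * \<eta> * r * (norm A1 + norm A2)"
      by (rule mult_mono; use that pos in simp)+
    have "\<bar>Im A2 * Re \<zeta> - Re A2 * Im \<zeta>\<bar> \<le> 8 * \<eta> * r * (norm A1 + norm A2)"
      using *[OF n(1)] le(1) by linarith
    then have "\<bar>B1 \<zeta>\<bar> \<le> 8 * \<eta> * r * (norm A1 + norm A2) / D"
      using D by (simp add: B1_def divide_right_mono)
    then show "\<bar>B1 \<zeta>\<bar> < r/4" using small by linarith
    have "\<bar>Re A1 * Im \<zeta> - Im A1 * Re \<zeta>\<bar> \<le> 8 * \<eta> * r * (norm A1 + norm A2)"
      using *[OF n(2)] le(2) by (simp add: algebra_simps)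
    then have "\<bar>B2 \<zeta>\<bar> \<le> 8 * \<eta> * r * (norm A1 + norm A2) / D"
      using D by (simp add: B2_def divide_right_mono)
    then show "\<bar>B2 \<zeta>\<bar> < r/4" using small by linarith
  qed
  define w where "w = L a0 b0"
  have "\<zeta> \<in> F ` ?Q" if "\<bar>B1 \<zeta> - B1 w\<bar> \<le> r/4" "\<bar>B2 \<zeta> - B2 w\<bar> \<le> r/4" for \<zeta>
  proof -
    \<comment> \<open>On each side of the rectangle the affine part of the relevant coordinate has
      the required sign and size at least \<open>r/2 - r/4\<close>, while the error is below
      \<open>r/4\<close>. A zero of \<open>G\<close> is a point that \<open>F\<close> maps to
      \<open>\<zeta>\<close>.\<close>
    define G where "G = (\<lambda>q. (B1 (F q - \<zeta>), B2 (F q - \<zeta>)))"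
    have BL: "B1 (L x y - \<zeta>) = (x - a0) - (B1 \<zeta> - B1 w)" "B2 (L x y - \<zeta>) = (y - b0) - (B2 \<zeta> - B2 w)" for x y
      by (simp_all add: w_def L_def B_add B_diff B_sc B_A)
    have dec: "B1 (F (x, y) - \<zeta>) = B1 (L x y - \<zeta>) + B1 (F (x, y) - L x y)"
       "B2 (F (x, y) - \<zeta>) = B2 (L x y - \<zeta>) + B2 (F (x, y) - L x y)" for x y
      by (simp_all add: B_diff)
    have left': "norm (F (x0, y) - L x0 y) \<le> 8 * \<eta> * r" if "y \<in> {y0..y1}" for y
      using left[OF that] pos by linarith
    have bot': "norm (F (x, y0) - L x y0) \<le> 8 * \<eta> * r" if "x \<in> {x0..x1}" for x
      using bot[OF that] pos by linarith
    have "\<exists>q\<in>{x0..x1} \<times> {y0..y1}. G q = 0"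
    proof (rule Poincare_Miranda_2D)
      show "continuous_on ({x0..x1} \<times> {y0..y1}) G"
        unfolding G_def B1_def B2_def using D by (intro continuous_intros contF) auto
      show "x0 \<le> x1" "y0 \<le> y1" by fact+
      fix y assume y: "y \<in> {y0..y1}"
      show "fst (G (x0, y)) < 0"
      proof -
        have "fst (G (x0, y)) = x0 - a0 - (B1 \<zeta> - B1 w) + B1 (F (x0, y) - L x0 y)" by (simp add: G_def dec BL)
        then show ?thesis
          using B_small(1)[OF left'[OF y]] that(1) x0(1) unfolding abs_less_iff abs_le_iff atLeastAtMost_iff by linarith
      qed
      show "fst (G (x1, y)) > 0"
      proof -
        have "fst (G (x1, y)) = x1 - a0 - (B1 \<zeta> - B1 w) + B1 (F (x1, y) - L x1 y)" by (simp add: G_def dec BL)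
        then show ?thesis
          using B_small(1)[OF right[OF y]] that(1) x1(1) unfolding abs_less_iff abs_le_iff atLeastAtMost_iff by linarith
      qed
    next
      fix x assume x: "x \<in> {x0..x1}"
      show "snd (G (x, y0)) < 0"
      proof -
        have "snd (G (x, y0)) = y0 - b0 - (B2 \<zeta> - B2 w) + B2 (F (x, y0) - L x y0)" by (simp add: G_def dec BL)
        then show ?thesis
          using B_small(2)[OF bot'[OF x]] that(2) y0(1) unfolding abs_less_iff abs_le_iff atLeastAtMost_iff by linarith
      qed
      show "snd (G (x, y1)) > 0"
      proof -
        have "snd (G (x, y1)) = y1 - b0 - (B2 \<zeta> - B2 w) + B2 (F (x, y1) - L x y1)" by (simp add: G_def dec BL)
        then show ?thesis
          using B_small(2)[OF top[OF x]] that(2) y1(1) unfolding abs_less_iff abs_le_iff atLeastAtMost_iff by linarith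
      qed
    qed
    then obtain q where q: "q \<in> {x0..x1} \<times> {y0..y1}" "G q = 0" by blast
    then have "F q - \<zeta> = 0" using B_id[of "F q - \<zeta>"] by (simp add: G_def zero_prod_def)
    moreover have "q \<in> ?Q" using q(1) xs ys by auto
    ultimately show ?thesis by (metis eq_iff_diff_eq_0 image_eqI)
  qed
  then show ?thesis
    by (intro exI[of _ "B1 w"] exI[of _ "B2 w"]) (auto simp: B1_def B2_def)
qed

end

section \<open>The area inequality\<close>

context acl_homeo
begin

definition jac :: "real \<times> real \<Rightarrow> real" where
  "jac p = Re (gx p) * Im (gy p) - Im (gx p) * Re (gy p)"

lemma jac_measurable [measurable]: "jac \<in> borel_measurable borel"
  unfolding jac_def by measurable

text \<open>At a common Lebesgue point with Jacobian \<open>D > 0\<close>, the image of a small ball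
  of radius \<open>2 * r\<close> contains a parallelogram of area \<open>D * r^2 / 4\<close>, while
  the Jacobian has integral at most \<open>32 * D * r^2\<close> over the ball; the ratio is 128. The
  Vitali comparison adds up such balls.\<close>

lemma nn_integral_jac_le:
  assumes locx: "\<And>R. (\<integral>\<^sup>+p. ennreal (norm (gx p)) * indicator (ball 0 R) p \<partial>lborel) < \<infinity>"
    and locy: "\<And>R. (\<integral>\<^sup>+p. ennreal (norm (gy p)) * indicator (ball 0 R) p \<partial>lborel) < \<infinity>"
    and locj: "\<And>R. (\<integral>\<^sup>+p. ennreal (norm (jac p)) * indicator (ball 0 R) p \<partial>lborel) < \<infinity>"
    and G: "open G"
  shows "(\<integral>\<^sup>+p. ennreal (jac p) * indicator G p \<partial>lborel) \<le> 128 * emeasure lborel (F ` G)"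
proof -
  have [measurable]: "ball c r \<in> sets borel" for c :: "real \<times> real" and r by simp
  define good where "good = (\<lambda>(g :: real \<times> real \<Rightarrow> complex) x. \<forall>\<eta>>0. \<exists>d>0. \<forall>r. 0 < r \<longrightarrow> r < d \<longrightarrow>
     (\<integral>\<^sup>+y. ennreal (norm (g y - g x)) * indicator (ball x r) y \<partial>lborel) \<le> ennreal \<eta> * emeasure lborel (ball x r))"
  define goodj where "goodj = (\<lambda>x. \<forall>\<eta>>0. \<exists>d>0. \<forall>r. 0 < r \<longrightarrow> r < d \<longrightarrow>
     (\<integral>\<^sup>+y. ennreal (norm (jac y - jac x)) * indicator (ball x r) y \<partial>lborel) \<le> ennreal \<eta> * emeasure lborel (ball x r))"
  have good_ae: "AE x in lborel. good gx x \<and> good gy x \<and> goodj x"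
    using Lebesgue_points[OF gx locx] Lebesgue_points[OF gy locy] Lebesgue_points[OF jac_measurable locj]
    unfolding good_def goodj_def by eventually_elim blast
  define M where "M = density lborel (\<lambda>p. ennreal (jac p))"
  \<comment> \<open>As \<open>F\<close> is a homeomorphism, the area of the image is itself a
    measure, the push-forward of Lebesgue measure by \<open>Fi\<close>; image areas of disjoint
    balls therefore add up.\<close>
  define N where "N = distr lborel borel Fi"
  have sM: "sets M = sets borel" and sN: "sets N = sets borel" by (simp_all add: M_def N_def)
  have eM: "emeasure M S = (\<integral>\<^sup>+p. ennreal (jac p) * indicator S p \<partial>lborel)" if "S \<in> sets borel" for S
    unfolding M_def by (rule emeasure_density) (use that in simp_all)
  have eN: "emeasure N S = emeasure lborel (F ` S)" if "S \<in> sets borel" for S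
    unfolding N_def image_eq_vimage using that by (subst emeasure_distr) simp_all
  \<comment> \<open>Where the Jacobian is not positive, \<open>ennreal\<close> makes the integrand
    0, so up to a null set these are the only points of \<open>G\<close> that count.\<close>
  define S where "S = {p \<in> G. good gx p \<and> good gy p \<and> goodj p \<and> 0 < jac p}"
  have ball_le: "emeasure lborel (ball p \<rho>) \<le> ennreal (4 * \<rho>\<^sup>2)" if "\<rho> > 0" for p :: "real \<times> real" and \<rho>
  proof -
    obtain a b where p: "p = (a, b)" by force
    have "ball p \<rho> \<subseteq> {a-\<rho>..a+\<rho>} \<times> {b-\<rho>..b+\<rho>}"
    proof
      fix q assume "q \<in> ball p \<rho>"
      then have "dist (fst p) (fst q) < \<rho>" "dist (snd p) (snd q) < \<rho>"
        using dist_fst_le[of p q] dist_snd_le[of p q] by auto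
      then show "q \<in> {a-\<rho>..a+\<rho>} \<times> {b-\<rho>..b+\<rho>}"
        by (cases q) (auto simp: p dist_real_def)
    qed
    then have "emeasure lborel (ball p \<rho>) \<le> emeasure lborel ({a-\<rho>..a+\<rho>} \<times> {b-\<rho>..b+\<rho>})"
      by (rule emeasure_mono) simp
    then show ?thesis using that by (simp add: emeasure_square)
  qed
  have loc: "\<exists>r. 0 < r \<and> r < d \<and> ball p r \<subseteq> G \<and> emeasure M (ball p r) \<le> 128 * emeasure N (ball p r)"
    if p: "p \<in> S" and d: "0 < d" for p d
  proof -
    obtain a0 b0 where p_eq: "p = (a0, b0)" by force
    define A1 where "A1 = gx p"
    define A2 where "A2 = gy p"
    define D where "D = jac p"
    have D_eq: "D = Re A1 * Im A2 - Re A2 * Im A1" by (simp add: D_def jac_def A1_def A2_def)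
    have D: "D > 0" using p by (simp add: S_def D_def)
    \<comment> \<open>Half of the threshold in \<open>parallelogram_subset_image\<close>.\<close>
    define \<eta> where "\<eta> = D / (64 * (norm A1 + norm A2))"
    have nA: "norm A1 + norm A2 > 0"
    proof (rule ccontr)
      assume "\<not> norm A1 + norm A2 > 0"
      then have "norm A1 = 0" "norm A2 = 0" using norm_ge_zero[of A1] norm_ge_zero[of A2] by linarith+
      then show False using D D_eq by simp
    qed
    have \<eta>: "\<eta> > 0" "32 * \<eta> * (norm A1 + norm A2) < D"
    proof -
      show "\<eta> > 0" using D nA by (simp add: \<eta>_def)
      have "\<eta> * (norm A1 + norm A2) = D / 64" 
      proof -
        have "D / (64 * n) * n = D / 64" if "n > 0" for n :: real using that by simp
        then show ?thesis using nA by (simp only: \<eta>_def)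
      qed
      then show "32 * \<eta> * (norm A1 + norm A2) < D" using D by linarith
    qed
    \<comment> \<open>The ball of radius \<open>2 * r\<close> has area at most
      \<open>16 * r^2\<close>, so a mean deviation of \<open>\<eta>/16\<close> yields the total
      \<open>\<eta> * r^2\<close> that is asked for on the square.\<close>
    have "\<eta>/16 > 0" using \<eta> by simp
    obtain d1 where d1: "d1 > 0" "\<And>r. 0 < r \<Longrightarrow> r < d1 \<Longrightarrow>
        (\<integral>\<^sup>+y. ennreal (norm (gx y - A1)) * indicator (ball p r) y \<partial>lborel) \<le> ennreal (\<eta>/16) * emeasure lborel (ball p r)"
      using p \<open>\<eta>/16 > 0\<close> unfolding S_def good_def A1_def by blast
    obtain d2 where d2: "d2 > 0" "\<And>r. 0 < r \<Longrightarrow> r < d2 \<Longrightarrow>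
        (\<integral>\<^sup>+y. ennreal (norm (gy y - A2)) * indicator (ball p r) y \<partial>lborel) \<le> ennreal (\<eta>/16) * emeasure lborel (ball p r)"
      using p \<open>\<eta>/16 > 0\<close> unfolding S_def good_def A2_def by blast
    obtain d3 where d3: "d3 > 0" "\<And>r. 0 < r \<Longrightarrow> r < d3 \<Longrightarrow>
        (\<integral>\<^sup>+y. ennreal (norm (jac y - D)) * indicator (ball p r) y \<partial>lborel) \<le> ennreal D * emeasure lborel (ball p r)"
      using p D unfolding S_def goodj_def D_def by blast
    obtain d4 where d4: "d4 > 0" "ball p d4 \<subseteq> G" using G p by (auto simp: S_def open_contains_ball)
    define \<rho> where "\<rho> = Min {d, d1, d2, d3, d4} / 2"
    have \<rho>: "\<rho> > 0" "\<rho> < d" "\<rho> < d1" "\<rho> < d2" "\<rho> < d3" "\<rho> < d4"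
      using d d1(1) d2(1) d3(1) d4(1) unfolding \<rho>_def by (auto simp: min_def)
    define r where "r = \<rho> / 2"
    have r: "r > 0" using \<rho> by (simp add: r_def)
    let ?Q = "{a0-r..a0+r} \<times> {b0-r..b0+r}"
    have Qb: "?Q \<subseteq> ball p \<rho>"
    proof
      fix q assume "q \<in> ?Q"
      then obtain x y where q: "q = (x, y)" "\<bar>x - a0\<bar> \<le> r" "\<bar>y - b0\<bar> \<le> r" by auto
      have "dist p q = sqrt ((dist a0 x)\<^sup>2 + (dist b0 y)\<^sup>2)" by (simp add: p_eq q dist_Pair_Pair)
      also have "\<dots> \<le> sqrt (r\<^sup>2 + r\<^sup>2)"
        using q by (intro real_sqrt_le_mono add_mono power_mono) (auto simp: dist_real_def)
      also have "\<dots> < sqrt (\<rho>\<^sup>2)"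
        using r by (intro real_sqrt_less_mono) (simp add: r_def power2_eq_square)
      also have "\<dots> = \<rho>" using \<rho> by simp
      finally show "q \<in> ball p \<rho>" by simp
    qed
    have \<eta>ball: "ennreal (\<eta>/16) * emeasure lborel (ball p \<rho>) \<le> ennreal (\<eta> * r\<^sup>2)"
    proof -
      have "ennreal (\<eta>/16) * emeasure lborel (ball p \<rho>) \<le> ennreal (\<eta>/16) * ennreal (4 * \<rho>\<^sup>2)"
        using ball_le[OF \<rho>(1)] by (rule mult_left_mono) simp
      also have "\<dots> = ennreal (\<eta> * r\<^sup>2)"
        using \<eta> by (subst ennreal_mult[symmetric]) (simp_all add: r_def power2_eq_square)
      finally show ?thesis .
    qed
    have hx: "(\<integral>\<^sup>+q. ennreal (norm (gx q - A1)) * indicator ?Q q \<partial>lborel) \<le> ennreal (\<eta> * r\<^sup>2)"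
    proof -
      have "(\<integral>\<^sup>+q. ennreal (norm (gx q - A1)) * indicator ?Q q \<partial>lborel)
        \<le> (\<integral>\<^sup>+q. ennreal (norm (gx q - A1)) * indicator (ball p \<rho>) q \<partial>lborel)"
        using Qb by (intro nn_integral_mono mult_left_mono) (auto simp: indicator_def)
      then show ?thesis using d1(2)[OF \<rho>(1,3)] \<eta>ball by (meson order_trans)
    qed
    have hy: "(\<integral>\<^sup>+q. ennreal (norm (gy q - A2)) * indicator ?Q q \<partial>lborel) \<le> ennreal (\<eta> * r\<^sup>2)"
    proof -
      have "(\<integral>\<^sup>+q. ennreal (norm (gy q - A2)) * indicator ?Q q \<partial>lborel)
        \<le> (\<integral>\<^sup>+q. ennreal (norm (gy q - A2)) * indicator (ball p \<rho>) q \<partial>lborel)"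
        using Qb by (intro nn_integral_mono mult_left_mono) (auto simp: indicator_def)
      then show ?thesis using d2(2)[OF \<rho>(1,4)] \<eta>ball by (meson order_trans)
    qed
    obtain \<alpha> \<beta> where sub: "{\<zeta>. \<bar>(Im A2 * Re \<zeta> - Re A2 * Im \<zeta>) / D - \<alpha>\<bar> \<le> r/4 \<and>
        \<bar>(Re A1 * Im \<zeta> - Im A1 * Re \<zeta>) / D - \<beta>\<bar> \<le> r/4} \<subseteq> F ` ?Q" (is "?S \<subseteq> _")
      using parallelogram_subset_image[OF r D[unfolded D_eq] \<eta>(1) \<eta>(2)[unfolded D_eq] hx hy]
      unfolding D_eq by blast
    have "emeasure lborel ?S = ennreal (D * (4 * (r/4)\<^sup>2))"
      using emeasure_parallelogram[of "Re A1" "Im A2" "Re A2" "Im A1" "r/4" \<alpha> \<beta>] D r unfolding D_eq by simp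
    also have "D * (4 * (r/4)\<^sup>2) = D * r\<^sup>2 / 4" by (simp add: power2_eq_square)
    finally have area: "ennreal (D * r\<^sup>2 / 4) = emeasure lborel ?S" by simp
    have "?S \<subseteq> F ` ball p \<rho>" using sub Qb by blast
    then have "emeasure lborel ?S \<le> emeasure lborel (F ` ball p \<rho>)"
      by (rule emeasure_mono) (simp add: image_eq_vimage measurable_sets_borel[OF Fi_measurable])
    then have low: "ennreal (D * r\<^sup>2 / 4) \<le> emeasure N (ball p \<rho>)" using area by (simp add: eN)
    have "emeasure M (ball p \<rho>) = (\<integral>\<^sup>+q. ennreal (jac q) * indicator (ball p \<rho>) q \<partial>lborel)" by (simp add: eM)
    also have "\<dots> \<le> (\<integral>\<^sup>+q. ennreal (norm (jac q - D)) * indicator (ball p \<rho>) q + ennreal D * indicator (ball p \<rho>) q \<partial>lborel)"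
    proof (rule nn_integral_mono)
      fix q
      have "jac q \<le> norm (jac q - D) + D" by simp
      then have "ennreal (jac q) \<le> ennreal (norm (jac q - D)) + ennreal D"
        using D by (subst ennreal_plus[symmetric]) (auto intro: ennreal_leI simp del: ennreal_plus)
      then show "ennreal (jac q) * indicator (ball p \<rho>) q
        \<le> ennreal (norm (jac q - D)) * indicator (ball p \<rho>) q + ennreal D * indicator (ball p \<rho>) q"
        by (cases "q \<in> ball p \<rho>") simp_all
    qed
    also have "\<dots> = (\<integral>\<^sup>+q. ennreal (norm (jac q - D)) * indicator (ball p \<rho>) q \<partial>lborel) + ennreal D * emeasure lborel (ball p \<rho>)"
      by (subst nn_integral_add) (simp_all add: nn_integral_cmult)
    also have "\<dots> \<le> ennreal D * emeasure lborel (ball p \<rho>) + ennreal D * emeasure lborel (ball p \<rho>)"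
      using d3(2)[OF \<rho>(1,5)] by (rule add_right_mono)
    also have "\<dots> \<le> ennreal D * ennreal (4 * \<rho>\<^sup>2) + ennreal D * ennreal (4 * \<rho>\<^sup>2)"
      using ball_le[OF \<rho>(1)] by (intro add_mono mult_left_mono) simp_all
    also have "\<dots> = ennreal (128 * (D * r\<^sup>2 / 4))"
      using D by (simp add: ennreal_mult[symmetric] ennreal_plus[symmetric] r_def power2_eq_square del: ennreal_plus)
    also have "\<dots> = 128 * ennreal (D * r\<^sup>2 / 4)" using D by (subst ennreal_mult) simp_all
    also have "\<dots> \<le> 128 * emeasure N (ball p \<rho>)" using low by (rule mult_left_mono) simp
    finally show ?thesis using \<rho> d4 by (intro exI[of _ \<rho>]) auto
  qed
  obtain U where U: "open U" "U \<subseteq> G" "negligible (S - U)" "emeasure M U \<le> 128 * emeasure N U"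
    using Vitali_comparison[OF sM sN loc] by blast
  have "AE p in lebesgue. p \<notin> S - U" using U(3) by (intro AE_not_in) (simp add: negligible_iff_null_sets)
  then have "AE p in lborel. p \<notin> S - U" by (simp add: AE_completion_iff)
  then have "(\<integral>\<^sup>+p. ennreal (jac p) * indicator G p \<partial>lborel) \<le> (\<integral>\<^sup>+p. ennreal (jac p) * indicator U p \<partial>lborel)"
    using good_ae
  proof (intro nn_integral_mono_AE, eventually_elim)
    case (elim p)
    then show ?case
      by (cases "0 < jac p"; cases "p \<in> G"; cases "p \<in> U") (auto simp: S_def ennreal_neg)
  qed
  also have "\<dots> = emeasure M U" using U(1) by (simp add: eM)
  also have "\<dots> \<le> 128 * emeasure N U" by (rule U(4))
  also have "\<dots> \<le> 128 * emeasure N G"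
    using U(1,2) G by (intro mult_left_mono emeasure_mono) (auto simp: sN)
  also have "\<dots> = 128 * emeasure lborel (F ` G)" using G by (simp add: eN)
  finally show ?thesis .
qed

end

section \<open>Logarithmic distance estimate\<close>

lemma abs_ln_diff_le:
  fixes x y c :: real
  assumes "0 < c" "c \<le> x" "c \<le> y"
  shows "\<bar>ln x - ln y\<bar> \<le> \<bar>x - y\<bar> / c"
proof -
  have "ln x - ln y \<le> (x - y) / y" "ln y - ln x \<le> (y - x) / x"
    using assms by (intro ln_diff_le; linarith)+
  moreover have "(x - y) / y \<le> \<bar>x - y\<bar> / c" "(y - x) / x \<le> \<bar>x - y\<bar> / c"
    using assms by (intro frac_le; linarith)+
  ultimately show ?thesis by linarith
qed

text \<open>A chain rule for increments instead of derivatives. On a short interval the truncated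
  distance stays within a quarter of its value \<open>c\<close>, so the logarithm has Lipschitz
  constant \<open>4 / (3 * c)\<close> there, which is at most \<open>2 / m\<close>;
  \<open>Bolzano\<close> cuts a general interval into such pieces.\<close>

lemma ln_max_upper_gradient:
  fixes \<phi> :: "real \<Rightarrow> complex" and G :: "real \<Rightarrow> ennreal"
  defines "m \<equiv> \<lambda>w t x. max (norm (\<phi> x - w)) t"
  assumes cont: "continuous_on UNIV \<phi>" and G [measurable]: "G \<in> borel_measurable borel" and t: "t > 0"
    and ub: "\<And>a b. a \<le> b \<Longrightarrow> ennreal (norm (\<phi> b - \<phi> a)) \<le> (\<integral>\<^sup>+x. G x * indicator {a..b} x \<partial>lborel)"
    and ab: "a \<le> b"
  shows "ennreal \<bar>ln (m w t b) - ln (m w t a)\<bar> \<le> (\<integral>\<^sup>+x. G x * ennreal (2 / m w t x) * indicator {a..b} x \<partial>lborel)"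
  using ab
proof (induction rule: Bolzano)
  case (trans a b c)
  have mc: "continuous_on UNIV (m w t)"
    unfolding m_def by (intro continuous_intros cont)
  have [measurable]: "m w t \<in> borel_measurable borel" using mc by (rule borel_measurable_continuous_onI)
  let ?X = "\<lambda>x. G x * ennreal (2 / m w t x)"
  have "ennreal \<bar>ln (m w t c) - ln (m w t a)\<bar> \<le> ennreal (\<bar>ln (m w t b) - ln (m w t a)\<bar> + \<bar>ln (m w t c) - ln (m w t b)\<bar>)"
    by (intro ennreal_leI) linarith
  also have "\<dots> = ennreal \<bar>ln (m w t b) - ln (m w t a)\<bar> + ennreal \<bar>ln (m w t c) - ln (m w t b)\<bar>"
    by (rule ennreal_plus) simp_all
  also have "\<dots> \<le> (\<integral>\<^sup>+x. ?X x * indicator {a..b} x \<partial>lborel) + (\<integral>\<^sup>+x. ?X x * indicator {b..c} x \<partial>lborel)"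
    using trans(1,2) by (rule add_mono)
  also have "\<dots> = (\<integral>\<^sup>+x. ?X x * indicator {a..b} x + ?X x * indicator {b..c} x \<partial>lborel)"
    by (rule nn_integral_add[symmetric]) measurable
  also have "\<dots> \<le> (\<integral>\<^sup>+x. ?X x * indicator {a..c} x \<partial>lborel)"
  proof (rule nn_integral_mono_AE)
    show "AE x in lborel. ?X x * indicator {a..b} x + ?X x * indicator {b..c} x \<le> ?X x * indicator {a..c} x"
      using AE_lborel_singleton[of b]
    proof eventually_elim
      case (elim x)
      then consider "x \<in> {a..b} \<and> x \<notin> {b..c}" | "x \<notin> {a..b} \<and> x \<in> {b..c}" | "x \<notin> {a..b} \<and> x \<notin> {b..c}"
        by fastforce
      then show ?case using trans(3,4) by cases auto
    qed
  qed
  finally show ?case .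
next
  case (local x)
  have mc: "continuous_on UNIV (m w t)"
    unfolding m_def by (intro continuous_intros cont)
  have [measurable]: "m w t \<in> borel_measurable borel" using mc by (rule borel_measurable_continuous_onI)
  define c where "c = m w t x"
  have c: "c > 0" using t by (simp add: c_def m_def less_max_iff_disj)
  have "isCont (m w t) x" using mc by (simp add: continuous_on_eq_continuous_at)
  then obtain d where d: "d > 0" "\<And>y. dist y x < d \<Longrightarrow> dist (m w t y) (m w t x) < c / 4"
    unfolding continuous_at_eps_delta using c by (metis divide_pos_pos zero_less_numeral)
  show ?case
  proof (intro exI[of _ d] conjI allI impI d)
    fix a b assume ab: "a \<le> x \<and> x \<le> b \<and> b - a < d"
    have near: "3/4 * c \<le> m w t y \<and> m w t y \<le> 5/4 * c" if "y \<in> {a..b}" for y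
    proof -
      have "dist y x < d" using that ab by (auto simp: dist_real_def)
      from d(2)[OF this] show ?thesis unfolding dist_real_def c_def[symmetric] abs_less_iff by linarith
    qed
    have "\<bar>ln (m w t b) - ln (m w t a)\<bar> \<le> \<bar>m w t b - m w t a\<bar> / (3/4 * c)"
      using near[of a] near[of b] ab c by (intro abs_ln_diff_le) auto
    also have "\<dots> \<le> norm (\<phi> b - \<phi> a) / (3/4 * c)"
    proof (rule divide_right_mono)
      have "\<bar>norm (\<phi> b - w) - norm (\<phi> a - w)\<bar> \<le> norm (\<phi> b - \<phi> a)"
        using norm_triangle_ineq3[of "\<phi> b - w" "\<phi> a - w"] by simp
      then show "\<bar>m w t b - m w t a\<bar> \<le> norm (\<phi> b - \<phi> a)" unfolding m_def by linarith
    qed (use c in simp)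
    also have "\<dots> = 4 / (3 * c) * norm (\<phi> b - \<phi> a)" using c by simp
    finally have "ennreal \<bar>ln (m w t b) - ln (m w t a)\<bar> \<le> ennreal (4 / (3 * c)) * ennreal (norm (\<phi> b - \<phi> a))"
      using c by (subst ennreal_mult[symmetric]) (auto intro: ennreal_leI)
    also have "\<dots> \<le> ennreal (4 / (3 * c)) * (\<integral>\<^sup>+x. G x * indicator {a..b} x \<partial>lborel)"
      using ub[of a b] ab by (intro mult_left_mono) auto
    also have "\<dots> = (\<integral>\<^sup>+x. ennreal (4 / (3 * c)) * (G x * indicator {a..b} x) \<partial>lborel)"
      by (rule nn_integral_cmult[symmetric]) measurable
    also have "\<dots> \<le> (\<integral>\<^sup>+x. G x * ennreal (2 / m w t x) * indicator {a..b} x \<partial>lborel)"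
    proof (rule nn_integral_mono)
      fix y
      show "ennreal (4 / (3 * c)) * (G y * indicator {a..b} y) \<le> G y * ennreal (2 / m w t y) * indicator {a..b} y"
      proof (cases "y \<in> {a..b}")
        case True
        have "4 / (3 * c) \<le> 2 / (5/4 * c)" using c by (simp add: field_simps)
        also have "\<dots> \<le> 2 / m w t y" using near[OF True] c by (intro divide_left_mono mult_pos_pos) auto
        finally have "G y * ennreal (4 / (3 * c)) \<le> G y * ennreal (2 / m w t y)"
          by (intro mult_left_mono ennreal_leI) auto
        then show ?thesis using True by (simp add: mult.commute)
      qed simp
    qed
    finally show "ennreal \<bar>ln (m w t b) - ln (m w t a)\<bar> \<le> (\<integral>\<^sup>+x. G x * ennreal (2 / m w t x) * indicator {a..b} x \<partial>lborel)" .
  qed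
qed

text \<open>The one-sided form avoids differences in \<open>ennreal\<close>; both directions are
  included, since \<open>a\<close> and \<open>b\<close> may be exchanged. Integrating over all of
  \<open>{c..d}\<close> makes the error term the same for all pairs of points, which allows
  averaging over them.\<close>

definition upper_gradient_x :: "(real \<times> real \<Rightarrow> ennreal) \<Rightarrow> (real \<times> real \<Rightarrow> ennreal) \<Rightarrow> bool" where
  "upper_gradient_x u V \<longleftrightarrow> (AE y in lborel. \<forall>c d. \<forall>a\<in>{c..d}. \<forall>b\<in>{c..d}.
     u (b, y) \<le> u (a, y) + (\<integral>\<^sup>+x. V (x, y) * indicator {c..d} x \<partial>lborel))"

section \<open>Poincare inequalities on rectangles and squares\<close>

abbreviation swap_args :: "(real \<times> real \<Rightarrow> ennreal) \<Rightarrow> real \<times> real \<Rightarrow> ennreal" where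
  "swap_args w \<equiv> \<lambda>p. w (snd p, fst p)"

lemma nn_integral_swap_args:
  fixes w :: "real \<times> real \<Rightarrow> ennreal"
  assumes [measurable]: "w \<in> borel_measurable borel"
  shows "(\<integral>\<^sup>+p. w (snd p, fst p) \<partial>lborel) = (\<integral>\<^sup>+p. w p \<partial>lborel)"
  using nn_integral_lborel_fst[OF assms] nn_integral_lborel_snd[of "swap_args w"] by simp

lemma nn_integral_rect_swap:
  fixes w :: "real \<times> real \<Rightarrow> ennreal"
  assumes [measurable]: "w \<in> borel_measurable borel" "I \<in> sets borel" "J \<in> sets borel"
  shows "(\<integral>\<^sup>+p. w (snd p, fst p) * indicator (J \<times> I) p \<partial>lborel) = (\<integral>\<^sup>+p. w p * indicator (I \<times> J) p \<partial>lborel)"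
proof -
  have "(\<integral>\<^sup>+p. w (snd p, fst p) * indicator (J \<times> I) p \<partial>lborel)
    = (\<integral>\<^sup>+p. (\<lambda>q. w q * indicator (I \<times> J) q) (snd p, fst p) \<partial>lborel)"
    by (intro nn_integral_cong) (auto simp: indicator_def)
  also have "\<dots> = (\<integral>\<^sup>+p. w p * indicator (I \<times> J) p \<partial>lborel)"
    by (rule nn_integral_swap_args) measurable
  finally show ?thesis .
qed

lemma nn_integral_rect:
  fixes w :: "real \<times> real \<Rightarrow> ennreal"
  assumes [measurable]: "w \<in> borel_measurable borel" "I \<in> sets borel" "J \<in> sets borel"
  shows "(\<integral>\<^sup>+p. w p * indicator (I \<times> J) p \<partial>lborel)
    = (\<integral>\<^sup>+y. (\<integral>\<^sup>+x. w (x, y) * indicator I x \<partial>lborel) * indicator J y \<partial>lborel)"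
proof -
  have "(\<integral>\<^sup>+p. w p * indicator (I \<times> J) p \<partial>lborel)
    = (\<integral>\<^sup>+y. \<integral>\<^sup>+x. w (x, y) * indicator (I \<times> J) (x, y) \<partial>lborel \<partial>lborel)"
    by (rule nn_integral_lborel_snd) measurable
  also have "\<dots> = (\<integral>\<^sup>+y. \<integral>\<^sup>+x. w (x, y) * indicator I x * indicator J y \<partial>lborel \<partial>lborel)"
    by (simp add: indicator_times mult.assoc)
  also have "\<dots> = (\<integral>\<^sup>+y. (\<integral>\<^sup>+x. w (x, y) * indicator I x \<partial>lborel) * indicator J y \<partial>lborel)"
    by (intro nn_integral_cong nn_integral_multc) measurable
  finally show ?thesis .
qed

text \<open>Integrating the inequality over all pairs of points of \<open>I\<close> and
  \<open>I'\<close> compares the two means; the lengths are multiplied out so that no division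
  occurs in \<open>ennreal\<close>.\<close>

lemma average_comparison:
  fixes u :: "real \<Rightarrow> ennreal"
  assumes [measurable]: "u \<in> borel_measurable borel" "I \<in> sets borel" "I' \<in> sets borel"
    and le: "\<And>x x'. x \<in> I \<Longrightarrow> x' \<in> I' \<Longrightarrow> u x \<le> u x' + W"
  shows "emeasure lborel I' * (\<integral>\<^sup>+x. u x * indicator I x \<partial>lborel)
    \<le> emeasure lborel I * (\<integral>\<^sup>+x. u x * indicator I' x \<partial>lborel) + emeasure lborel I * (emeasure lborel I' * W)"
proof -
  have "emeasure lborel I' * (\<integral>\<^sup>+x. u x * indicator I x \<partial>lborel)
    = (\<integral>\<^sup>+x. emeasure lborel I' * (u x * indicator I x) \<partial>lborel)"
    by (rule nn_integral_cmult[symmetric]) measurable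
  also have "\<dots> = (\<integral>\<^sup>+x. \<integral>\<^sup>+x'. (u x * indicator I x) * indicator I' x' \<partial>lborel \<partial>lborel)"
    by (intro nn_integral_cong) (simp add: nn_integral_cmult mult.commute[of "emeasure lborel I'"])
  also have "\<dots> \<le> (\<integral>\<^sup>+x. \<integral>\<^sup>+x'. (u x' * indicator I' x' + W * indicator I' x') * indicator I x \<partial>lborel \<partial>lborel)"
    using le by (intro nn_integral_mono) (auto split: split_indicator)
  also have "\<dots> = (\<integral>\<^sup>+x. (\<integral>\<^sup>+x'. u x' * indicator I' x' + W * indicator I' x' \<partial>lborel) * indicator I x \<partial>lborel)"
    by (intro nn_integral_cong nn_integral_multc) measurable
  also have "\<dots> = (\<integral>\<^sup>+x'. u x' * indicator I' x' + W * indicator I' x' \<partial>lborel) * emeasure lborel I"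
    by (subst nn_integral_cmult) simp_all
  also have "(\<integral>\<^sup>+x'. u x' * indicator I' x' + W * indicator I' x' \<partial>lborel)
    = (\<integral>\<^sup>+x'. u x' * indicator I' x' \<partial>lborel) + W * emeasure lborel I'"
    by (subst nn_integral_add) (simp_all add: nn_integral_cmult)
  finally show ?thesis by (simp add: distrib_left distrib_right mult.commute mult.left_commute)
qed

lemma upper_gradient_x_average:
  assumes [measurable]: "u \<in> borel_measurable borel" "V \<in> borel_measurable borel" "I' \<in> sets borel" "J \<in> sets borel"
    and ug: "upper_gradient_x u V" and sub: "I' \<subseteq> {c..d}"
  shows "emeasure lborel I' * (\<integral>\<^sup>+p. u p * indicator ({c..d} \<times> J) p \<partial>lborel)
    \<le> emeasure lborel {c..d} * (\<integral>\<^sup>+p. u p * indicator (I' \<times> J) p \<partial>lborel)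
      + emeasure lborel {c..d} * (emeasure lborel I' * (\<integral>\<^sup>+p. V p * indicator ({c..d} \<times> J) p \<partial>lborel))"
proof -
  let ?I = "{c..d}"
  let ?u = "\<lambda>S y. \<integral>\<^sup>+x. u (x, y) * indicator S x \<partial>lborel"
  let ?V = "\<lambda>y. \<integral>\<^sup>+x. V (x, y) * indicator ?I x \<partial>lborel"
  have "emeasure lborel I' * (\<integral>\<^sup>+p. u p * indicator (?I \<times> J) p \<partial>lborel)
    = emeasure lborel I' * (\<integral>\<^sup>+y. ?u ?I y * indicator J y \<partial>lborel)"
    by (subst nn_integral_rect) simp_all
  also have "\<dots> = (\<integral>\<^sup>+y. emeasure lborel I' * (?u ?I y * indicator J y) \<partial>lborel)"
    by (rule nn_integral_cmult[symmetric]) measurable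
  also have "\<dots> \<le> (\<integral>\<^sup>+y. emeasure lborel ?I * (?u I' y * indicator J y)
      + emeasure lborel ?I * (emeasure lborel I' * (?V y * indicator J y)) \<partial>lborel)"
  proof (rule nn_integral_mono_AE)
    show "AE y in lborel. emeasure lborel I' * (?u ?I y * indicator J y) \<le> emeasure lborel ?I * (?u I' y * indicator J y)
      + emeasure lborel ?I * (emeasure lborel I' * (?V y * indicator J y))"
      using ug unfolding upper_gradient_x_def
    proof eventually_elim
      case (elim y)
      have "emeasure lborel I' * ?u ?I y \<le> emeasure lborel ?I * ?u I' y + emeasure lborel ?I * (emeasure lborel I' * ?V y)"
        by (rule average_comparison) (use elim sub in auto)
      then show ?case by (cases "y \<in> J") simp_all
    qed
  qed
  also have "\<dots> = emeasure lborel ?I * (\<integral>\<^sup>+y. ?u I' y * indicator J y \<partial>lborel)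
      + emeasure lborel ?I * (emeasure lborel I' * (\<integral>\<^sup>+y. ?V y * indicator J y \<partial>lborel))"
    by (subst nn_integral_add) (simp_all add: nn_integral_cmult)
  also have "\<dots> = emeasure lborel ?I * (\<integral>\<^sup>+p. u p * indicator (I' \<times> J) p \<partial>lborel)
      + emeasure lborel ?I * (emeasure lborel I' * (\<integral>\<^sup>+p. V p * indicator (?I \<times> J) p \<partial>lborel))"
    by (simp add: nn_integral_rect)
  finally show ?thesis .
qed

lemma upper_gradient_y_average:
  assumes [measurable]: "u \<in> borel_measurable borel" "V \<in> borel_measurable borel" "J' \<in> sets borel" "I \<in> sets borel"
    and ug: "upper_gradient_x (swap_args u) (swap_args V)" and sub: "J' \<subseteq> {c..d}"
  shows "emeasure lborel J' * (\<integral>\<^sup>+p. u p * indicator (I \<times> {c..d}) p \<partial>lborel)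
    \<le> emeasure lborel {c..d} * (\<integral>\<^sup>+p. u p * indicator (I \<times> J') p \<partial>lborel)
      + emeasure lborel {c..d} * (emeasure lborel J' * (\<integral>\<^sup>+p. V p * indicator (I \<times> {c..d}) p \<partial>lborel))"
proof -
  have "swap_args u \<in> borel_measurable borel" "swap_args V \<in> borel_measurable borel" by measurable
  from upper_gradient_x_average[OF this assms(3,4) ug sub]
  show ?thesis
    unfolding nn_integral_rect_swap[OF assms(1,4) atLeastAtMost_borel]
      nn_integral_rect_swap[OF assms(1,4,3)] nn_integral_rect_swap[OF assms(2,4) atLeastAtMost_borel] .
qed

text \<open>On a line that meets a zero of \<open>u\<close>, the integral of \<open>V\<close> over
  the line bounds \<open>u\<close> at each of its points.\<close>

lemma upper_gradient_x_zero:
  assumes [measurable]: "u \<in> borel_measurable borel" "V \<in> borel_measurable borel" "J \<in> sets borel"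
    and ug: "upper_gradient_x u V" and zero: "\<And>y. y \<in> J \<Longrightarrow> \<exists>x\<in>{c..d}. u (x, y) = 0"
  shows "(\<integral>\<^sup>+p. u p * indicator ({c..d} \<times> J) p \<partial>lborel)
    \<le> emeasure lborel {c..d} * (\<integral>\<^sup>+p. V p * indicator ({c..d} \<times> J) p \<partial>lborel)"
proof -
  let ?I = "{c..d}"
  let ?V = "\<lambda>y. \<integral>\<^sup>+x. V (x, y) * indicator ?I x \<partial>lborel"
  have "(\<integral>\<^sup>+p. u p * indicator (?I \<times> J) p \<partial>lborel) = (\<integral>\<^sup>+y. (\<integral>\<^sup>+x. u (x, y) * indicator ?I x \<partial>lborel) * indicator J y \<partial>lborel)"
    by (rule nn_integral_rect) measurable
  also have "\<dots> \<le> (\<integral>\<^sup>+y. emeasure lborel ?I * (?V y * indicator J y) \<partial>lborel)"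
  proof (rule nn_integral_mono_AE)
    show "AE y in lborel. (\<integral>\<^sup>+x. u (x, y) * indicator ?I x \<partial>lborel) * indicator J y \<le> emeasure lborel ?I * (?V y * indicator J y)"
      using ug unfolding upper_gradient_x_def
    proof eventually_elim
      case (elim y)
      show ?case
      proof (cases "y \<in> J")
        case True
        then obtain a where a: "a \<in> ?I" "u (a, y) = 0" using zero by blast
        have "(\<integral>\<^sup>+x. u (x, y) * indicator ?I x \<partial>lborel) \<le> (\<integral>\<^sup>+x. ?V y * indicator ?I x \<partial>lborel)"
        proof (rule nn_integral_mono)
          fix x
          show "u (x, y) * indicator ?I x \<le> ?V y * indicator ?I x"
          proof (cases "x \<in> ?I")
            case True
            have "u (x, y) \<le> u (a, y) + ?V y" using elim a(1) True by blast
            then show ?thesis using True a(2) by simp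
          qed simp
        qed
        also have "\<dots> = emeasure lborel ?I * ?V y" by (subst nn_integral_cmult) (simp_all add: mult.commute)
        finally show ?thesis using True by simp
      qed simp
    qed
  qed
  also have "\<dots> = emeasure lborel ?I * (\<integral>\<^sup>+y. ?V y * indicator J y \<partial>lborel)"
    by (rule nn_integral_cmult) measurable
  also have "(\<integral>\<^sup>+y. ?V y * indicator J y \<partial>lborel) = (\<integral>\<^sup>+p. V p * indicator (?I \<times> J) p \<partial>lborel)"
    by (rule nn_integral_rect[symmetric]) measurable
  finally show ?thesis .
qed

lemma ennreal_mult_left_cancel_le:
  "0 < c \<Longrightarrow> ennreal c * x \<le> ennreal c * y \<Longrightarrow> x \<le> y"
  by (subst (asm) ennreal_mult_le_mult_iff) auto

definition square :: "real \<times> real \<Rightarrow> real \<Rightarrow> (real \<times> real) set" where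
  "square z r = {fst z - r..fst z + r} \<times> {snd z - r..snd z + r}"

lemma square_borel [measurable]: "square z r \<in> sets borel"
  unfolding square_def by (intro sets_borel_Times) auto

text \<open>One average comparison for each coordinate. The factor 4 is the ratio of the areas; the
  error \<open>6 * r\<close> consists of \<open>2 * r\<close> from the first coordinate and twice
  \<open>2 * r\<close> from the second.\<close>

lemma square_halving:
  assumes [measurable]: "u \<in> borel_measurable borel" "V \<in> borel_measurable borel"
    and ux: "upper_gradient_x u V" and uy: "upper_gradient_x (swap_args u) (swap_args V)" and r: "r > 0"
  shows "(\<integral>\<^sup>+p. u p * indicator (square z r) p \<partial>lborel)
    \<le> 4 * (\<integral>\<^sup>+p. u p * indicator (square z (r/2)) p \<partial>lborel) + ennreal (6 * r) * (\<integral>\<^sup>+p. V p * indicator (square z r) p \<partial>lborel)"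
proof -
  obtain a b where z: "z = (a, b)" by force
  let ?I = "{a-r..a+r}" and ?I' = "{a-r/2..a+r/2}" and ?J = "{b-r..b+r}" and ?J' = "{b-r/2..b+r/2}"
  let ?u = "\<lambda>S. \<integral>\<^sup>+p. u p * indicator S p \<partial>lborel" and ?V = "\<lambda>S. \<integral>\<^sup>+p. V p * indicator S p \<partial>lborel"
  have e: "emeasure lborel ?I = ennreal (2*r)" "emeasure lborel ?J = ennreal (2*r)"
     "emeasure lborel ?I' = ennreal r" "emeasure lborel ?J' = ennreal r" using r by auto
  have dbl: "ennreal (2*r) = ennreal r * 2" using r by (simp add: ennreal_mult mult.commute)
  have 1: "?u (?I \<times> ?J) \<le> 2 * ?u (?I' \<times> ?J) + ennreal (2*r) * ?V (?I \<times> ?J)"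
  proof (rule ennreal_mult_left_cancel_le[OF r])
    have "ennreal r * ?u (?I \<times> ?J) \<le> ennreal (2*r) * ?u (?I' \<times> ?J) + ennreal (2*r) * (ennreal r * ?V (?I \<times> ?J))"
      using upper_gradient_x_average[OF assms(1,2) _ _ ux, of ?I' ?J "a-r" "a+r"] r by (simp add: e)
    then show "ennreal r * ?u (?I \<times> ?J) \<le> ennreal r * (2 * ?u (?I' \<times> ?J) + ennreal (2*r) * ?V (?I \<times> ?J))"
      by (simp only: dbl distrib_left mult.assoc mult.left_commute)
  qed
  have 2: "?u (?I' \<times> ?J) \<le> 2 * ?u (?I' \<times> ?J') + ennreal (2*r) * ?V (?I' \<times> ?J)"
  proof (rule ennreal_mult_left_cancel_le[OF r])
    have "ennreal r * ?u (?I' \<times> ?J) \<le> ennreal (2*r) * ?u (?I' \<times> ?J') + ennreal (2*r) * (ennreal r * ?V (?I' \<times> ?J))"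
      using upper_gradient_y_average[OF assms(1,2) _ _ uy, of ?J' ?I' "b-r" "b+r"] r by (simp add: e)
    then show "ennreal r * ?u (?I' \<times> ?J) \<le> ennreal r * (2 * ?u (?I' \<times> ?J') + ennreal (2*r) * ?V (?I' \<times> ?J))"
      by (simp only: dbl distrib_left mult.assoc mult.left_commute)
  qed
  have 3: "?V (?I' \<times> ?J) \<le> ?V (?I \<times> ?J)"
    using r by (intro nn_integral_mono mult_left_mono) (auto simp: indicator_def)
  have "?u (?I \<times> ?J) \<le> 2 * (2 * ?u (?I' \<times> ?J') + ennreal (2*r) * ?V (?I' \<times> ?J)) + ennreal (2*r) * ?V (?I \<times> ?J)"
    using 1 2 by (meson add_right_mono mult_left_mono order_trans zero_le)
  also have "\<dots> \<le> 2 * (2 * ?u (?I' \<times> ?J') + ennreal (2*r) * ?V (?I \<times> ?J)) + ennreal (2*r) * ?V (?I \<times> ?J)"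
    using 3 by (intro add_right_mono mult_left_mono add_left_mono) auto
  also have "\<dots> = 4 * ?u (?I' \<times> ?J') + (2 * ennreal (2*r) + ennreal (2*r)) * ?V (?I \<times> ?J)"
    by (simp add: distrib_left distrib_right add.assoc mult.assoc[symmetric])
  also have "2 * ennreal (2*r) + ennreal (2*r) = ennreal (6*r)"
  proof -
    have "2 * ennreal (2*r) = ennreal (4*r)" using r by (simp add: ennreal_mult[symmetric] flip: ennreal_numeral)
    then show ?thesis using r by (simp add: ennreal_plus[symmetric] del: ennreal_plus)
  qed
  finally show ?thesis by (simp add: square_def z)
qed

text \<open>Only the lines in one half of the square are known to meet a zero. The zero bound holds
  on that half, and averaging in the other direction carries it to the whole square: twice
  \<open>2 * r\<close> plus \<open>2 * r\<close> gives \<open>6 * r\<close>.\<close>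

lemma square_zero_x:
  assumes [measurable]: "u \<in> borel_measurable borel" "V \<in> borel_measurable borel"
    and ux: "upper_gradient_x u V" and uy: "upper_gradient_x (swap_args u) (swap_args V)" and r: "r > 0"
    and J: "y0 = b \<or> y0 = b - r" and zero: "\<And>y. y \<in> {y0..y0+r} \<Longrightarrow> \<exists>x\<in>{a-r..a+r}. u (x, y) = 0"
  shows "(\<integral>\<^sup>+p. u p * indicator (square (a, b) r) p \<partial>lborel)
    \<le> ennreal (6 * r) * (\<integral>\<^sup>+p. V p * indicator (square (a, b) r) p \<partial>lborel)"
proof -
  let ?I = "{a-r..a+r}" and ?J = "{b-r..b+r}" and ?J' = "{y0..y0+r}"
  let ?u = "\<lambda>S. \<integral>\<^sup>+p. u p * indicator S p \<partial>lborel" and ?V = "\<lambda>S. \<integral>\<^sup>+p. V p * indicator S p \<partial>lborel"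
  have e: "emeasure lborel ?I = ennreal (2*r)" "emeasure lborel ?J = ennreal (2*r)" "emeasure lborel ?J' = ennreal r"
    using r by auto
  have sub: "?J' \<subseteq> ?J" using J r by auto
  have 1: "?u (?I \<times> ?J') \<le> ennreal (2*r) * ?V (?I \<times> ?J')"
    using upper_gradient_x_zero[OF assms(1,2) _ ux, of ?J' "a-r" "a+r"] zero by (simp add: e)
  have 2: "?V (?I \<times> ?J') \<le> ?V (?I \<times> ?J)"
    using sub by (intro nn_integral_mono mult_left_mono) (auto simp: indicator_def)
  have 12: "?u (?I \<times> ?J') \<le> ennreal (2*r) * ?V (?I \<times> ?J)"
    using 1 2 by (meson mult_left_mono order_trans zero_le)
  have "?u (?I \<times> ?J) \<le> ennreal (6 * r) * ?V (?I \<times> ?J)"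
  proof (rule ennreal_mult_left_cancel_le[OF r])
    have "ennreal r * ?u (?I \<times> ?J) \<le> ennreal (2*r) * ?u (?I \<times> ?J') + ennreal (2*r) * (ennreal r * ?V (?I \<times> ?J))"
      using upper_gradient_y_average[OF assms(1,2) _ _ uy, of ?J' ?I "b-r" "b+r"] sub by (simp add: e)
    also have "\<dots> \<le> ennreal (2*r) * (ennreal (2*r) * ?V (?I \<times> ?J)) + ennreal (2*r) * (ennreal r * ?V (?I \<times> ?J))"
      by (intro add_right_mono mult_left_mono 12) simp
    also have "\<dots> = ennreal (6 * r * r) * ?V (?I \<times> ?J)"
    proof -
      have "ennreal (2*r) * ennreal (2*r) + ennreal (2*r) * ennreal r = ennreal (6 * r * r)"
        using r by (simp add: ennreal_mult[symmetric] ennreal_plus[symmetric] del: ennreal_plus)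
      then show ?thesis by (simp add: distrib_right[symmetric] mult.assoc[symmetric])
    qed
    also have "\<dots> = ennreal r * (ennreal (6 * r) * ?V (?I \<times> ?J))"
      using r by (simp add: mult.assoc[symmetric] ennreal_mult[symmetric] mult.commute)
    finally show "ennreal r * ?u (?I \<times> ?J) \<le> ennreal r * (ennreal (6 * r) * ?V (?I \<times> ?J))" .
  qed
  then show ?thesis by (simp add: square_def)
qed

lemma square_zero_y:
  assumes [measurable]: "u \<in> borel_measurable borel" "V \<in> borel_measurable borel"
    and ux: "upper_gradient_x u V" and uy: "upper_gradient_x (swap_args u) (swap_args V)" and r: "r > 0"
    and J: "x0 = a \<or> x0 = a - r" and zero: "\<And>x. x \<in> {x0..x0+r} \<Longrightarrow> \<exists>y\<in>{b-r..b+r}. u (x, y) = 0"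
  shows "(\<integral>\<^sup>+p. u p * indicator (square (a, b) r) p \<partial>lborel)
    \<le> ennreal (6 * r) * (\<integral>\<^sup>+p. V p * indicator (square (a, b) r) p \<partial>lborel)"
proof -
  have "(\<integral>\<^sup>+p. swap_args u p * indicator (square (b, a) r) p \<partial>lborel)
    \<le> ennreal (6 * r) * (\<integral>\<^sup>+p. swap_args V p * indicator (square (b, a) r) p \<partial>lborel)"
    by (rule square_zero_x[OF _ _ uy _ r J]) (use ux zero in auto)
  then show ?thesis
    unfolding square_def fst_conv snd_conv
      nn_integral_rect_swap[OF assms(1) atLeastAtMost_borel atLeastAtMost_borel]
      nn_integral_rect_swap[OF assms(2) atLeastAtMost_borel atLeastAtMost_borel] .
qed

text \<open>Until the sup-norm distance from (a, b) first reaches \<open>r\<close>, the path stays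
  in the square. At that time one coordinate has moved by exactly \<open>r\<close>, so by the
  intermediate value theorem it has run through a whole half-side.\<close>

lemma path_crossing_square:
  fixes \<gamma> :: "real \<Rightarrow> real \<times> real"
  assumes cont: "continuous_on {0..1} \<gamma>" and start: "\<gamma> 0 = (a, b)" and r: "r > 0"
    and far: "r \<le> max \<bar>fst (\<gamma> 1) - a\<bar> \<bar>snd (\<gamma> 1) - b\<bar>"
  shows "(\<exists>y0. (y0 = b \<or> y0 = b - r) \<and> (\<forall>y\<in>{y0..y0+r}. \<exists>s\<in>{0..1}. snd (\<gamma> s) = y \<and> fst (\<gamma> s) \<in> {a-r..a+r})) \<or>
    (\<exists>x0. (x0 = a \<or> x0 = a - r) \<and> (\<forall>x\<in>{x0..x0+r}. \<exists>s\<in>{0..1}. fst (\<gamma> s) = x \<and> snd (\<gamma> s) \<in> {b-r..b+r}))"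
proof -
  define d where "d = (\<lambda>s. max \<bar>fst (\<gamma> s) - a\<bar> \<bar>snd (\<gamma> s) - b\<bar>)"
  have cd: "continuous_on {0..1} d" unfolding d_def by (intro continuous_intros cont)
  have d0: "d 0 = 0" using start by (simp add: d_def)
  have "\<exists>s\<ge>0. s \<le> 1 \<and> d s = r" by (rule IVT') (use d0 far r cd in \<open>auto simp: d_def\<close>)
  moreover have "compact {s \<in> {0..1}. d s = r}"
  proof -
    have "closed {s \<in> {0..1}. d s = r}" by (rule continuous_closed_preimage_constant) (use cd in auto)
    then have "compact ({0..1} \<inter> {s \<in> {0..1}. d s = r})" by (intro compact_Int_closed) auto
    then show ?thesis by (simp add: Int_def conj_commute cong: conj_cong)
  qed
  ultimately obtain s1 where s1: "s1 \<in> {0..1}" "d s1 = r" "\<And>s. s \<in> {0..1} \<Longrightarrow> d s = r \<Longrightarrow> s1 \<le> s"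
    using compact_attains_inf[of "{s \<in> {0..1}. d s = r}"] by auto
  have le: "d s \<le> r" if "s \<in> {0..s1}" for s
  proof (rule ccontr)
    assume "\<not> d s \<le> r"
    then have "\<exists>x\<ge>0. x \<le> s \<and> d x = r"
      by (intro IVT') (use d0 r that s1 in \<open>auto intro: continuous_on_subset[OF cd]\<close>)
    then obtain x where "0 \<le> x" "x \<le> s" "d x = r" by blast
    then have "s1 \<le> x" using s1 that by auto
    then have "x = s1" "s = s1" using \<open>x \<le> s\<close> that by auto
    then show False using \<open>\<not> d s \<le> r\<close> s1 by simp
  qed
  have cc: "continuous_on {0..s1} (\<lambda>s. fst (\<gamma> s))" "continuous_on {0..s1} (\<lambda>s. snd (\<gamma> s))"
    using s1 by (auto intro!: continuous_intros continuous_on_subset[OF cont])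
  have box: "fst (\<gamma> s) \<in> {a-r..a+r} \<and> snd (\<gamma> s) \<in> {b-r..b+r}" if "s \<in> {0..s1}" for s
    using le[OF that] by (auto simp: d_def abs_le_iff)
  have ivt: "\<exists>s\<in>{0..s1}. g s = y" if g: "continuous_on {0..s1} g" and y: "y \<in> {g 0..g s1} \<or> y \<in> {g s1..g 0}" for g :: "real \<Rightarrow> real" and y
    using y
  proof
    assume "y \<in> {g 0..g s1}"
    then have "\<exists>x\<ge>0. x \<le> s1 \<and> g x = y" by (intro IVT') (use s1 g in auto)
    then show ?thesis by auto
  next
    assume "y \<in> {g s1..g 0}"
    then have "\<exists>x\<ge>0. x \<le> s1 \<and> g x = y" by (intro IVT2') (use s1 g in auto)
    then show ?thesis by auto
  qed
  have sub: "s \<in> {0..1}" if "s \<in> {0..s1}" for s using that s1 by auto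
  consider "snd (\<gamma> s1) = b + r" | "snd (\<gamma> s1) = b - r" | "fst (\<gamma> s1) = a + r" | "fst (\<gamma> s1) = a - r"
    using s1(2) unfolding d_def by linarith
  then show ?thesis
  proof cases
    case 1
    have "\<exists>s\<in>{0..1}. snd (\<gamma> s) = y \<and> fst (\<gamma> s) \<in> {a-r..a+r}" if "y \<in> {b..b+r}" for y
    proof -
      have "\<exists>s\<in>{0..s1}. snd (\<gamma> s) = y" by (rule ivt[OF cc(2)]) (use that 1 start in auto)
      then obtain s where "s \<in> {0..s1}" "snd (\<gamma> s) = y" by blast
      then show ?thesis using box[of s] sub[of s] by blast
    qed
    then show ?thesis by blast
  next
    case 2
    have "\<exists>s\<in>{0..1}. snd (\<gamma> s) = y \<and> fst (\<gamma> s) \<in> {a-r..a+r}" if "y \<in> {b-r..b-r+r}" for y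
    proof -
      have "\<exists>s\<in>{0..s1}. snd (\<gamma> s) = y" by (rule ivt[OF cc(2)]) (use that 2 start in auto)
      then obtain s where "s \<in> {0..s1}" "snd (\<gamma> s) = y" by blast
      then show ?thesis using box[of s] sub[of s] by blast
    qed
    then show ?thesis by blast
  next
    case 3
    have "\<exists>s\<in>{0..1}. fst (\<gamma> s) = x \<and> snd (\<gamma> s) \<in> {b-r..b+r}" if "x \<in> {a..a+r}" for x
    proof -
      have "\<exists>s\<in>{0..s1}. fst (\<gamma> s) = x" by (rule ivt[OF cc(1)]) (use that 3 start in auto)
      then obtain s where "s \<in> {0..s1}" "fst (\<gamma> s) = x" by blast
      then show ?thesis using box[of s] sub[of s] by blast
    qed
    then show ?thesis by blast
  next
    case 4
    have "\<exists>s\<in>{0..1}. fst (\<gamma> s) = x \<and> snd (\<gamma> s) \<in> {b-r..b+r}" if "x \<in> {a-r..a-r+r}" for x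
    proof -
      have "\<exists>s\<in>{0..s1}. fst (\<gamma> s) = x" by (rule ivt[OF cc(1)]) (use that 4 start in auto)
      then obtain s where "s \<in> {0..s1}" "fst (\<gamma> s) = x" by blast
      then show ?thesis using box[of s] sub[of s] by blast
    qed
    then show ?thesis by blast
  qed
qed

text \<open>Brings \<open>ln_max_upper_gradient\<close> into the form of
  \<open>upper_gradient_x\<close>. As \<open>m \<ge> t\<close>, the logarithm of
  \<open>m / t\<close> is nonnegative and survives the passage to \<open>ennreal\<close>.\<close>

lemma ln_max_line_bound:
  fixes \<phi> :: "real \<Rightarrow> complex" and G :: "real \<Rightarrow> ennreal"
  defines "m \<equiv> \<lambda>w t x. max (norm (\<phi> x - w)) t"
  assumes cont: "continuous_on UNIV \<phi>" and G [measurable]: "G \<in> borel_measurable borel" and t: "t > 0"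
    and ub: "\<And>a b. a \<le> b \<Longrightarrow> ennreal (norm (\<phi> b - \<phi> a)) \<le> (\<integral>\<^sup>+x. G x * indicator {a..b} x \<partial>lborel)"
    and ab: "a \<in> {c..d}" "b \<in> {c..d}"
  shows "ennreal (ln (m w t b / t)) \<le> ennreal (ln (m w t a / t)) + (\<integral>\<^sup>+x. G x * ennreal (2 / m w t x) * indicator {c..d} x \<partial>lborel)"
proof -
  have pos: "m w t x > 0" for x using t by (simp add: m_def less_max_iff_disj)
  have lnd: "ennreal \<bar>ln (m w t b) - ln (m w t a)\<bar> \<le> (\<integral>\<^sup>+x. G x * ennreal (2 / m w t x) * indicator {a..b} x \<partial>lborel)"
    if "a \<le> b" for a b
    unfolding m_def by (rule ln_max_upper_gradient[OF cont G t ub that])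
  have "ennreal \<bar>ln (m w t b) - ln (m w t a)\<bar> \<le> (\<integral>\<^sup>+x. G x * ennreal (2 / m w t x) * indicator {min a b..max a b} x \<partial>lborel)"
  proof (cases "a \<le> b")
    case True
    then show ?thesis using lnd[OF True] by simp
  next
    case False
    then have "b \<le> a" by simp
    from lnd[OF this] show ?thesis using False by (simp add: abs_minus_commute)
  qed
  also have "\<dots> \<le> (\<integral>\<^sup>+x. G x * ennreal (2 / m w t x) * indicator {c..d} x \<partial>lborel)"
    using ab by (intro nn_integral_mono mult_left_mono) (auto simp: indicator_def)
  finally have le: "ennreal \<bar>ln (m w t b) - ln (m w t a)\<bar>
    \<le> (\<integral>\<^sup>+x. G x * ennreal (2 / m w t x) * indicator {c..d} x \<partial>lborel)" .
  have nn: "0 \<le> ln (m w t a / t)" using t by (intro ln_ge_zero) (simp add: m_def)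
  have "ln (m w t x / t) = ln (m w t x) - ln t" for x
    using t pos[of x] by (simp add: ln_div)
  then have "ln (m w t b / t) \<le> ln (m w t a / t) + \<bar>ln (m w t b) - ln (m w t a)\<bar>" by simp
  then have "ennreal (ln (m w t b / t)) \<le> ennreal (ln (m w t a / t) + \<bar>ln (m w t b) - ln (m w t a)\<bar>)"
    by (rule ennreal_leI)
  also have "\<dots> = ennreal (ln (m w t a / t)) + ennreal \<bar>ln (m w t b) - ln (m w t a)\<bar>"
    by (rule ennreal_plus) (use nn in simp_all)
  also have "\<dots> \<le> ennreal (ln (m w t a / t)) + (\<integral>\<^sup>+x. G x * ennreal (2 / m w t x) * indicator {c..d} x \<partial>lborel)"
    using le by (rule add_left_mono)
  finally show ?thesis .
qed

text \<open>The distortion inequality is stated for the two partial derivatives, which the operator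
  norm dominates. The local integrability assumptions are those of
  \<open>nn_integral_jac_le\<close>.\<close>

locale distortion_map = acl_homeo +
  fixes K :: "real \<times> real \<Rightarrow> real"
  assumes K_measurable [measurable]: "K \<in> borel_measurable borel" and K_ge_1: "1 \<le> K p"
    and distortion: "AE p in lborel. (norm (gx p))\<^sup>2 \<le> K p * jac p \<and> (norm (gy p))\<^sup>2 \<le> K p * jac p"
    and locx: "(\<integral>\<^sup>+p. ennreal (norm (gx p)) * indicator (ball 0 R) p \<partial>lborel) < \<infinity>"
    and locy: "(\<integral>\<^sup>+p. ennreal (norm (gy p)) * indicator (ball 0 R) p \<partial>lborel) < \<infinity>"
    and locj: "(\<integral>\<^sup>+p. ennreal (norm (jac p)) * indicator (ball 0 R) p \<partial>lborel) < \<infinity>"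
begin

section \<open>The truncated logarithm and its multiscale bound\<close>

definition trunc_dist :: "complex \<Rightarrow> real \<Rightarrow> real \<times> real \<Rightarrow> real" where
  "trunc_dist w t p = max (norm (F p - w)) t"

definition log_dist :: "complex \<Rightarrow> real \<Rightarrow> real \<times> real \<Rightarrow> ennreal" where
  "log_dist w t p = ennreal (ln (trunc_dist w t p / t))"

text \<open>An upper gradient of \<open>log_dist\<close> in both coordinate directions at once; the
  factor 2 is that of \<open>ln_max_upper_gradient\<close>.\<close>

definition log_grad :: "complex \<Rightarrow> real \<Rightarrow> real \<times> real \<Rightarrow> ennreal" where
  "log_grad w t p = ennreal (norm (gx p) + norm (gy p)) * ennreal (2 / trunc_dist w t p)"

lemma trunc_dist_measurable [measurable]: "trunc_dist w t \<in> borel_measurable borel"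
  unfolding trunc_dist_def by measurable

lemma log_dist_measurable [measurable]: "log_dist w t \<in> borel_measurable borel"
  unfolding log_dist_def by measurable

lemma log_grad_measurable [measurable]: "log_grad w t \<in> borel_measurable borel"
  unfolding log_grad_def by measurable

lemma trunc_dist_pos: "t > 0 \<Longrightarrow> trunc_dist w t p > 0"
  by (simp add: trunc_dist_def less_max_iff_disj)

lemma upper_gradient_log_dist_x:
  assumes t: "t > 0"
  shows "upper_gradient_x (log_dist w t) (log_grad w t)"
  unfolding upper_gradient_x_def
  using acl_x
proof eventually_elim
  case (elim y)
  define G where "G = (\<lambda>x. ennreal (norm (gx (x, y)) + norm (gy (x, y))))"
  have [measurable]: "G \<in> borel_measurable borel" unfolding G_def by measurable
  have ub: "ennreal (norm (F (b, y) - F (a, y))) \<le> (\<integral>\<^sup>+x. G x * indicator {a..b} x \<partial>lborel)" if "a \<le> b" for a b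
  proof -
    have "ennreal (norm (F (b, y) - F (a, y) - (b - a) *\<^sub>R 0)) \<le> (\<integral>\<^sup>+x. ennreal (norm (gx (x, y) - 0)) * indicator {a..b} x \<partial>lborel)"
      using elim that by blast
    also have "\<dots> \<le> (\<integral>\<^sup>+x. G x * indicator {a..b} x \<partial>lborel)"
      unfolding G_def by (intro nn_integral_mono mult_right_mono ennreal_leI) auto
    finally show ?thesis by simp
  qed
  have c: "continuous_on UNIV (\<lambda>x. F (x, y))"
    by (rule continuous_on_compose2[OF contF[of UNIV]]) (auto intro!: continuous_intros)
  show ?case
    using ln_max_line_bound[OF c _ t ub] unfolding log_dist_def trunc_dist_def log_grad_def G_def by simp
qed

lemma upper_gradient_log_dist_y:
  assumes t: "t > 0"
  shows "upper_gradient_x (swap_args (log_dist w t)) (swap_args (log_grad w t))"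
  unfolding upper_gradient_x_def fst_conv snd_conv
  using acl_y
proof eventually_elim
  case (elim y)
  define G where "G = (\<lambda>x. ennreal (norm (gx (y, x)) + norm (gy (y, x))))"
  have [measurable]: "G \<in> borel_measurable borel" unfolding G_def by measurable
  have ub: "ennreal (norm (F (y, b) - F (y, a))) \<le> (\<integral>\<^sup>+x. G x * indicator {a..b} x \<partial>lborel)" if "a \<le> b" for a b
  proof -
    have "ennreal (norm (F (y, b) - F (y, a) - (b - a) *\<^sub>R 0)) \<le> (\<integral>\<^sup>+x. ennreal (norm (gy (y, x) - 0)) * indicator {a..b} x \<partial>lborel)"
      using elim that by blast
    also have "\<dots> \<le> (\<integral>\<^sup>+x. G x * indicator {a..b} x \<partial>lborel)"
      unfolding G_def by (intro nn_integral_mono mult_right_mono ennreal_leI) auto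
    finally show ?thesis by simp
  qed
  have c: "continuous_on UNIV (\<lambda>x. F (y, x))"
    by (rule continuous_on_compose2[OF contF[of UNIV]]) (auto intro!: continuous_intros)
  show ?case
    using ln_max_line_bound[OF c _ t ub] unfolding log_dist_def trunc_dist_def log_grad_def G_def by simp
qed

text \<open>\<open>log_dist\<close> vanishes on the preimage of the segment from \<open>F z\<close> to \<open>F q\<close>, which crosses the square.\<close>

lemma log_dist_innermost_square:
  assumes t: "t = norm (F q - F z)" "t > 0" and r: "r > 0" "r \<le> max \<bar>fst q - fst z\<bar> \<bar>snd q - snd z\<bar>"
  shows "(\<integral>\<^sup>+p. log_dist (F z) t p * indicator (square z r) p \<partial>lborel)
    \<le> ennreal (6 * r) * (\<integral>\<^sup>+p. log_grad (F z) t p * indicator (square z r) p \<partial>lborel)"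
proof -
  obtain a b where z: "z = (a, b)" by force
  define \<gamma> where "\<gamma> = (\<lambda>s. Fi (F z + s *\<^sub>R (F q - F z)))"
  have c\<gamma>: "continuous_on {0..1} \<gamma>"
    unfolding \<gamma>_def by (rule continuous_on_compose2[OF contFi[of UNIV]]) (auto intro!: continuous_intros)
  have \<gamma>01: "\<gamma> 0 = (a, b)" "\<gamma> 1 = q" by (simp_all add: \<gamma>_def z)
  have zero: "log_dist (F z) t (\<gamma> s) = 0" if "s \<in> {0..1}" for s
  proof -
    have "norm (F (\<gamma> s) - F z) = s * t" using that by (simp add: \<gamma>_def t)
    also have "\<dots> \<le> t" using that t(2) by (simp add: mult_left_le_one_le)
    finally have "trunc_dist (F z) t (\<gamma> s) = t" by (simp add: trunc_dist_def)
    then show ?thesis using t(2) by (simp add: log_dist_def)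
  qed
  have far: "r \<le> max \<bar>fst (\<gamma> 1) - a\<bar> \<bar>snd (\<gamma> 1) - b\<bar>" using r(2) by (simp add: \<gamma>01 z)
  note ugs = upper_gradient_log_dist_x[OF t(2), of "F z"] upper_gradient_log_dist_y[OF t(2), of "F z"]
  have "(\<integral>\<^sup>+p. log_dist (F z) t p * indicator (square (a, b) r) p \<partial>lborel)
    \<le> ennreal (6 * r) * (\<integral>\<^sup>+p. log_grad (F z) t p * indicator (square (a, b) r) p \<partial>lborel)"
    using path_crossing_square[OF c\<gamma> \<gamma>01(1) r(1) far]
  proof
    assume "\<exists>y0. (y0 = b \<or> y0 = b - r) \<and> (\<forall>y\<in>{y0..y0+r}. \<exists>s\<in>{0..1}. snd (\<gamma> s) = y \<and> fst (\<gamma> s) \<in> {a-r..a+r})"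
    then obtain y0 where y0: "y0 = b \<or> y0 = b - r"
      "\<forall>y\<in>{y0..y0+r}. \<exists>s\<in>{0..1}. snd (\<gamma> s) = y \<and> fst (\<gamma> s) \<in> {a-r..a+r}" by blast
    have hit: "\<exists>x\<in>{a-r..a+r}. log_dist (F z) t (x, y) = 0" if y: "y \<in> {y0..y0+r}" for y
    proof -
      obtain s where s: "s \<in> {0..1}" "snd (\<gamma> s) = y" "fst (\<gamma> s) \<in> {a-r..a+r}" using y0(2) y by blast
      have "(fst (\<gamma> s), y) = \<gamma> s" using s(2) by (simp add: prod_eq_iff)
      then have "log_dist (F z) t (fst (\<gamma> s), y) = 0" using zero[OF s(1)] by simp
      then show ?thesis using s(3) by blast
    qed
    show ?thesis by (rule square_zero_x[OF _ _ ugs r(1) y0(1) hit]) measurable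
  next
    assume "\<exists>x0. (x0 = a \<or> x0 = a - r) \<and> (\<forall>x\<in>{x0..x0+r}. \<exists>s\<in>{0..1}. fst (\<gamma> s) = x \<and> snd (\<gamma> s) \<in> {b-r..b+r})"
    then obtain x0 where x0: "x0 = a \<or> x0 = a - r"
      "\<forall>x\<in>{x0..x0+r}. \<exists>s\<in>{0..1}. fst (\<gamma> s) = x \<and> snd (\<gamma> s) \<in> {b-r..b+r}" by blast
    have hit: "\<exists>y\<in>{b-r..b+r}. log_dist (F z) t (x, y) = 0" if x: "x \<in> {x0..x0+r}" for x
    proof -
      obtain s where s: "s \<in> {0..1}" "fst (\<gamma> s) = x" "snd (\<gamma> s) \<in> {b-r..b+r}" using x0(2) x by blast
      have "(x, snd (\<gamma> s)) = \<gamma> s" using s(2) by (simp add: prod_eq_iff)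
      then have "log_dist (F z) t (x, snd (\<gamma> s)) = 0" using zero[OF s(1)] by simp
      then show ?thesis using s(3) by blast
    qed
    show ?thesis by (rule square_zero_y[OF _ _ ugs r(1) x0(1) hit]) measurable
  qed
  then show ?thesis by (simp only: z)
qed

text \<open>Iterates \<open>square_halving\<close>: after \<open>k\<close> steps the accumulated
  factor is \<open>4^k\<close>, and the error constant at half-side \<open>1/2^k\<close> is
  \<open>6 / 2^k\<close>, so scale \<open>k\<close> gets the weight \<open>6 * 2^k\<close>. At scale
  \<open>n\<close> the zeros of \<open>log_dist\<close> take care of the remaining integral.\<close>

lemma log_dist_multiscale:
  assumes t: "t = norm (F q - F z)" "t > 0" and far: "1/2^n \<le> max \<bar>fst q - fst z\<bar> \<bar>snd q - snd z\<bar>"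
  shows "(\<integral>\<^sup>+p. log_dist (F z) t p * indicator (square z 1) p \<partial>lborel)
    \<le> (\<Sum>j\<le>n. ennreal (6 * 2^j) * (\<integral>\<^sup>+p. log_grad (F z) t p * indicator (square z (1/2^j)) p \<partial>lborel))"
proof -
  let ?U = "\<lambda>j. \<integral>\<^sup>+p. log_dist (F z) t p * indicator (square z (1/2^j)) p \<partial>lborel"
  let ?V = "\<lambda>j. \<integral>\<^sup>+p. log_grad (F z) t p * indicator (square z (1/2^j)) p \<partial>lborel"
  note ugs = upper_gradient_log_dist_x[OF t(2), of "F z"] upper_gradient_log_dist_y[OF t(2), of "F z"]
  have c: "ennreal (4^k) * ennreal (6 * (1/2^k)) = ennreal (6 * 2^k)" for k :: nat
  proof -
    have "(4::real)^k = 2^k * 2^k" by (simp flip: power_mult_distrib)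
    then show ?thesis by (subst ennreal_mult[symmetric]) simp_all
  qed
  have ind: "?U 0 \<le> ennreal (4^k) * ?U k + (\<Sum>j<k. ennreal (6 * 2^j) * ?V j)" for k
  proof (induction k)
    case (Suc k)
    have half: "?U k \<le> 4 * ?U (Suc k) + ennreal (6 * (1/2^k)) * ?V k"
      using square_halving[OF log_dist_measurable log_grad_measurable ugs, where r="1/2^k" and z=z] by (simp add: mult.commute)
    have "?U 0 \<le> ennreal (4^k) * (4 * ?U (Suc k) + ennreal (6 * (1/2^k)) * ?V k) + (\<Sum>j<k. ennreal (6 * 2^j) * ?V j)"
      using Suc half by (meson add_right_mono mult_left_mono order_trans zero_le)
    also have "\<dots> = ennreal (4^Suc k) * ?U (Suc k) + (\<Sum>j<Suc k. ennreal (6 * 2^j) * ?V j)"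
    proof -
      have "ennreal (4^Suc k) = ennreal (4^k) * 4" by (simp add: ennreal_mult mult.commute)
      then show ?thesis by (simp only: distrib_left mult.assoc[symmetric] c sum.lessThan_Suc add_ac)
    qed
    finally show ?case .
  qed simp
  have "?U 0 \<le> ennreal (4^n) * (ennreal (6 * (1/2^n)) * ?V n) + (\<Sum>j<n. ennreal (6 * 2^j) * ?V j)"
    using ind[of n] log_dist_innermost_square[OF t _ far] by (meson add_right_mono mult_left_mono order_trans zero_le zero_less_divide_1_iff zero_less_numeral zero_less_power)
  also have "\<dots> = (\<Sum>j\<le>n. ennreal (6 * 2^j) * ?V j)"
    by (simp only: mult.assoc[symmetric] c lessThan_Suc_atMost[symmetric] sum.lessThan_Suc add_ac)
  finally show ?thesis by simp
qed

end

text \<open>A sum of distinct powers of 2 is at most twice its largest term, so squaring it costs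
  only a factor 4. Cauchy--Schwarz would cost a factor of order \<open>n\<close>, and the final
  bound would no longer be quadratic in the logarithm. The second conjunct drives the
  induction.\<close>

lemma sum_powers_sq_le:
  fixes s :: "nat \<Rightarrow> real"
  assumes s: "\<And>j. s j = 0 \<or> s j = 1"
  shows "(\<Sum>j\<le>n. 2^j * s j)\<^sup>2 \<le> 4 * (\<Sum>j\<le>n. 4^j * s j) \<and> (\<Sum>j\<le>n. 2^j * s j) \<le> 2 * 2^n"
proof (induction n)
  case 0
  show ?case using s[of 0] by auto
next
  case (Suc n)
  let ?w = "\<Sum>j\<le>n. 2^j * s j"
  have s0: "0 \<le> s j" for j using s[of j] by auto
  have nn: "0 \<le> ?w" "0 \<le> (\<Sum>j\<le>n. 4^j * s j)" by (intro sum_nonneg mult_nonneg_nonneg s0; simp)+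
  show ?case
  proof (cases "s (Suc n) = 1")
    case True
    have w: "?w + 2^Suc n \<le> 2 * 2^Suc n" using Suc by simp
    have "(?w + 2^Suc n)\<^sup>2 \<le> (2 * 2^Suc n)\<^sup>2" using w nn by (intro power_mono) auto
    also have "\<dots> = 4 * 4^Suc n" by (simp add: power2_eq_square flip: power_mult_distrib)
    also have "\<dots> \<le> 4 * ((\<Sum>j\<le>n. 4^j * s j) + 4^Suc n)" using nn by simp
    finally show ?thesis using True w by simp
  next
    case False
    then have z: "s (Suc n) = 0" using s by blast
    have "(2::real) * 2^n \<le> 2 * 2^Suc n" by simp
    then show ?thesis using Suc[THEN conjunct1] Suc[THEN conjunct2]
      unfolding sum.atMost_Suc z mult_zero_right add_0_right by (intro conjI; linarith)
  qed
qed

text \<open>Expand the square of \<open>2 * L * v - k * w\<close>. The weight \<open>L\<close>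
  shifts the burden between the Jacobian term \<open>j\<close> and the distortion term with
  \<open>k\<close>.\<close>

lemma Young_weighted:
  fixes v w k L j :: real
  assumes "L > 0" "k > 0" "v\<^sup>2 \<le> 16 * k * j"
  shows "v * w \<le> 16 * L * j + k * w\<^sup>2 / (4 * L)"
proof -
  have "0 \<le> (2 * L * v - k * w)\<^sup>2" by simp
  then have "4 * L * k * (v * w) \<le> 4 * L\<^sup>2 * v\<^sup>2 + k\<^sup>2 * w\<^sup>2"
    by (simp add: power2_diff power_mult_distrib algebra_simps)
  also have "\<dots> \<le> 4 * L\<^sup>2 * (16 * k * j) + k\<^sup>2 * w\<^sup>2"
    using assms(3) by (intro add_right_mono mult_left_mono) auto
  also have "\<dots> = 4 * L * k * (16 * L * j + k * w\<^sup>2 / (4 * L))"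
    using assms(1,2) by (simp add: power2_eq_square distrib_left)
  finally show ?thesis using assms(1,2) by (subst (asm) mult_le_cancel_left_pos) simp_all
qed

section \<open>Absorbing the Jacobian\<close>

context distortion_map
begin

lemma square_subset_sup:
  assumes "square z 1 \<noteq> {}"
  obtains B where "1 \<le> B" "\<And>p. p \<in> square z 1 \<Longrightarrow> norm (F p - F z) < B"
proof -
  have "compact (square z 1)" unfolding square_def by (intro compact_Times) auto
  then have "bounded ((\<lambda>p. F p - F z) ` square z 1)"
    by (intro compact_imp_bounded compact_continuous_image continuous_intros contF)
  then obtain b where "\<forall>x\<in>(\<lambda>p. F p - F z) ` square z 1. norm x \<le> b" unfolding bounded_iff by blast
  then have "norm (F p - F z) \<le> b" if "p \<in> square z 1" for p using that by blast
  then have "norm (F p - F z) < max 1 (b + 1)" if "p \<in> square z 1" for p using that by fastforce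
  then show ?thesis by (intro that[of "max 1 (b + 1)"]) simp_all
qed

text \<open>Dyadic annuli about \<open>F z\<close>: where the distance lies between
  \<open>2^j * t\<close> and \<open>2^(j+1) * t\<close>, the denominator is at least the square of
  the inner radius, and the area inequality bounds the integral of the Jacobian by a multiple of
  that square. Each annulus contributes a constant, and about \<open>log 2 (B / t)\<close> annuli
  are needed.\<close>

lemma nn_integral_jac_log_le:
  assumes t: "0 < t" "t < 1" and B: "1 \<le> B" "\<And>p. p \<in> Q \<Longrightarrow> norm (F p - F z) < B" and Q [measurable]: "Q \<in> sets borel"
  shows "(\<integral>\<^sup>+p. ennreal (jac p / (trunc_dist (F z) t p)\<^sup>2) * indicator Q p \<partial>lborel)
    \<le> ennreal (2048 * (2 * ln (B / t) + 1))"
proof -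
  define N where "N = nat \<lceil>log 2 (B / t)\<rceil>"
  have Bt: "1 < B / t" using t B by (simp add: less_divide_eq)
  then have l0: "0 < log 2 (B / t)" by simp
  have N1: "real N < log 2 (B / t) + 1" using l0 unfolding N_def by linarith
  have N2: "log 2 (B / t) \<le> real N" unfolding N_def by linarith
  have "B / t = 2 powr log 2 (B / t)" using Bt by simp
  also have "\<dots> \<le> 2 powr real N" using N2 by (intro powr_mono) auto
  finally have "B / t \<le> 2^N" by (simp add: powr_realpow)
  then have BN: "B \<le> 2^N * t" using t by (simp add: divide_le_eq)
  define G where "G = (\<lambda>j::nat. F -` ball (F z) (2^Suc j * t))"
  have oG: "open (G j)" for j unfolding G_def using contF by (intro open_vimage) auto
  \<comment> \<open>2048 is 128 from the area inequality, times 4 as a bound for \<open>pi\<close>,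
    times 4 because the outer radius is twice the inner one.\<close>
  have IG: "(\<integral>\<^sup>+p. ennreal (jac p) * indicator (G j) p \<partial>lborel) \<le> ennreal (2048 * (2^j * t)\<^sup>2)" for j
  proof -
    have "F ` G j = ball (F z) (2^Suc j * t)"
      unfolding G_def by (rule surj_image_vimage_eq) (rule surjI[of F Fi], rule FFi)
    then have "(\<integral>\<^sup>+p. ennreal (jac p) * indicator (G j) p \<partial>lborel) \<le> 128 * emeasure lborel (ball (F z) (2^Suc j * t))"
      using nn_integral_jac_le[OF locx locy locj oG[of j]] by simp
    also have "emeasure lborel (ball (F z) (2^Suc j * t)) = ennreal (pi * (2^Suc j * t)\<^sup>2)"
      using t by (subst emeasure_ball) (simp_all add: unit_ball_vol_2)
    also have "128 * ennreal (pi * (2^Suc j * t)\<^sup>2) = ennreal (128 * (pi * (2^Suc j * t)\<^sup>2))"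
      by (subst ennreal_mult) simp_all
    also have "\<dots> \<le> ennreal (128 * (4 * (2^Suc j * t)\<^sup>2))"
      using pi_less_4 by (intro ennreal_leI mult_left_mono mult_right_mono) auto
    also have "128 * (4 * (2^Suc j * t)\<^sup>2) = 2048 * (2^j * t)\<^sup>2" by (simp add: power_mult_distrib)
    finally show ?thesis .
  qed
  have [measurable]: "G j \<in> sets borel" for j using oG by simp
  have pt: "ennreal (jac p / (trunc_dist (F z) t p)\<^sup>2) * indicator Q p
    \<le> (\<Sum>j<N. ennreal (1 / (2^j * t)\<^sup>2) * (ennreal (jac p) * indicator (G j) p))" for p
  proof (cases "p \<in> Q \<and> 0 < jac p")
    case True
    define P where "P = (\<lambda>j. norm (F p - F z) < 2^j * t)"
    have "P N" using B(2)[of p] BN True by (simp add: P_def)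
    define k where "k = (LEAST j. P j)"
    have Pk: "P k" unfolding k_def by (rule LeastI[of P, OF \<open>P N\<close>])
    have kN: "k \<le> N" unfolding k_def by (rule Least_le[of P, OF \<open>P N\<close>])
    have Npos: "0 < N" using l0 by (simp add: N_def)
    \<comment> \<open>Subtraction of naturals: the case \<open>k = 0\<close>, where the distance is
      below \<open>t\<close>, joins the innermost ball, and there the truncation supplies the lower
      bound \<open>t\<close>.\<close>
    define j where "j = k - 1"
    have jN: "j < N" using kN Npos by (simp add: j_def)
    have pG: "p \<in> G j"
    proof -
      have "2^k * t \<le> 2^Suc j * t" using t by (intro mult_right_mono power_increasing) (auto simp: j_def)
      then show ?thesis using Pk by (simp add: P_def G_def dist_norm norm_minus_commute)
    qed
    have tr: "2^j * t \<le> trunc_dist (F z) t p"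
    proof (cases "k = 0")
      case True
      then show ?thesis by (simp add: j_def trunc_dist_def)
    next
      case False
      then have "\<not> P j" using not_less_Least[of j P] by (simp add: j_def k_def)
      then show ?thesis by (simp add: P_def trunc_dist_def)
    qed
    have "jac p / (trunc_dist (F z) t p)\<^sup>2 \<le> jac p / (2^j * t)\<^sup>2"
      using tr t True by (intro divide_left_mono power_mono mult_pos_pos zero_less_power trunc_dist_pos) auto
    then have "ennreal (jac p / (trunc_dist (F z) t p)\<^sup>2) * indicator Q p \<le> ennreal (1 / (2^j * t)\<^sup>2) * (ennreal (jac p) * indicator (G j) p)"
      using True pG t by (simp add: ennreal_mult[symmetric] ennreal_leI)
    also have "\<dots> \<le> (\<Sum>j<N. ennreal (1 / (2^j * t)\<^sup>2) * (ennreal (jac p) * indicator (G j) p))"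
      using jN by (intro member_le_sum) auto
    finally show ?thesis .
  next
    case False
    then consider "p \<notin> Q" | "jac p \<le> 0" by linarith
    then show ?thesis
    proof cases
      case 2
      then have "jac p / (trunc_dist (F z) t p)\<^sup>2 \<le> 0" by (simp add: divide_nonpos_nonneg)
      then show ?thesis by (simp add: ennreal_neg)
    qed simp
  qed
  have "(\<integral>\<^sup>+p. ennreal (jac p / (trunc_dist (F z) t p)\<^sup>2) * indicator Q p \<partial>lborel)
    \<le> (\<integral>\<^sup>+p. (\<Sum>j<N. ennreal (1 / (2^j * t)\<^sup>2) * (ennreal (jac p) * indicator (G j) p)) \<partial>lborel)"
    by (intro nn_integral_mono pt)
  also have "\<dots> = (\<Sum>j<N. ennreal (1 / (2^j * t)\<^sup>2) * (\<integral>\<^sup>+p. ennreal (jac p) * indicator (G j) p \<partial>lborel))"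
    by (subst nn_integral_sum) (auto intro!: sum.cong nn_integral_cmult)
  also have "\<dots> \<le> (\<Sum>j<N. ennreal (1 / (2^j * t)\<^sup>2) * ennreal (2048 * (2^j * t)\<^sup>2))"
    by (intro sum_mono mult_left_mono IG) auto
  also have "\<dots> = (\<Sum>j<N. ennreal 2048)"
    using t by (intro sum.cong refl, subst ennreal_mult[symmetric]) auto
  also have "\<dots> = ennreal (2048 * real N)" by (subst sum_ennreal) simp_all
  also have "\<dots> \<le> ennreal (2048 * (2 * ln (B / t) + 1))"
  proof (intro ennreal_leI mult_left_mono)
    have "(1/2::real) \<le> ln 2" using ln_le_minus_one[of "1/2"] by (simp add: ln_div)
    then have "ln (B / t) / ln 2 \<le> ln (B / t) / (1/2)" using Bt by (intro divide_left_mono) auto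
    then show "real N \<le> 2 * ln (B / t) + 1" using N1 by (simp add: log_def)
  qed simp
  finally show ?thesis .
qed

lemma square_mono: "r \<le> s \<Longrightarrow> square z r \<subseteq> square z s"
  by (auto simp: square_def)

text \<open>
  The weight \<open>1/2^20\<close> makes the Jacobian term at most \<open>3/8 ln (1/t)\<close>, up to a constant, so that it can
  be absorbed.
\<close>

lemma Young_log_grad:
  assumes t: "0 < t"
  shows "AE p in lborel. (\<Sum>j\<le>n. ennreal (6 * 2^j) * (log_grad w t p * indicator (square z (1/2^j)) p))
    \<le> ennreal (96 / 2^20) * (ennreal (jac p / (trunc_dist w t p)\<^sup>2) * indicator (square z 1) p)
      + ennreal (6 * 2^20) * (\<Sum>j\<le>n. ennreal (4^j) * (ennreal (K p) * indicator (square z (1/2^j)) p))"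
  using distortion
proof eventually_elim
  case (elim p)
  define m where "m = trunc_dist w t p"
  have m: "m > 0" using trunc_dist_pos[OF t] by (simp add: m_def)
  define v where "v = (norm (gx p) + norm (gy p)) * (2 / m)"
  have v0: "v \<ge> 0" using m by (simp add: v_def)
  have lg: "log_grad w t p = ennreal v" 
    unfolding log_grad_def v_def m_def[symmetric] by (rule ennreal_mult[symmetric]) (use m in simp_all)
  define s where "s = (\<lambda>j::nat. indicator (square z (1/2^j)) p :: real)"
  have s01: "s j = 0 \<or> s j = 1" for j by (simp add: s_def indicator_def)
  have s0: "0 \<le> s j" for j using s01[of j] by auto
  have ind: "indicator (square z (1/2^j)) p = ennreal (s j)" for j
    by (simp add: s_def indicator_def)
  define W where "W = (\<Sum>j\<le>n. 2^j * s j)"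
  define Y where "Y = (\<Sum>j\<le>n. 4^j * s j)"
  have Kp: "K p > 0" using K_ge_1[of p] by simp
  have J0: "0 \<le> jac p" using elim Kp by (metis mult_less_0_iff not_le order_less_le_trans zero_le_power2 norm_ge_zero less_le_not_le)
  show ?case
  proof (cases "p \<in> square z 1")
    case False
    have "p \<notin> square z (1/2^j)" for j :: nat
      using False square_mono[of "1/2^j" 1 z] by auto
    then show ?thesis by simp
  next
    case True
    \<comment> \<open>The squared sum is at most \<open>4 * K * J\<close>; with the factor
      \<open>2 / m\<close> of the gradient this becomes \<open>16 * K * J / m^2\<close>, the shape
      required by \<open>Young_weighted\<close>.\<close>
    have "(norm (gx p) + norm (gy p))\<^sup>2 \<le> 2 * (norm (gx p))\<^sup>2 + 2 * (norm (gy p))\<^sup>2"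
      using sum_squares_bound[of "norm (gx p)" "norm (gy p)"] by (simp add: power2_sum)
    also have "\<dots> \<le> 4 * (K p * jac p)" using elim by simp
    finally have "v\<^sup>2 \<le> 4 * (K p * jac p) * (2 / m)\<^sup>2"
      unfolding v_def power_mult_distrib by (rule mult_right_mono) simp
    also have "\<dots> = 16 * K p * (jac p / m\<^sup>2)" by (simp add: power2_eq_square)
    finally have vv: "v\<^sup>2 \<le> 16 * K p * (jac p / m\<^sup>2)" .
    have "v * W \<le> 16 * (1/2^20) * (jac p / m\<^sup>2) + K p * W\<^sup>2 / (4 * (1/2^20))"
      by (rule Young_weighted[OF _ Kp vv]) simp
    also have "\<dots> \<le> 16 * (1/2^20) * (jac p / m\<^sup>2) + K p * (4 * Y) / (4 * (1/2^20))"
      using sum_powers_sq_le[of s n, OF s01] Kp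
      by (intro add_left_mono divide_right_mono mult_left_mono) (simp_all add: W_def Y_def)
    finally have main: "6 * (v * W) \<le> 96 / 2^20 * (jac p / m\<^sup>2) + 6 * 2^20 * (K p * Y)" by simp
    have KY: "K p * Y = (\<Sum>j\<le>n. 4^j * (K p * s j))"
      unfolding Y_def by (simp add: sum_distrib_left mult.left_commute)
    have KY0: "0 \<le> 4^j * (K p * s j)" for j using Kp s0[of j] by simp
    have "(\<Sum>j\<le>n. ennreal (6 * 2^j) * (log_grad w t p * indicator (square z (1/2^j)) p))
      = (\<Sum>j\<le>n. ennreal (6 * 2^j * (v * s j)))"
      unfolding lg ind using v0 s0 by (intro sum.cong refl) (simp add: ennreal_mult)
    also have "\<dots> = ennreal (\<Sum>j\<le>n. 6 * 2^j * (v * s j))"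
      using v0 s0 by (intro sum_ennreal) simp
    also have "(\<Sum>j\<le>n. 6 * 2^j * (v * s j)) = 6 * (v * W)"
      by (simp add: W_def sum_distrib_left mult.assoc mult.left_commute)
    also have "ennreal (6 * (v * W)) \<le> ennreal (96 / 2^20 * (jac p / m\<^sup>2) + 6 * 2^20 * (K p * Y))"
      by (rule ennreal_leI[OF main])
    also have "\<dots> = ennreal (96 / 2^20 * (jac p / m\<^sup>2)) + ennreal (6 * 2^20 * (K p * Y))"
      using J0 KY0 unfolding KY by (intro ennreal_plus) (auto intro!: sum_nonneg)
    also have "ennreal (96 / 2^20 * (jac p / m\<^sup>2)) = ennreal (96 / 2^20) * (ennreal (jac p / (trunc_dist w t p)\<^sup>2) * indicator (square z 1) p)"
      using J0 True by (subst ennreal_mult) (simp_all add: m_def)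
    also have "ennreal (6 * 2^20 * (K p * Y)) = ennreal (6 * 2^20) * ennreal (\<Sum>j\<le>n. 4^j * (K p * s j))"
      unfolding KY by (rule ennreal_mult) (auto intro!: sum_nonneg KY0)
    also have "ennreal (\<Sum>j\<le>n. 4^j * (K p * s j)) = (\<Sum>j\<le>n. ennreal (4^j * (K p * s j)))"
      using KY0 by (intro sum_ennreal[symmetric])
    also have "\<dots> = (\<Sum>j\<le>n. ennreal (4^j) * (ennreal (K p) * indicator (square z (1/2^j)) p))"
      unfolding ind using Kp s0 by (intro sum.cong refl) (simp add: ennreal_mult)
    finally show ?thesis .
  qed
qed

text \<open>The integral of \<open>log_dist\<close> over the largest square is bounded below by its
  values on a strip away from \<open>z\<close>, and above by the sum over the scales.
  \<open>C\<close> may depend on \<open>z\<close>, but not on \<open>q\<close> or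
  \<open>n\<close>.\<close>

theorem log_distance_estimate:
  obtains C where "\<And>q n. q \<noteq> z \<Longrightarrow> norm (F q - F z) < 1 \<Longrightarrow> 1/2^n \<le> max \<bar>fst q - fst z\<bar> \<bar>snd q - snd z\<bar> \<Longrightarrow>
    ennreal (ln (1 / norm (F q - F z))) \<le> ennreal C
      + ennreal (2^24) * (\<Sum>j\<le>n. ennreal (4^j) * (\<integral>\<^sup>+p. ennreal (K p) * indicator (square z (1/2^j)) p \<partial>lborel))"
proof -
  obtain a b where z: "z = (a, b)" by force
  obtain B where B: "1 \<le> B" "\<And>p. p \<in> square z 1 \<Longrightarrow> norm (F p - F z) < B"
    by (rule square_subset_sup[of z]) (auto simp: square_def)
  \<comment> \<open>A strip of area 1 at positive distance from \<open>z\<close>: by compactness and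
    injectivity \<open>F\<close> stays away from \<open>F z\<close> on it, so
    \<open>log_dist\<close> is at least \<open>ln (c / t)\<close> there.\<close>
  let ?S = "{a+1/2..a+1} \<times> {b-1..b+1}"
  have cS: "compact ?S" by (intro compact_Times) auto
  have "\<exists>x\<in>?S. \<forall>y\<in>?S. norm (F x - F z) \<le> norm (F y - F z)"
    by (rule continuous_attains_inf[OF cS]) (auto intro!: continuous_intros contF)
  then obtain p0 where p0: "p0 \<in> ?S" "\<And>p. p \<in> ?S \<Longrightarrow> norm (F p0 - F z) \<le> norm (F p - F z)"
    by blast
  define c where "c = min 1 (norm (F p0 - F z))"
  have "p0 \<noteq> z" using p0(1) by (auto simp: z)
  then have "F p0 \<noteq> F z" using FiF by metis
  then have c: "0 < c" "c \<le> 1" by (auto simp: c_def)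
  define C where "C = 2 * (2 * ln B + 1 - ln c)"
  have lnB: "0 \<le> ln B" using B by simp
  have lnc: "ln c \<le> 0" using c by simp
  show ?thesis
  proof (rule that[of C])
    fix q n assume q: "q \<noteq> z" "norm (F q - F z) < 1" and far: "1/2^n \<le> max \<bar>fst q - fst z\<bar> \<bar>snd q - snd z\<bar>"
    define t where "t = norm (F q - F z)"
    have "F q \<noteq> F z" using q(1) FiF by metis
    then have t: "0 < t" "t < 1" using q by (auto simp: t_def)
    define I where "I = (\<Sum>j\<le>n. ennreal (4^j) * (\<integral>\<^sup>+p. ennreal (K p) * indicator (square z (1/2^j)) p \<partial>lborel))"
    have low: "ennreal (ln (c / t)) \<le> (\<integral>\<^sup>+p. log_dist (F z) t p * indicator (square z 1) p \<partial>lborel)"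
    proof -
      have area: "emeasure lborel ?S = 1"
      proof -
        have "emeasure lborel ?S = emeasure lborel {a+1/2..a+1} * emeasure lborel {b-1..b+1}"
          unfolding lborel_prod[symmetric] by (rule lborel.emeasure_pair_measure_Times) simp_all
        also have "emeasure lborel {a+1/2..a+1} = ennreal (1/2)" by (subst emeasure_lborel_Icc) simp_all
        also have "emeasure lborel {b-1..b+1} = ennreal 2" by (subst emeasure_lborel_Icc) simp_all
        also have "ennreal (1/2) * ennreal 2 = ennreal (1/2 * 2)" by (rule ennreal_mult[symmetric]) simp_all
        finally show ?thesis by simp
      qed
      have "?S \<in> sets borel" by (intro sets_borel_Times) auto
      then have "ennreal (ln (c / t)) = (\<integral>\<^sup>+p. ennreal (ln (c / t)) * indicator ?S p \<partial>lborel)"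
        by (simp add: nn_integral_cmult area)
      also have "\<dots> \<le> (\<integral>\<^sup>+p. log_dist (F z) t p * indicator (square z 1) p \<partial>lborel)"
      proof (rule nn_integral_mono)
        fix p
        show "ennreal (ln (c / t)) * indicator ?S p \<le> log_dist (F z) t p * indicator (square z 1) p"
        proof (cases "p \<in> ?S")
          case True
          then have "p \<in> square z 1" by (auto simp: square_def z)
          have "c \<le> trunc_dist (F z) t p" using p0(2)[OF True] by (simp add: c_def trunc_dist_def le_max_iff_disj min_le_iff_disj)
          then have "ln (c / t) \<le> ln (trunc_dist (F z) t p / t)"
            using c t trunc_dist_pos[OF t(1)] by (intro ln_mono divide_right_mono) auto
          then show ?thesis using True \<open>p \<in> square z 1\<close> by (simp add: log_dist_def ennreal_leI)
        qed simp
      qed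
      finally show ?thesis .
    qed
    also have "\<dots> \<le> (\<Sum>j\<le>n. ennreal (6 * 2^j) * (\<integral>\<^sup>+p. log_grad (F z) t p * indicator (square z (1/2^j)) p \<partial>lborel))"
      by (rule log_dist_multiscale[OF t_def t(1) far])
    also have "\<dots> = (\<integral>\<^sup>+p. (\<Sum>j\<le>n. ennreal (6 * 2^j) * (log_grad (F z) t p * indicator (square z (1/2^j)) p)) \<partial>lborel)"
      by (subst nn_integral_sum) (auto intro!: sum.cong nn_integral_cmult[symmetric])
    also have "\<dots> \<le> (\<integral>\<^sup>+p. ennreal (96 / 2^20) * (ennreal (jac p / (trunc_dist (F z) t p)\<^sup>2) * indicator (square z 1) p)
      + ennreal (6 * 2^20) * (\<Sum>j\<le>n. ennreal (4^j) * (ennreal (K p) * indicator (square z (1/2^j)) p)) \<partial>lborel)"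
      by (rule nn_integral_mono_AE[OF Young_log_grad[OF t(1)]])
    also have "\<dots> = ennreal (96 / 2^20) * (\<integral>\<^sup>+p. ennreal (jac p / (trunc_dist (F z) t p)\<^sup>2) * indicator (square z 1) p \<partial>lborel)
      + ennreal (6 * 2^20) * I"
      unfolding I_def
      by (subst nn_integral_add) (simp_all add: nn_integral_cmult nn_integral_sum)
    also have "\<dots> \<le> ennreal (96 / 2^20) * ennreal (2048 * (2 * ln (B / t) + 1)) + ennreal (6 * 2^20) * I"
      by (intro add_right_mono mult_left_mono nn_integral_jac_log_le[OF t B]) auto
    finally have est: "ennreal (ln (c / t)) \<le> ennreal (96 / 2^20) * ennreal (2048 * (2 * ln (B / t) + 1)) + ennreal (6 * 2^20) * I" .
    have "ennreal (ln (1 / t)) \<le> ennreal C + ennreal (2^24) * I"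
    proof (cases "I = \<infinity>")
      case True
      then show ?thesis by (simp add: ennreal_mult_top)
    next
      case False
      then obtain i where i: "I = ennreal i" "0 \<le> i" by (cases I) auto
      have lnt: "ln (1 / t) = - ln t" "ln (c / t) = ln c - ln t" "ln (B / t) = ln B - ln t"
        using t c B by (simp_all add: ln_div)
      have lt: "ln t < 0" using t by simp
      define X where "X = 2048 * (2 * ln (B / t) + 1)"
      have X0: "0 \<le> X" using lt lnB by (simp add: X_def lnt)
      have e1: "ennreal (96 / 2^20) * ennreal X = ennreal (96 / 2^20 * X)"
        by (rule ennreal_mult[symmetric]) (use X0 in simp_all)
      have e2: "ennreal (6 * 2^20) * I = ennreal (6 * 2^20 * i)"
        unfolding i(1) by (rule ennreal_mult[symmetric]) (use i in simp_all)
      have e3: "ennreal (2^24) * I = ennreal (2^24 * i)"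
        unfolding i(1) by (rule ennreal_mult[symmetric]) (use i in simp_all)
      have "ennreal (96 / 2^20) * ennreal X + ennreal (6 * 2^20) * I
        = ennreal (96 / 2^20 * X + 6 * 2^20 * i)"
        unfolding e1 e2 by (rule ennreal_plus[symmetric]) (use i X0 in simp_all)
      with est[folded X_def] have "ennreal (ln (c / t)) \<le> ennreal (96 / 2^20 * X + 6 * 2^20 * i)" by simp
      moreover have "0 \<le> 96 / 2^20 * X + 6 * 2^20 * i" using i X0 by simp
      ultimately have "ln (c / t) \<le> 96 / 2^20 * (2048 * (2 * ln (B / t) + 1)) + 6 * 2^20 * i"
        unfolding X_def[symmetric] by (subst (asm) ennreal_le_iff) assumption+
      \<comment> \<open>\<open>96 / 2^20 * 2048 = 3/16\<close>, so \<open>- ln t\<close> occurs on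
        the right with coefficient 3/8. Moving it over leaves 5/8 on the left, and
        \<open>8/5 * 6 * 2^20\<close> is below \<open>2^24\<close>.\<close>
      then have "ln c - ln t \<le> 3/16 * (2 * (ln B - ln t) + 1) + 6 * 2^20 * i"
        by (simp add: lnt X_def) argo
      then have "- ln t \<le> C + 2^24 * i" using lnB lnc i(2) unfolding C_def by (simp add: field_simps)
      then have "ennreal (ln (1 / t)) \<le> ennreal (C + 2^24 * i)" by (intro ennreal_leI) (simp add: lnt)
      also have "\<dots> = ennreal C + ennreal (2^24) * I"
        unfolding e3 by (rule ennreal_plus) (use i lnB lnc in \<open>simp_all add: C_def\<close>)
      finally show ?thesis .
    qed
    then show "ennreal (ln (1 / norm (F q - F z))) \<le> ennreal C
      + ennreal (2^24) * (\<Sum>j\<le>n. ennreal (4^j) * (\<integral>\<^sup>+p. ennreal (K p) * indicator (square z (1/2^j)) p \<partial>lborel))"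
      unfolding t_def I_def .
  qed
qed

end

section \<open>Exponentially integrable distortion\<close>

text \<open>Subtracting the constant \<open>A\<close> under the integral gives the shifted bound
  that \<open>acl_homeo\<close> asks for.\<close>

lemma acl_increment_bound:
  fixes G :: "real \<Rightarrow> complex"
  assumes G: "set_integrable lborel {a..b} G" and "a \<le> b"
  shows "ennreal (norm ((LINT t:{a..b}|lborel. G t) - (b - a) *\<^sub>R A))
    \<le> (\<integral>\<^sup>+t. ennreal (norm (G t - A)) * indicator {a..b} t \<partial>lborel)"
proof -
  have A: "set_integrable lborel {a..b} (\<lambda>t. A)"
    unfolding set_integrable_def
    by (rule integrable_indicator) (use assms in simp_all)
  have A': "(LINT t:{a..b}|lborel. A) = (b - a) *\<^sub>R A"
    using assms by (simp add: set_lebesgue_integral_def)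
  have "(LINT t:{a..b}|lborel. G t) - (b - a) *\<^sub>R A = (LINT t:{a..b}|lborel. G t - A)"
    unfolding A'[symmetric] using G A by (rule set_integral_diff(2)[symmetric])
  moreover have "set_integrable lborel {a..b} (\<lambda>t. G t - A)"
    using G A by (rule set_integral_diff(1))
  then have "ennreal (norm (LINT t:{a..b}|lborel. G t - A))
      \<le> (\<integral>\<^sup>+t. ennreal (norm (indicator {a..b} t *\<^sub>R (G t - A))) \<partial>lborel)"
    unfolding set_lebesgue_integral_def set_integrable_def by (rule integral_norm_bound_ennreal)
  moreover have "(\<integral>\<^sup>+t. ennreal (norm (indicator {a..b} t *\<^sub>R (G t - A))) \<partial>lborel)
      = (\<integral>\<^sup>+t. ennreal (norm (G t - A)) * indicator {a..b} t \<partial>lborel)"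
    by (intro nn_integral_cong) (simp add: indicator_def)
  ultimately show ?thesis by simp
qed

section \<open>From the definition of distortion to Borel representatives\<close>

lemma nn_integral_cball_finite:
  fixes w :: "complex \<Rightarrow> 'b::euclidean_space"
  assumes "\<And>S. compact S \<Longrightarrow> set_integrable lborel S w"
  shows "(\<integral>\<^sup>+z. ennreal (norm (w z)) * indicator (cball 0 R) z \<partial>lborel) < \<infinity>"
proof -
  have "set_integrable lborel (cball 0 R) w" by (rule assms) simp
  then have "(\<integral>\<^sup>+z. ennreal (norm (indicator (cball 0 R) z *\<^sub>R w z)) \<partial>lborel) < \<infinity>"
    unfolding set_integrable_def integrable_iff_bounded by blast
  also have "(\<integral>\<^sup>+z. ennreal (norm (indicator (cball 0 R) z *\<^sub>R w z)) \<partial>lborel)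
      = (\<integral>\<^sup>+z. ennreal (norm (w z)) * indicator (cball 0 R) z \<partial>lborel)"
    by (intro nn_integral_cong) (simp add: indicator_def)
  finally show ?thesis .
qed

lemma nn_integral_ball_pair_finite:
  fixes w :: "complex \<Rightarrow> ennreal"
  assumes [measurable]: "w \<in> borel_measurable borel"
    and fin: "(\<integral>\<^sup>+z. w z * indicator (cball 0 R) z \<partial>lborel) < \<infinity>"
  shows "(\<integral>\<^sup>+p. w (Complex (fst p) (snd p)) * indicator (ball 0 R) p \<partial>lborel) < \<infinity>"
proof -
  have [measurable]: "cball (0::complex) R \<in> sets borel" by simp
  have "(\<integral>\<^sup>+p. w (Complex (fst p) (snd p)) * indicator (ball 0 R) p \<partial>lborel)
      \<le> (\<integral>\<^sup>+p. w (Complex (fst p) (snd p)) * indicator (cball 0 R) (Complex (fst p) (snd p)) \<partial>lborel)"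
    by (intro nn_integral_mono mult_left_mono)
       (auto simp: indicator_def complex_norm norm_prod_def dist_norm)
  also have "\<dots> = (\<integral>\<^sup>+z. w z * indicator (cball 0 R) z \<partial>lborel)"
    by (rule nn_integral_complex[symmetric]) measurable
  finally show ?thesis using fin by (rule order_le_less_trans)
qed

lemma AE_lborel_Complex:
  assumes "AE z in lborel. P z"
  shows "AE p in lborel. P (Complex (fst p) (snd p))"
proof (rule AE_distrD[where f = "\<lambda>p. Complex (fst p) (snd p)" and P = P])
  show "(\<lambda>p. Complex (fst p) (snd p)) \<in> measurable lborel (borel :: complex measure)" by simp
  show "AE z in distr lborel borel (\<lambda>p. Complex (fst p) (snd p)). P z"
    using assms by (simp only: distr_Complex)
qed

lemma norm_weak_partial_le_onorm:
  "norm (weak_partial 1 f z) \<le> onorm (weak_differential f z)"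
  "norm (weak_partial \<i> f z) \<le> onorm (weak_differential f z)"
proof -
  have bl: "bounded_linear (weak_differential f z)"
    unfolding weak_differential_def
    by (intro bounded_linear_add bounded_linear_scaleR_const bounded_linear_Re bounded_linear_Im)
  show "norm (weak_partial 1 f z) \<le> onorm (weak_differential f z)"
    using onorm[OF bl, of 1] by (simp add: weak_differential_def)
  show "norm (weak_partial \<i> f z) \<le> onorm (weak_differential f z)"
    using onorm[OF bl, of \<i>] by (simp add: weak_differential_def)
qed

text \<open>The partial derivatives, the Jacobian and \<open>exp (p * K1)\<close> are replaced by
  Borel functions that differ from them on null sets, and everything is moved to pairs of reals. The
  identities among them then hold only almost everywhere, which is all that
  \<open>distortion_map\<close> asks, except for the pointwise bound
  \<open>K \<ge> 1\<close>.\<close>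

lemma exp_integrable_distortionE:
  assumes "exp_integrable_distortion p f" "p > 0"
  obtains g gx gy K where "homeomorphism UNIV UNIV f g" "K \<in> borel_measurable borel"
    "distortion_map (\<lambda>q. f (Complex (fst q) (snd q))) (\<lambda>z. (Re (g z), Im (g z))) gx gy
       (\<lambda>q. K (Complex (fst q) (snd q)))"
    "\<And>R. (\<integral>\<^sup>+z. ennreal (exp (p * K z)) * indicator (cball 0 R) z \<partial>lborel) < \<infinity>"
proof -
  from assms(1) obtain K1 where fd: "finite_distortion f" and db: "distortion_bound f K1"
    and ei: "locally_integrable (\<lambda>z. exp (p * K1 z))"
    by (auto simp: exp_integrable_distortion_def is_distortion_def)
  from fd obtain g where g: "homeomorphism UNIV UNIV f g"
    by (auto simp: finite_distortion_def plane_homeomorphism_def)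
  have contf: "continuous_on UNIV f" using g by (rule homeomorphism_cont1)
  have contg: "continuous_on UNIV g" using g by (rule homeomorphism_cont2)
  have fg: "f (g z) = z" "g (f z) = z" for z using g by (auto simp: homeomorphism_def)
  have "\<exists>u. has_weak_partial v f u" if "v \<in> {1, \<i>}" for v
    using fd that by (auto simp: finite_distortion_def W11_loc_def)
  then have hw: "has_weak_partial v f (weak_partial v f)" if "v \<in> {1, \<i>}" for v
    unfolding weak_partial_def using that by (metis someI_ex)
  have lw: "locally_integrable (weak_partial v f)" if "v \<in> {1, \<i>}" for v
    using hw[OF that] by (simp add: has_weak_partial_def)
  have l1: "locally_integrable (weak_partial 1 f)" and li: "locally_integrable (weak_partial \<i> f)"
    using lw by auto
  obtain u where u [measurable]: "u \<in> borel_measurable borel"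
    and u': "weak_partial 1 f \<in> borel_measurable lebesgue" "AE z in lborel. weak_partial 1 f z = u z"
      "\<And>S. compact S \<Longrightarrow> set_integrable lborel S u"
    using l1 by (rule locally_integrable_borel_version) blast
  obtain v where v [measurable]: "v \<in> borel_measurable borel"
    and v': "weak_partial \<i> f \<in> borel_measurable lebesgue" "AE z in lborel. weak_partial \<i> f z = v z"
      "\<And>S. compact S \<Longrightarrow> set_integrable lborel S v"
    using li by (rule locally_integrable_borel_version) blast
  obtain e where e [measurable]: "e \<in> borel_measurable borel"
    and e': "AE z in lborel. exp (p * K1 z) = e z" "\<And>S. compact S \<Longrightarrow> set_integrable lborel S e"
    using ei by (rule locally_integrable_borel_version) blast
  have lj: "locally_integrable (jacobian f)" using fd by (simp add: finite_distortion_def)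
  obtain j where j [measurable]: "j \<in> borel_measurable borel"
    and j': "AE z in lborel. jacobian f z = j z" "\<And>S. compact S \<Longrightarrow> set_integrable lborel S j"
    using lj by (rule locally_integrable_borel_version) blast
  \<comment> \<open>The distortion is recovered by a logarithm from the Borel version of its
    exponential; the maximum with 1 changes it on a null set at most and makes the lower bound hold
    everywhere.\<close>
  define K where "K z = max 1 (ln (e z) / p)" for z
  have K [measurable]: "K \<in> borel_measurable borel" unfolding K_def by measurable
  have K1: "1 \<le> K1 z" for z using db by (simp add: distortion_bound_def)
  have aeK: "AE z in lborel. K1 z = K z \<and> exp (p * K z) = e z"
    using e'(1)
  proof eventually_elim
    case (elim z)
    then have "ln (e z) / p = K1 z" using assms(2) by (metis ln_exp nonzero_mult_div_cancel_left less_irrefl)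
    then show ?case using K1[of z] elim by (simp add: K_def max_def)
  qed
  define J where "J z = Re (u z) * Im (v z) - Im (u z) * Re (v z)" for z
  have J [measurable]: "J \<in> borel_measurable borel" unfolding J_def by measurable
  have aeJ: "AE z in lborel. jacobian f z = J z \<and> J z = j z"
    using u'(2) v'(2) j'(1) by eventually_elim (simp add: J_def jacobian_def)
  have "AE z in lebesgue. (onorm (weak_differential f z))\<^sup>2 \<le> K1 z * jacobian f z"
    using db by (simp add: distortion_bound_def)
  then have "AE z in lborel. (onorm (weak_differential f z))\<^sup>2 \<le> K1 z * jacobian f z"
    by (simp add: AE_completion_iff)
  then have dist: "AE z in lborel. (norm (u z))\<^sup>2 \<le> K z * J z \<and> (norm (v z))\<^sup>2 \<le> K z * J z"
    using u'(2) v'(2) aeK aeJ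
  proof eventually_elim
    case (elim z)
    have "(norm (u z))\<^sup>2 \<le> (onorm (weak_differential f z))\<^sup>2"
      using norm_weak_partial_le_onorm(1)[of f z] elim by (intro power_mono) simp_all
    moreover have "(norm (v z))\<^sup>2 \<le> (onorm (weak_differential f z))\<^sup>2"
      using norm_weak_partial_le_onorm(2)[of f z] elim by (intro power_mono) simp_all
    ultimately show ?case using elim by simp
  qed
  let ?c = "\<lambda>q. Complex (fst q) (snd q)"
  \<comment> \<open>For the direction \<open>1\<close> the running variable is the real part, so it
    is the second component of the pair.\<close>
  have "weak_partial2 (\<lambda>q. f (Complex (snd q) (fst q))) (\<lambda>q. u (Complex (snd q) (fst q)))"
    by (rule coords.weak_partial2_of_has_weak_partial[OF coords_horizontal hw contf u'(1) u u'(2,3)]) auto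
  from acl_of_weak_partial2[OF this]
  have aclx: "AE y in lborel. \<forall>a b A. a \<le> b \<longrightarrow> ennreal (norm (f (Complex b y) - f (Complex a y) - (b - a) *\<^sub>R A))
        \<le> (\<integral>\<^sup>+x. ennreal (norm (u (Complex x y) - A)) * indicator {a..b} x \<partial>lborel)"
  proof eventually_elim
    case (elim y)
    have si: "set_integrable lborel {a..b} (\<lambda>t. u (Complex t y))" for a b using elim by simp
    have eq: "a \<le> b \<Longrightarrow> f (Complex b y) - f (Complex a y) = (LINT t:{a..b}|lborel. u (Complex t y))" for a b
      using elim by simp
    show ?case
    proof (intro allI impI)
      fix a b :: real and A assume "a \<le> b"
      show "ennreal (norm (f (Complex b y) - f (Complex a y) - (b - a) *\<^sub>R A))
        \<le> (\<integral>\<^sup>+x. ennreal (norm (u (Complex x y) - A)) * indicator {a..b} x \<partial>lborel)"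
        unfolding eq[OF \<open>a \<le> b\<close>] by (rule acl_increment_bound[OF si \<open>a \<le> b\<close>])
    qed
  qed
  have "weak_partial2 (\<lambda>q. f (?c q)) (\<lambda>q. v (?c q))"
    by (rule coords.weak_partial2_of_has_weak_partial[OF coords_vertical hw contf v'(1) v v'(2,3)]) auto
  from acl_of_weak_partial2[OF this]
  have acly: "AE x in lborel. \<forall>a b A. a \<le> b \<longrightarrow> ennreal (norm (f (Complex x b) - f (Complex x a) - (b - a) *\<^sub>R A))
        \<le> (\<integral>\<^sup>+y. ennreal (norm (v (Complex x y) - A)) * indicator {a..b} y \<partial>lborel)"
  proof eventually_elim
    case (elim x)
    have si: "set_integrable lborel {a..b} (\<lambda>t. v (Complex x t))" for a b using elim by simp
    have eq: "a \<le> b \<Longrightarrow> f (Complex x b) - f (Complex x a) = (LINT t:{a..b}|lborel. v (Complex x t))" for a b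
      using elim by simp
    show ?case
    proof (intro allI impI)
      fix a b :: real and A assume "a \<le> b"
      show "ennreal (norm (f (Complex x b) - f (Complex x a) - (b - a) *\<^sub>R A))
        \<le> (\<integral>\<^sup>+y. ennreal (norm (v (Complex x y) - A)) * indicator {a..b} y \<partial>lborel)"
        unfolding eq[OF \<open>a \<le> b\<close>] by (rule acl_increment_bound[OF si \<open>a \<le> b\<close>])
    qed
  qed
  have cc: "continuous_on UNIV ?c" by (simp add: Complex_eq) (intro continuous_intros)
  have homeo: "homeomorphism UNIV UNIV (\<lambda>q. f (?c q)) (\<lambda>z. (Re (g z), Im (g z)))"
  proof (rule homeomorphismI)
    show "continuous_on UNIV (\<lambda>q. f (?c q))" by (rule continuous_on_compose2[OF contf cc]) auto
    show "continuous_on UNIV (\<lambda>z. (Re (g z), Im (g z)))" by (intro continuous_intros contg)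
  qed (simp_all add: fg)
  have acl: "acl_homeo (\<lambda>q. f (?c q)) (\<lambda>z. (Re (g z), Im (g z))) (\<lambda>q. u (?c q)) (\<lambda>q. v (?c q))"
  proof (rule acl_homeo.intro)
    show "(\<lambda>q. u (?c q)) \<in> borel_measurable borel" "(\<lambda>q. v (?c q)) \<in> borel_measurable borel" by measurable
  qed (use homeo aclx acly in simp_all)
  then interpret A: acl_homeo "\<lambda>q. f (?c q)" "\<lambda>z. (Re (g z), Im (g z))" "\<lambda>q. u (?c q)" "\<lambda>q. v (?c q)" .
  have jac: "A.jac q = J (?c q)" for q by (simp add: A.jac_def J_def)
  have dm: "distortion_map (\<lambda>q. f (?c q)) (\<lambda>z. (Re (g z), Im (g z))) (\<lambda>q. u (?c q)) (\<lambda>q. v (?c q)) (\<lambda>q. K (?c q))"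
  proof (rule distortion_map.intro[OF acl], rule distortion_map_axioms.intro)
    show "(\<lambda>q. K (?c q)) \<in> borel_measurable borel" by measurable
    show "1 \<le> K (?c q)" for q by (simp add: K_def)
    show "AE q in lborel. (cmod (u (?c q)))\<^sup>2 \<le> K (?c q) * A.jac q \<and> (cmod (v (?c q)))\<^sup>2 \<le> K (?c q) * A.jac q"
      unfolding jac by (rule AE_lborel_Complex[OF dist])
    show "(\<integral>\<^sup>+q. ennreal (cmod (u (?c q))) * indicator (ball 0 R) q \<partial>lborel) < \<infinity>" for R
      by (rule nn_integral_ball_pair_finite[where w = "\<lambda>z. ennreal (cmod (u z))"])
         (measurable, rule nn_integral_cball_finite[OF u'(3)])
    show "(\<integral>\<^sup>+q. ennreal (cmod (v (?c q))) * indicator (ball 0 R) q \<partial>lborel) < \<infinity>" for R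
      by (rule nn_integral_ball_pair_finite[where w = "\<lambda>z. ennreal (cmod (v z))"])
         (measurable, rule nn_integral_cball_finite[OF v'(3)])
    fix R
    have "(\<integral>\<^sup>+z. ennreal (norm (J z)) * indicator (cball 0 R) z \<partial>lborel)
        = (\<integral>\<^sup>+z. ennreal (norm (j z)) * indicator (cball 0 R) z \<partial>lborel)"
      by (rule nn_integral_cong_AE) (use aeJ in eventually_elim, simp)
    then have "(\<integral>\<^sup>+z. ennreal (norm (J z)) * indicator (cball 0 R) z \<partial>lborel) < \<infinity>"
      using nn_integral_cball_finite[OF j'(2)] by simp
    then show "(\<integral>\<^sup>+q. ennreal (norm (A.jac q)) * indicator (ball 0 R) q \<partial>lborel) < \<infinity>"
      unfolding jac by (intro nn_integral_ball_pair_finite[where w = "\<lambda>z. ennreal (norm (J z))"]) measurable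
  qed
  have fin: "(\<integral>\<^sup>+z. ennreal (exp (p * K z)) * indicator (cball 0 R) z \<partial>lborel) < \<infinity>" for R
  proof -
    have "(\<integral>\<^sup>+z. ennreal (exp (p * K z)) * indicator (cball 0 R) z \<partial>lborel)
        = (\<integral>\<^sup>+z. ennreal (norm (e z)) * indicator (cball 0 R) z \<partial>lborel)"
    proof (rule nn_integral_cong_AE)
      show "AE z in lborel. ennreal (exp (p * K z)) * indicator (cball 0 R) z = ennreal (norm (e z)) * indicator (cball 0 R) z"
        using aeK
      proof eventually_elim
        case (elim z)
        then have "norm (e z) = exp (p * K z)" by (metis norm_exp abs_exp_cancel real_norm_def)
        then show ?case by simp
      qed
    qed
    then show ?thesis using nn_integral_cball_finite[OF e'(2)] by simp
  qed
  show ?thesis by (rule that[OF g K dm fin])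
qed

text \<open>The tangent line of \<open>exp\<close> at \<open>M\<close> gives \<open>p K \<le> M + exp (- M) exp (p K)\<close>.\<close>

lemma nn_integral_le_exp_integral:
  fixes K :: "real \<times> real \<Rightarrow> real"
  assumes [measurable]: "K \<in> borel_measurable borel" and "p > 0" "M \<ge> 0" "r \<ge> 0"
  shows "(\<integral>\<^sup>+q. ennreal (K q) * indicator (square z r) q \<partial>lborel)
    \<le> ennreal (4 * M / p * r\<^sup>2)
      + ennreal (exp (- M) / p) * (\<integral>\<^sup>+q. ennreal (exp (p * K q)) * indicator (square z r) q \<partial>lborel)"
proof -
  have pt: "ennreal (K q) \<le> ennreal (M / p) + ennreal (exp (- M) / p) * ennreal (exp (p * K q))" for q
  proof -
    have "p * K q - M \<le> exp (p * K q - M)" using exp_ge_add_one_self[of "p * K q - M"] by linarith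
    then have "p * K q \<le> M + exp (- M) * exp (p * K q)" by (simp add: exp_diff exp_minus field_simps)
    then have "K q \<le> M / p + exp (- M) / p * exp (p * K q)" using assms(2) by (simp add: field_simps)
    then have "ennreal (K q) \<le> ennreal (M / p + exp (- M) / p * exp (p * K q))" by (rule ennreal_leI)
    also have "\<dots> = ennreal (M / p) + ennreal (exp (- M) / p * exp (p * K q))"
      by (rule ennreal_plus) (use assms in simp_all)
    also have "ennreal (exp (- M) / p * exp (p * K q)) = ennreal (exp (- M) / p) * ennreal (exp (p * K q))"
      by (rule ennreal_mult) (use assms in simp_all)
    finally show ?thesis .
  qed
  have em: "emeasure lborel (square z r) = ennreal (4 * r\<^sup>2)"
    unfolding square_def by (rule emeasure_square[OF assms(4)])
  have "(\<integral>\<^sup>+q. ennreal (K q) * indicator (square z r) q \<partial>lborel)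
    \<le> (\<integral>\<^sup>+q. ennreal (M / p) * indicator (square z r) q
        + ennreal (exp (- M) / p) * (ennreal (exp (p * K q)) * indicator (square z r) q) \<partial>lborel)"
  proof (rule nn_integral_mono)
    fix q
    show "ennreal (K q) * indicator (square z r) q \<le> ennreal (M / p) * indicator (square z r) q
        + ennreal (exp (- M) / p) * (ennreal (exp (p * K q)) * indicator (square z r) q)"
      using pt[of q] by (cases "q \<in> square z r") simp_all
  qed
  also have "\<dots> = ennreal (M / p) * emeasure lborel (square z r)
      + ennreal (exp (- M) / p) * (\<integral>\<^sup>+q. ennreal (exp (p * K q)) * indicator (square z r) q \<partial>lborel)"
    by (subst nn_integral_add) (simp_all add: nn_integral_cmult)
  also have "ennreal (M / p) * emeasure lborel (square z r) = ennreal (4 * M / p * r\<^sup>2)"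
    unfolding em by (subst ennreal_mult[symmetric]) (use assms in \<open>simp_all add: mult_ac\<close>)
  finally show ?thesis .
qed

text \<open>The tangent is taken at \<open>M = \<beta> * k * ln 2\<close>: then
  \<open>exp (- M) = 2 powr (- \<beta> * k)\<close> turns the density
  \<open>2 powr (- k * (2 - \<beta>))\<close> into \<open>4^-k\<close>, the order of the area, and
  the other term is of order \<open>M\<close> times the area.\<close>

lemma sq_mean_le_of_exp_density:
  fixes K :: "real \<times> real \<Rightarrow> real"
  assumes K: "K \<in> borel_measurable borel" and "p > 0" "\<beta> > 0"
    and good: "(\<integral>\<^sup>+q. ennreal (exp (p * K q)) * indicator (square z (1/2^k)) q \<partial>lborel)
      \<le> ennreal (2 powr (- (real k * (2 - \<beta>))))"
  shows "ennreal (4^k) * (\<integral>\<^sup>+q. ennreal (K q) * indicator (square z (1/2^k)) q \<partial>lborel)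
    \<le> ennreal ((4 * \<beta> * real k + 1) / p)"
proof -
  define M where "M = \<beta> * real k * ln 2"
  have M: "0 \<le> M" "M \<le> \<beta> * real k"
    using assms ln_le_minus_one[of 2] by (auto simp: M_def mult_left_le)
  have eM: "exp (- M) = 2 powr (- (\<beta> * real k))" by (simp add: M_def powr_def)
  have q: "((2::real)^k)\<^sup>2 = 4^k" unfolding power2_eq_square power_mult_distrib[symmetric] by simp
  have r: "(1/2^k)\<^sup>2 = (1/4^k :: real)" by (simp only: power_divide q power_one)
  have "2 powr (- (\<beta> * real k)) * 2 powr (- (real k * (2 - \<beta>))) = 2 powr (- (2 * real k))"
    by (simp add: powr_add[symmetric] algebra_simps)
  also have "\<dots> = 1 / 4^k"
    by (simp add: powr_minus powr_powr[symmetric] powr_realpow field_simps q)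
  finally have w: "2 powr (- (\<beta> * real k)) * 2 powr (- (real k * (2 - \<beta>))) = (1 / 4^k :: real)" .
  have "(\<integral>\<^sup>+q. ennreal (K q) * indicator (square z (1/2^k)) q \<partial>lborel)
    \<le> ennreal (4 * M / p * (1/2^k)\<^sup>2) + ennreal (exp (- M) / p)
        * (\<integral>\<^sup>+q. ennreal (exp (p * K q)) * indicator (square z (1/2^k)) q \<partial>lborel)"
    by (rule nn_integral_le_exp_integral[OF K assms(2) M(1)]) simp
  also have "\<dots> \<le> ennreal (4 * M / p * (1/2^k)\<^sup>2)
      + ennreal (exp (- M) / p) * ennreal (2 powr (- (real k * (2 - \<beta>))))"
    by (intro add_left_mono mult_left_mono good) simp
  also have "\<dots> = ennreal (4 * M / p * (1/2^k)\<^sup>2) + ennreal (exp (- M) / p * 2 powr (- (real k * (2 - \<beta>))))"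
    by (subst ennreal_mult) (use assms in simp_all)
  also have "\<dots> = ennreal (4 * M / p * (1/2^k)\<^sup>2 + exp (- M) / p * 2 powr (- (real k * (2 - \<beta>))))"
    by (rule ennreal_plus[symmetric]) (use assms M in simp_all)
  also have "4 * M / p * (1/2^k)\<^sup>2 + exp (- M) / p * 2 powr (- (real k * (2 - \<beta>))) = (4 * M + 1) / p / 4^k"
    unfolding r eM times_divide_eq_left w by (simp add: add_divide_distrib mult.commute)
  finally have "ennreal (4^k) * (\<integral>\<^sup>+q. ennreal (K q) * indicator (square z (1/2^k)) q \<partial>lborel)
      \<le> ennreal (4^k) * ennreal ((4 * M + 1) / p / 4^k)"
    by (rule mult_left_mono) simp
  also have "\<dots> = ennreal (4^k * ((4 * M + 1) / p / 4^k))"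
    by (rule ennreal_mult[symmetric]) (use assms M in simp_all)
  also have "\<dots> \<le> ennreal ((4 * \<beta> * real k + 1) / p)"
    using M assms by (intro ennreal_leI) (simp add: divide_right_mono)
  finally show ?thesis .
qed

text \<open>The scales below \<open>k0\<close> contribute a constant. Each later scale
  \<open>j \<le> n\<close> contributes at most \<open>(4 * \<beta> * n + 1) / p\<close>, and there
  are at most \<open>n + 1\<close> of them, whence a bound quadratic in \<open>n\<close>.\<close>

lemma (in distortion_map) log_distance_at_good_point:
  assumes p: "p > 0" and b: "\<beta> > 0"
    and fin: "(\<integral>\<^sup>+q. ennreal (exp (p * K q)) * indicator (square z 1) q \<partial>lborel) < \<infinity>"
    and good: "\<And>k. k0 \<le> k \<Longrightarrow> (\<integral>\<^sup>+q. ennreal (exp (p * K q)) * indicator (square z (1/2^k)) q \<partial>lborel)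
      \<le> ennreal (2 powr (- (real k * (2 - \<beta>))))"
  obtains C where "C \<ge> 0" "\<And>q n. q \<noteq> z \<Longrightarrow> norm (F q - F z) < 1 \<Longrightarrow> 1/2^n \<le> max \<bar>fst q - fst z\<bar> \<bar>snd q - snd z\<bar> \<Longrightarrow>
    ln (1 / norm (F q - F z)) \<le> C + 2^27 * (\<beta> / p) * (real n)\<^sup>2"
proof -
  define I where "I k = (\<integral>\<^sup>+q. ennreal (K q) * indicator (square z (1/2^k)) q \<partial>lborel)" for k :: nat
  have "I k < \<infinity>" for k
  proof -
    have "square z (1/2^k) \<subseteq> square z 1" by (rule square_mono) simp
    then
    have "I k \<le> (\<integral>\<^sup>+q. ennreal (K q) * indicator (square z 1) q \<partial>lborel)"
      unfolding I_def by (intro nn_integral_mono mult_left_mono) (auto split: split_indicator)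
    \<comment> \<open>For mere finiteness the tangent at 0 is enough.\<close>
    also have "\<dots> \<le> ennreal (4 * 0 / p * 1\<^sup>2) + ennreal (exp (- 0) / p) * (\<integral>\<^sup>+q. ennreal (exp (p * K q)) * indicator (square z 1) q \<partial>lborel)"
      by (rule nn_integral_le_exp_integral) (use p in simp_all)
    also have "\<dots> < \<infinity>" using fin by (simp add: ennreal_mult_less_top)
    finally show ?thesis .
  qed
  then have "(\<Sum>j<k0. ennreal (4^j) * I j) < \<infinity>" by (simp add: ennreal_mult_less_top)
  then obtain S where S: "(\<Sum>j<k0. ennreal (4^j) * I j) = ennreal S" "0 \<le> S"
    by (cases "\<Sum>j<k0. ennreal (4^j) * I j") auto
  obtain C where C: "\<And>q n. q \<noteq> z \<Longrightarrow> norm (F q - F z) < 1 \<Longrightarrow> 1/2^n \<le> max \<bar>fst q - fst z\<bar> \<bar>snd q - snd z\<bar> \<Longrightarrow>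
    ennreal (ln (1 / norm (F q - F z))) \<le> ennreal C + ennreal (2^24) * (\<Sum>j\<le>n. ennreal (4^j) * I j)"
    unfolding I_def using log_distance_estimate[of z] by blast
  define C0 where "C0 = max C 0 + 2^24 * (S + (1 + (4 * \<beta> + 1)\<^sup>2 / (4 * \<beta>)) / p)"
  show ?thesis
  proof (rule that[of C0])
    show "0 \<le> C0" using S p b by (simp add: C0_def)
    fix q n assume q: "q \<noteq> z" "norm (F q - F z) < 1" "1/2^n \<le> max \<bar>fst q - fst z\<bar> \<bar>snd q - snd z\<bar>"
    define T where "T = (real n + 1) * ((4 * \<beta> * real n + 1) / p)"
    have T0: "0 \<le> T" using p b by (simp add: T_def)
    have summand: "ennreal (4^j) * I j \<le> (if j < k0 then ennreal (4^j) * I j else 0) + ennreal ((4 * \<beta> * real n + 1) / p)"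
      if "j \<le> n" for j
    proof (cases "j < k0")
      case False
      have "ennreal (4^j) * I j \<le> ennreal ((4 * \<beta> * real j + 1) / p)"
        unfolding I_def by (rule sq_mean_le_of_exp_density[OF K_measurable p b good]) (use False in simp)
      also have "\<dots> \<le> ennreal ((4 * \<beta> * real n + 1) / p)"
        using that p b by (intro ennreal_leI divide_right_mono add_right_mono mult_left_mono) auto
      finally show ?thesis using False by simp
    qed simp
    have "(\<Sum>j\<le>n. ennreal (4^j) * I j)
        \<le> (\<Sum>j\<le>n. (if j < k0 then ennreal (4^j) * I j else 0) + ennreal ((4 * \<beta> * real n + 1) / p))"
      by (intro sum_mono summand) simp
    also have "\<dots> = (\<Sum>j\<le>n. if j < k0 then ennreal (4^j) * I j else 0) + (\<Sum>j\<le>n. ennreal ((4 * \<beta> * real n + 1) / p))"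
      by (rule sum.distrib)
    also have "(\<Sum>j\<le>n. if j < k0 then ennreal (4^j) * I j else 0) = (\<Sum>j\<in>{..n} \<inter> {..<k0}. ennreal (4^j) * I j)"
      by (subst sum.inter_restrict) (simp_all add: lessThan_def)
    also have "\<dots> \<le> ennreal S"
      unfolding S(1)[symmetric] by (rule sum_mono2) auto
    also have "(\<Sum>j\<le>n. ennreal ((4 * \<beta> * real n + 1) / p)) = ennreal T"
      using p b by (subst sum_ennreal) (simp_all add: T_def add.commute)
    finally have "(\<Sum>j\<le>n. ennreal (4^j) * I j) \<le> ennreal S + ennreal T" by (simp add: add_right_mono)
    also have "\<dots> = ennreal (S + T)" by (rule ennreal_plus[symmetric]) (use S T0 in simp_all)
    finally have sum: "(\<Sum>j\<le>n. ennreal (4^j) * I j) \<le> ennreal (S + T)" .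
    have "ennreal (ln (1 / norm (F q - F z))) \<le> ennreal C + ennreal (2^24) * (\<Sum>j\<le>n. ennreal (4^j) * I j)"
      by (rule C[OF q])
    also have "\<dots> \<le> ennreal (max C 0) + ennreal (2^24) * ennreal (S + T)"
      by (intro add_mono mult_left_mono sum ennreal_leI) auto
    also have "ennreal (2^24) * ennreal (S + T) = ennreal (2^24 * (S + T))"
      by (rule ennreal_mult[symmetric]) (use S T0 in simp_all)
    also have "ennreal (max C 0) + ennreal (2^24 * (S + T)) = ennreal (max C 0 + 2^24 * (S + T))"
      by (rule ennreal_plus[symmetric]) (use S T0 in simp_all)
    finally have "ennreal (ln (1 / norm (F q - F z))) \<le> ennreal (max C 0 + 2^24 * (S + T))" .
    then have 1: "ln (1 / norm (F q - F z)) \<le> max C 0 + 2^24 * (S + T)"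
      by (subst (asm) ennreal_le_iff) (use S T0 in simp_all)
    \<comment> \<open>Completing the square absorbs the linear term into the quadratic one, whose
      coefficient doubles from \<open>4 * \<beta>\<close> to \<open>8 * \<beta>\<close>; multiplied
      by \<open>2^24\<close> this is the \<open>2^27\<close> of the claim, and the rest goes into
      \<open>C0\<close>.\<close>
    have "T = (4 * \<beta> * (real n)\<^sup>2 + (4 * \<beta> + 1) * real n + 1) / p"
      by (simp add: T_def field_simps power2_eq_square)
    also have "\<dots> \<le> (8 * \<beta> * (real n)\<^sup>2 + (4 * \<beta> + 1)\<^sup>2 / (4 * \<beta>) + 1) / p"
    proof (intro divide_right_mono add_right_mono)
      have "0 \<le> (2 * (2 * \<beta> * real n) - (4 * \<beta> + 1))\<^sup>2" by simp
      then have "(4 * \<beta> + 1) * real n * (8 * \<beta>) \<le> (4 * \<beta> * (real n)\<^sup>2) * (4 * \<beta>) + (4 * \<beta> + 1)\<^sup>2"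
        by (simp add: power2_diff power_mult_distrib) (simp add: algebra_simps power2_eq_square)
      also have "\<dots> = (4 * \<beta> * (real n)\<^sup>2 + (4 * \<beta> + 1)\<^sup>2 / (4 * \<beta>)) * (4 * \<beta>)"
        using b by (simp add: distrib_right)
      finally have "(4 * \<beta> + 1) * real n * (8 * \<beta>) \<le> (4 * \<beta> * (real n)\<^sup>2 + (4 * \<beta> + 1)\<^sup>2 / (4 * \<beta>)) * (4 * \<beta>)" .
      moreover have "(4 * \<beta> + 1) * real n * (4 * \<beta>) \<le> (4 * \<beta> + 1) * real n * (8 * \<beta>)"
        using b by (intro mult_left_mono) simp_all
      ultimately have "(4 * \<beta> + 1) * real n * (4 * \<beta>) \<le> (4 * \<beta> * (real n)\<^sup>2 + (4 * \<beta> + 1)\<^sup>2 / (4 * \<beta>)) * (4 * \<beta>)"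
        by linarith
      then have "(4 * \<beta> + 1) * real n \<le> 4 * \<beta> * (real n)\<^sup>2 + (4 * \<beta> + 1)\<^sup>2 / (4 * \<beta>)"
        using b by (subst (asm) mult_le_cancel_right_pos) simp_all
      then show "4 * \<beta> * (real n)\<^sup>2 + (4 * \<beta> + 1) * real n \<le> 8 * \<beta> * (real n)\<^sup>2 + (4 * \<beta> + 1)\<^sup>2 / (4 * \<beta>)" by linarith
    qed (use p in simp)
    also have "\<dots> = 8 * (\<beta> / p) * (real n)\<^sup>2 + (1 + (4 * \<beta> + 1)\<^sup>2 / (4 * \<beta>)) / p"
      by (simp add: add_divide_distrib)
    finally have "2^24 * (S + T) \<le> 2^24 * (S + (8 * (\<beta> / p) * (real n)\<^sup>2 + (1 + (4 * \<beta> + 1)\<^sup>2 / (4 * \<beta>)) / p))"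
      by (intro mult_left_mono add_left_mono) simp_all
    with 1 show "ln (1 / norm (F q - F z)) \<le> C0 + 2^27 * (\<beta> / p) * (real n)\<^sup>2"
      unfolding C0_def distrib_left by simp
  qed
qed

section \<open>Comparison with the gauge\<close>

lemma nn_integral_csquare:
  assumes [measurable]: "w \<in> borel_measurable borel"
  shows "(\<integral>\<^sup>+x. w x * indicator (csquare z r) x \<partial>lborel)
    = (\<integral>\<^sup>+q. w (Complex (fst q) (snd q)) * indicator (square (Re z, Im z) r) q \<partial>lborel)"
proof -
  have "indicator (csquare z r) (Complex (fst q) (snd q)) = (indicator (square (Re z, Im z) r) q :: ennreal)" for q
    by (cases q) (auto simp: csquare_def square_def indicator_def abs_le_iff)
  then show ?thesis by (subst nn_integral_complex) simp_all
qed

text \<open>\<open>m\<close> stands for the sup-norm distance of two points at distance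
  \<open>r\<close>. The least \<open>n\<close> with \<open>2^n \<ge> 2 / r\<close> serves, and
  \<open>ln 2 \<ge> 1/2\<close> accounts for the factor 2 before the logarithm.\<close>

lemma dyadic_scale:
  fixes r m :: real
  assumes "0 < m" "r \<le> 2 * m" "0 < r" "r < 1"
  obtains n where "1 / 2^n \<le> m" "real n \<le> 2 + 2 * ln (1 / r)"
proof -
  define n where "n = nat \<lceil>log 2 (2 / r)\<rceil>"
  have "1 \<le> log 2 (2 / r)" using assms by (simp add: field_simps)
  then have n: "log 2 (2 / r) \<le> real n" "real n < log 2 (2 / r) + 1"
    unfolding n_def by linarith+
  have "2 / r \<le> 2 powr (real n)" using n(1) assms by (simp add: log_le_iff)
  then have "2 / r \<le> 2^n" by (simp add: powr_realpow)
  moreover have "1 / m \<le> 2 / r" using assms by (simp add: field_simps)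
  ultimately have "1 / m \<le> 2^n" by linarith
  then have 1: "1 / 2^n \<le> m" using assms(1) by (simp add: field_simps)
  have l2: "(1/2::real) \<le> ln 2" using ln_le_minus_one[of "1/2"] by (simp add: ln_div)
  have l0: "0 \<le> ln (1 / r)" using assms by simp
  have "log 2 (2 / r) = 1 + log 2 (1 / r)" using assms by (simp add: log_divide)
  also have "log 2 (1 / r) \<le> ln (1 / r) / (1/2)"
    unfolding log_def using l0 l2 by (intro divide_left_mono) auto
  finally have "real n \<le> 2 + 2 * ln (1 / r)" using n(2) by simp
  with 1 show ?thesis by (rule that)
qed

text \<open>With \<open>L = ln (1 / r)\<close>, the bound on \<open>n\<close> gives
  \<open>ln (1 / t) \<le> C + e + e * L^2\<close> for \<open>e = 2^30 * (\<beta> / p)\<close>, whose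
  root is at most \<open>sqrt (C + e) + sqrt e * L\<close>. It remains to see that
  \<open>a * sqrt e \<le> s\<close>, which amounts to \<open>Ct \<le> 2^8\<close>; this follows from
  \<open>Ct \<le> 72\<close>.\<close>

lemma powr_le_gauge:
  fixes s \<beta> p Ct C r t :: real
  assumes pos: "s > 0" "\<beta> > 0" "p > 0" "Ct > 0" "Ct \<le> 72" "C \<ge> 0" and r: "0 < r" "r < 1"
    and t: "ln (1 / t) \<le> C + 2^27 * (\<beta> / p) * (real n)\<^sup>2" and n: "real n \<le> 2 + 2 * ln (1 / r)"
    and a: "a = 1/2^19 * sqrt (p * Ct) * s / sqrt \<beta>"
  shows "r powr s \<le> exp (a * sqrt (C + 2^30 * (\<beta> / p))) * exp (- a * sqrt (ln (1 / t)))"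
proof -
  define L where "L = ln (1 / r)"
  have L: "L > 0" using r by (simp add: L_def)
  define e where "e = 2^30 * (\<beta> / p)"
  have e: "e > 0" using pos by (simp add: e_def)
  have "(real n)\<^sup>2 \<le> (2 + 2 * L)\<^sup>2" using n by (intro power_mono) (simp_all add: L_def)
  also have "\<dots> \<le> 8 + 8 * L\<^sup>2"
    using sum_squares_bound[of 1 L] by (simp add: power2_sum power_mult_distrib)
  finally have "2^27 * (\<beta> / p) * (real n)\<^sup>2 \<le> 2^27 * (\<beta> / p) * (8 + 8 * L\<^sup>2)"
    using pos by (intro mult_left_mono) auto
  also have "\<dots> = e + e * L\<^sup>2" by (simp add: e_def algebra_simps add_divide_distrib)
  finally have "ln (1 / t) \<le> (C + e) + e * L\<^sup>2" using t by linarith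
  then have "sqrt (ln (1 / t)) \<le> sqrt ((C + e) + e * L\<^sup>2)" by (rule real_sqrt_le_mono)
  also have "\<dots> \<le> sqrt (C + e) + sqrt (e * L\<^sup>2)" using pos e by (intro sqrt_add_le_add_sqrt) auto
  also have "sqrt (e * L\<^sup>2) = sqrt e * L" using L by (simp add: real_sqrt_mult)
  finally have sq: "sqrt (ln (1 / t)) \<le> sqrt (C + e) + sqrt e * L" .
  have a0: "0 \<le> a" unfolding a using pos by simp
  have "a * sqrt e = s * (1/2^19 * (sqrt (p * Ct) * sqrt e / sqrt \<beta>))" unfolding a by simp
  also have "sqrt (p * Ct) * sqrt e / sqrt \<beta> = sqrt (Ct * 2^30)"
    using pos by (simp add: real_sqrt_mult[symmetric] real_sqrt_divide[symmetric] e_def)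
  also have "\<dots> \<le> sqrt ((2^19)\<^sup>2)" using pos by (intro real_sqrt_le_mono) simp
  also have "\<dots> = 2^19" by simp
  finally have "a * sqrt e \<le> s" using pos by simp
  then have "a * sqrt e * L \<le> s * L" using L by (intro mult_right_mono) auto
  moreover have "a * sqrt (ln (1 / t)) \<le> a * (sqrt (C + e) + sqrt e * L)"
    using sq a0 by (rule mult_left_mono)
  moreover have "a * (sqrt (C + e) + sqrt e * L) = a * sqrt (C + e) + a * sqrt e * L"
    by (simp add: algebra_simps)
  moreover have "s * ln r = - (s * L)" using r by (simp add: L_def ln_div)
  moreover have "- a * sqrt (ln (1 / t)) = - (a * sqrt (ln (1 / t)))" by simp
  ultimately have "s * ln r \<le> a * sqrt (C + e) + - a * sqrt (ln (1 / t))" by linarith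
  then show ?thesis using r by (simp add: powr_def exp_add[symmetric] e_def)
qed

text \<open>\<open>M\<close> and \<open>\<delta>\<close> depend on the point: \<open>M\<close>
  through the constant of the distance estimate, \<open>\<delta>\<close> through continuity of the
  inverse at \<open>f z\<close>.\<close>

lemma gauge_comparison_at_good_point:
  assumes hom: "homeomorphism UNIV UNIV f g"
    and K [measurable]: "K \<in> borel_measurable borel"
    and dm: "distortion_map (\<lambda>q. f (Complex (fst q) (snd q))) (\<lambda>z. (Re (g z), Im (g z))) gx gy
       (\<lambda>q. K (Complex (fst q) (snd q)))"
    and pos: "s > 0" "\<beta> > 0" "p > 0" "Ct > 0" "Ct \<le> 72"
    and fin: "\<And>R. (\<integral>\<^sup>+z. ennreal (exp (p * K z)) * indicator (cball 0 R) z \<partial>lborel) < \<infinity>"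
    and good: "\<And>k. k0 \<le> k \<Longrightarrow> (\<integral>\<^sup>+x. ennreal (exp (p * K x)) * indicator (csquare z (1/2^k)) x \<partial>lborel)
      \<le> ennreal (2 powr (- (real k * (2 - \<beta>))))"
  obtains M \<delta> where "0 < \<delta>"
    "\<And>y. y \<noteq> z \<Longrightarrow> dist (f y) (f z) < \<delta> \<Longrightarrow> dist y z powr s
      \<le> M * exp (- (1/2^19 * sqrt (p * Ct) * s / sqrt \<beta>) * sqrt (ln (1 / dist (f y) (f z))))"
proof -
  interpret D: distortion_map "\<lambda>q. f (Complex (fst q) (snd q))" "\<lambda>z. (Re (g z), Im (g z))" gx gy
    "\<lambda>q. K (Complex (fst q) (snd q))" by (rule dm)
  define a where "a = 1/2^19 * sqrt (p * Ct) * s / sqrt \<beta>"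
  have sq: "(\<integral>\<^sup>+x. ennreal (exp (p * K x)) * indicator (csquare z r) x \<partial>lborel)
    = (\<integral>\<^sup>+q. ennreal (exp (p * K (Complex (fst q) (snd q)))) * indicator (square (Re z, Im z) r) q \<partial>lborel)" for r
    by (rule nn_integral_csquare) measurable
  have "(\<integral>\<^sup>+x. ennreal (exp (p * K x)) * indicator (csquare z 1) x \<partial>lborel)
      \<le> (\<integral>\<^sup>+x. ennreal (exp (p * K x)) * indicator (cball 0 (norm z + 2)) x \<partial>lborel)"
  proof (intro nn_integral_mono mult_left_mono)
    fix x
    have "norm x \<le> norm z + 2" if "x \<in> csquare z 1"
    proof -
      have "norm (x - z) \<le> \<bar>Re (x - z)\<bar> + \<bar>Im (x - z)\<bar>" by (rule cmod_le)
      also have "\<dots> \<le> 2" using that by (simp add: csquare_def)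
      finally show ?thesis using norm_triangle_ineq2[of x z] by linarith
    qed
    then show "(indicator (csquare z 1) x :: ennreal) \<le> indicator (cball 0 (norm z + 2)) x"
      by (simp add: indicator_def)
  qed simp
  then have fin1: "(\<integral>\<^sup>+x. ennreal (exp (p * K x)) * indicator (csquare z 1) x \<partial>lborel) < \<infinity>"
    using fin by (rule order_le_less_trans)
  obtain C where C: "0 \<le> C" "\<And>q n. q \<noteq> (Re z, Im z) \<Longrightarrow>
      norm (f (Complex (fst q) (snd q)) - f (Complex (fst (Re z, Im z)) (snd (Re z, Im z)))) < 1 \<Longrightarrow>
      1/2^n \<le> max \<bar>fst q - fst (Re z, Im z)\<bar> \<bar>snd q - snd (Re z, Im z)\<bar> \<Longrightarrow>
      ln (1 / norm (f (Complex (fst q) (snd q)) - f (Complex (fst (Re z, Im z)) (snd (Re z, Im z)))))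
        \<le> C + 2^27 * (\<beta> / p) * (real n)\<^sup>2"
    using D.log_distance_at_good_point[OF pos(3,2) fin1[unfolded sq] good[unfolded sq]] by blast
  have "continuous_on UNIV g" using hom by (rule homeomorphism_cont2)
  then have "isCont g (f z)" by (simp add: continuous_on_eq_continuous_at)
  \<comment> \<open>Points whose images are close to \<open>f z\<close> lie within distance 1 of
    \<open>z\<close>, as \<open>dyadic_scale\<close> requires.\<close>
  then obtain d where d: "d > 0" "\<And>w. dist w (f z) < d \<Longrightarrow> dist (g w) (g (f z)) < 1"
    unfolding continuous_at_eps_delta by (metis zero_less_one)
  have gf: "g (f y) = y" for y using hom by (simp add: homeomorphism_def)
  show ?thesis
  proof (rule that[of "min d 1" "exp (a * sqrt (C + 2^30 * (\<beta> / p)))"])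
    show "0 < min d 1" using d by simp
    fix y assume y: "y \<noteq> z" "dist (f y) (f z) < min d 1"
    define m where "m = max \<bar>Re y - Re z\<bar> \<bar>Im y - Im z\<bar>"
    have r: "0 < dist y z" "dist y z < 1" using d(2)[of "f y"] y by (simp_all add: gf)
    have "dist y z \<le> \<bar>Re y - Re z\<bar> + \<bar>Im y - Im z\<bar>" using cmod_le[of "y - z"] by (simp add: dist_norm)
    then have rm: "dist y z \<le> 2 * m" by (auto simp: m_def max_def)
    then have "0 < m" using r by linarith
    then obtain n where n: "1 / 2^n \<le> m" "real n \<le> 2 + 2 * ln (1 / dist y z)"
      using rm r by (rule dyadic_scale)
    have "ln (1 / dist (f y) (f z)) \<le> C + 2^27 * (\<beta> / p) * (real n)\<^sup>2"
      using C(2)[of "(Re y, Im y)" n] y n(1) by (auto simp: m_def dist_norm complex_eq_iff)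
    then have "dist y z powr s \<le> exp (a * sqrt (C + 2^30 * (\<beta> / p))) * exp (- a * sqrt (ln (1 / dist (f y) (f z))))"
      by (rule powr_le_gauge[OF pos C(1) r _ n(2) a_def])
    then show "dist y z powr s \<le> exp (a * sqrt (C + 2^30 * (\<beta> / p)))
        * exp (- (1/2^19 * sqrt (p * Ct) * s / sqrt \<beta>) * sqrt (ln (1 / dist (f y) (f z))))"
      unfolding a_def .
  qed
qed

text \<open>The comparison constants vary with the point. Apart from the null set \<open>N\<close>
  of points of large density, \<open>A\<close> is therefore exhausted by countably many sets
  \<open>E m\<close> on which \<open>m + 1\<close> serves as the constant and its reciprocal as the
  radius; the pullback of covers applies to each.\<close>

lemma hausdorff_measure_eq_0_of_image:
  assumes "exp_integrable_distortion p f" and Ct: "modulus_constant Ct"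
    and p: "p > 0" and s: "s > 0" "s < 2" and \<epsilon>: "\<epsilon> > 0"
    and null: "hausdorff_gauge_measure (\<lambda>t. exp (- (1/2^19 * sqrt (p * Ct) * s / sqrt (2 - s + \<epsilon>)) * sqrt (ln (1 / t)))) (f ` A) = 0"
  shows "hausdorff_measure s A = 0"
proof -
  \<comment> \<open>With this \<open>\<beta>\<close> the density exponent \<open>2 - \<beta>\<close>
    equals \<open>s - \<epsilon>\<close>, for which the exceptional set is null in dimension
    \<open>s\<close>.\<close>
  define \<beta> where "\<beta> = 2 - s + \<epsilon>"
  have \<beta>: "\<beta> > 0" "2 - \<beta> = s - \<epsilon>" using s \<epsilon> by (simp_all add: \<beta>_def)
  have Ct': "Ct > 0" "Ct \<le> 72" using Ct modulus_constant_le by (simp_all add: modulus_constant_def)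
  obtain g gx gy K where hom: "homeomorphism UNIV UNIV f g" and K [measurable]: "K \<in> borel_measurable borel"
    and dm: "distortion_map (\<lambda>q. f (Complex (fst q) (snd q))) (\<lambda>z. (Re (g z), Im (g z))) gx gy
       (\<lambda>q. K (Complex (fst q) (snd q)))"
    and fin: "\<And>R. (\<integral>\<^sup>+z. ennreal (exp (p * K z)) * indicator (cball 0 R) z \<partial>lborel) < \<infinity>"
    using assms(1) p by (rule exp_integrable_distortionE) blast
  define a where "a = 1/2^19 * sqrt (p * Ct) * s / sqrt \<beta>"
  have a0: "0 \<le> a" unfolding a_def using p Ct' s \<beta> by simp
  define h where "h t = exp (- a * sqrt (ln (1 / t)))" for t
  have inj: "f x = f y \<Longrightarrow> x = y" for x y using hom by (metis UNIV_I homeomorphism_def)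
  define N where "N = {z. \<forall>m. \<exists>k\<ge>m. ennreal (2 powr (- (real k * (s - \<epsilon>)))) <
      (\<integral>\<^sup>+x. ennreal (exp (p * K x)) * indicator (csquare z (1/2^k)) x \<partial>lborel)}"
  have N: "hausdorff_measure s N = 0"
    unfolding N_def by (rule hausdorff_null_upper_density[OF _ fin s(1) \<epsilon>]) measurable
  define E where "E m = {z \<in> A. \<forall>y. y \<noteq> z \<longrightarrow> dist (f y) (f z) < 1 / real (Suc m) \<longrightarrow>
      dist y z powr s \<le> real (Suc m) * h (dist (f y) (f z))}" for m :: nat
  have E: "hausdorff_measure s (E m) = 0" for m
  proof (rule hausdorff_null_pullback[where d = "1 / real (Suc m)" and M = "real (Suc m)" and h = h and f = f])
    have "hausdorff_gauge_measure h (f ` A) = 0"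
      using null unfolding h_def a_def \<beta>_def .
    then show "hausdorff_gauge_measure h (f ` E m) = 0"
      by (rule hausdorff_gauge_measure_eq_0_mono) (auto simp: E_def)
    fix t u :: real assume tu: "0 < t" "t \<le> u" "u < 1 / real (Suc m)"
    have "1 / real (Suc m) \<le> 1" by simp
    then have "u < 1" using tu by linarith
    then have "ln (1 / u) \<le> ln (1 / t)" using tu by (intro ln_mono divide_left_mono) auto
    then have "a * sqrt (ln (1 / u)) \<le> a * sqrt (ln (1 / t))"
      using a0 by (intro mult_left_mono real_sqrt_le_mono)
    then show "h t \<le> h u" by (simp add: h_def)
  qed (use s inj in \<open>auto simp: E_def h_def\<close>)
  have cover: "A \<subseteq> (\<Union>n. case n of 0 \<Rightarrow> N | Suc m \<Rightarrow> E m)"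
  proof
    fix z assume "z \<in> A"
    show "z \<in> (\<Union>n. case n of 0 \<Rightarrow> N | Suc m \<Rightarrow> E m)"
    proof (cases "z \<in> N")
      case True
      then show ?thesis by (intro UN_I[of 0]) simp_all
    next
      case False
      then obtain k0 where "\<And>k. k0 \<le> k \<Longrightarrow> (\<integral>\<^sup>+x. ennreal (exp (p * K x)) * indicator (csquare z (1/2^k)) x \<partial>lborel)
          \<le> ennreal (2 powr (- (real k * (2 - \<beta>))))"
        unfolding N_def \<beta>(2) by (auto simp: not_less)
      from gauge_comparison_at_good_point[OF hom K dm s(1) \<beta>(1) p Ct' fin this]
      obtain M \<delta> where M: "0 < \<delta>" "\<And>y. y \<noteq> z \<Longrightarrow> dist (f y) (f z) < \<delta> \<Longrightarrow> dist y z powr s \<le> M * h (dist (f y) (f z))"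
        unfolding h_def a_def by blast
      obtain m :: nat where m: "max M (1 / \<delta>) \<le> real m" using real_arch_simple by blast
      have d: "1 / real (Suc m) \<le> \<delta>"
      proof -
        have "1 / \<delta> \<le> real (Suc m)" using m by simp
        then show ?thesis using M(1) by (simp add: field_simps)
      qed
      have "dist y z powr s \<le> real (Suc m) * h (dist (f y) (f z))"
        if "y \<noteq> z" "dist (f y) (f z) < 1 / real (Suc m)" for y
      proof -
        have "dist y z powr s \<le> M * h (dist (f y) (f z))" using that d by (intro M(2)) auto
        also have "\<dots> \<le> real (Suc m) * h (dist (f y) (f z))"
          using m by (intro mult_right_mono) (simp_all add: h_def)
        finally show ?thesis .
      qed
      then have "z \<in> E m" using \<open>z \<in> A\<close> by (simp add: E_def)
      then show ?thesis by (intro UN_I[of "Suc m"]) simp_all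
    qed
  qed
  have "hausdorff_measure s (case n of 0 \<Rightarrow> N | Suc m \<Rightarrow> E m) = 0" for n
    using N E by (cases n) simp_all
  then have "hausdorff_measure s (\<Union>n. case n of 0 \<Rightarrow> N | Suc m \<Rightarrow> E m) = 0"
    unfolding hausdorff_measure_def by (rule hausdorff_gauge_measure_UN_eq_0)
  then show ?thesis
    unfolding hausdorff_measure_def using cover by (rule hausdorff_gauge_measure_eq_0_mono)
qed

theorem theorem2:
  shows "\<exists>C>0. \<forall>Ct. modulus_constant Ct \<longrightarrow>
    (\<forall>p>0. \<exists>s\<^sub>0. 0 < s\<^sub>0 \<and> s\<^sub>0 < 2 \<and>
      (\<forall>s \<epsilon> f. s\<^sub>0 < s \<and> s < 2 \<and> \<epsilon> > 0 \<and> exp_integrable_distortion p f \<longrightarrow>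
        (\<forall>A :: complex set.
           hausdorff_gauge_measure
             (\<lambda>t. exp (- (C * sqrt (p * Ct) * s / sqrt (2 - s + \<epsilon>)) * sqrt (ln (1 / t)))) (f ` A) = 0
           \<longrightarrow> hausdorff_measure s A = 0)))"
proof (rule exI[of _ "1/2^19"], intro conjI allI impI)
  fix Ct p :: real assume "modulus_constant Ct" "p > 0"
  \<comment> \<open>The witness for the lower limit is 1:
    \<open>hausdorff_measure_eq_0_of_image\<close> covers every \<open>s\<close> strictly between 0
    and 2.\<close>
  then show "\<exists>s\<^sub>0. 0 < s\<^sub>0 \<and> s\<^sub>0 < 2 \<and>
      (\<forall>s \<epsilon> f. s\<^sub>0 < s \<and> s < 2 \<and> \<epsilon> > 0 \<and> exp_integrable_distortion p f \<longrightarrow>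
        (\<forall>A :: complex set.
           hausdorff_gauge_measure
             (\<lambda>t. exp (- (1/2^19 * sqrt (p * Ct) * s / sqrt (2 - s + \<epsilon>)) * sqrt (ln (1 / t)))) (f ` A) = 0
           \<longrightarrow> hausdorff_measure s A = 0))"
    using hausdorff_measure_eq_0_of_image[of p _ Ct]
    by (intro exI[of _ 1]) (auto simp del: power_one_over)
qed simp

end
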